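(* Let $(\Omega^{(\bullet,\bullet)},\bar\partial,\partial)$ be an $A$-covariant differential $*$-calculus with a complex structure over $M$. Let $(\mathcal F,\bar\partial_{\mathcal F},h)$ be an $A$-covariant Hermitian holomorphic vector bundle, and consider the degree one map $$\partial_{\mathcal F}:=C_h^{-1}\circ\bar\partial_{{}^\vee\mathcal F}\circ C_h:\ \Omega^{(\bullet,0)}\otimes_M\mathcal F\to\Omega^{(\bullet,0)}\otimes_M\mathcal F .$$ The map $\partial_{\mathcal F}$ is an anti-holomorphic structure for $\mathcal F$, and the map $\nabla:=\bar\partial_{\mathcal F}+\partial_{\mathcal F}$ is the Chern connection of the triple $(\mathcal F,\bar\partial_{\mathcal F},h)$.
   Context: **Calculi.** Everything is over $\mathbb C$. $A$ is a fixed Hopf $*$-algebra; left coactions are written $v\mapsto v_{(-1)}\otimes v_{(0)}$. An $A$-comodule $*$-algebra is a unital $*$-algebra $M$ with a left $A$-coaction that is an algebra map and commutes with $*$. An $A$-covariant differential $*$-calculus over $M$ is a graded algebra $\Omega^\bullet=\bigoplus_{k\ge 0}\Omega^k$ (product $\wedge$) with $\Omega^0=M$, a degree one map $d$ with $d^2=0$ satisfying the graded Leibniz rule, generated by $M$ as a dg algebra, with a conjugate-linear involution $*$ extending that of $M$, $(d\omega)^*=d(\omega^* )$, $(\omega\wedge\nu)^*=(-1)^{|\omega||\nu|}\nu^*\wedge\omega^*$, and a graded left $A$-coaction compatible with product, $d$ and $*$. A complex structure is an algebra $\mathbb N_0^2$-grading $\Omega^{(a,b)}$ with $\Omega^k=\bigoplus_{a+b=k}\Omega^{(a,b)}$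 (as $A$-comodules and $M$-bimodules), $(\Omega^{(a,b)})^*=\Omega^{(b,a)}$ and $d=\partial+\bar\partial$, where $\partial,\bar\partial$ are the components of $d$ of bidegree $(1,0),(0,1)$. **Bundles.** A vector bundle $\mathcal F$ is a left $M$-module, finitely generated projective, with a compatible left $A$-coaction; ${}^\vee\mathcal F$ is the right $M$-module of left $M$-linear maps $\mathcal F\to M$ (with coaction $\phi_{(-1)}\otimes\phi_{(0)}(f)=S(f_{(-1)})\phi(f_{(0)})_{(-1)}\otimes\phi(f_{(0)})_{(0)}$). A left holomorphic structure is an $A$-comodule map $\bar\partial_{\mathcal F}:\mathcal F\to\Omega^{(0,1)}\otimes_M\mathcal F$ with $\bar\partial_{\mathcal F}(mf)=\bar\partial m\otimes f+m\bar\partial_{\mathcal F}f$ whose extension $\bar\partial_{\mathcal F}(\omega\otimes f)=\bar\partial\omega\otimes f+(-1)^{|\omega|}\omega\wedge\bar\partial_{\mathcal F}f$ squares to zero; an anti-holomorphic structure is the same with $(\Omega^{(\bullet,0)},\partial)$ in place of $(\Omega^{(0,\bullet)},\bar\partial)$. The evaluation pairing is $(\omega\otimes f)\wedge_{\mathrm{ev}}(\phi\otimes\nu)=\omega\,\phi(f)\wedge\nu$. The dual structure $\bar\partial_{{}^\vee\mathcal F}:{}^\vee\mathcal F\to{}^\vee\mathcal F\otimes_M\Omega^{(0,1)}$ is determined by $f\wedge_{\mathrm{ev}}\bar\partial_{{}^\vee\mathcal F}(\phi)=\bar\partial(\phi(f))-\bar\partial_{\mathcal F}(f)\wedge_{\mathrm{ev}}\phi$,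 extended by $\bar\partial_{{}^\vee\mathcal F}(\phi\otimes\omega)=\bar\partial_{{}^\vee\mathcal F}(\phi)\wedge\omega+\phi\otimes\bar\partial\omega$. **Hermitian structures.** A Hermitian structure is an isomorphism of right $M$-modules and $A$-comodules $h:\overline{\mathcal F}\to{}^\vee\mathcal F$ with $h(\overline f)(g)=h(\overline g)(f)^*$; $\overline{\mathcal F}$ is the conjugate vector space with $\overline f\,m=\overline{m^*f}$ and coaction $\overline f\mapsto (f_{(-1)})^*\otimes\overline{f_{(0)}}$. $C_h:\Omega^\bullet\otimes_M\mathcal F\to{}^\vee\mathcal F\otimes_M\Omega^\bullet$ is the $\mathbb R$-linear isomorphism $C_h(\omega\otimes f)=h(\overline f)\otimes\omega^*$. Put $\mathfrak h(\omega\otimes f,\nu\otimes g)=\omega\,h(\overline g)(f)\wedge\nu^*$. An $A$-covariant connection is an $A$-comodule map $\nabla:\mathcal F\to\Omega^1\otimes_M\mathcal F$ with $\nabla(mf)=dm\otimes f+m\nabla f$; it is Hermitian if $d\,\mathfrak h(f,g)=\mathfrak h(\nabla f,g)+\mathfrak h(f,\nabla g)$ for all $f,g\in\mathcal F$. The Chern connection of $(\mathcal F,\bar\partial_{\mathcal F},h)$ is the unique $A$-covariant Hermitian connection on $\mathcal F$ whose $(0,1)$-part is $\bar\partial_{\mathcal F}$. *)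

theory Defs
  imports Complex_Main "HOL-Library.Poly_Mapping" "HOL-Library.Function_Algebras"
begin

section \<open>Complex vector spaces and algebras\<close>

class scaleC =
  fixes scaleC :: "complex \<Rightarrow> 'a \<Rightarrow> 'a" (infixr "*\<^sub>C" 75)

class complex_vector = scaleC + ab_group_add +
  assumes scaleC_add_right: "c *\<^sub>C (x + y) = c *\<^sub>C x + c *\<^sub>C y"
    and scaleC_add_left: "(c + e) *\<^sub>C x = c *\<^sub>C x + e *\<^sub>C x"
    and scaleC_scaleC: "c *\<^sub>C e *\<^sub>C x = (c * e) *\<^sub>C x"
    and scaleC_one: "1 *\<^sub>C x = x"

text \<open>Unital associative algebras. There is no axiom \<open>0 \<noteq> 1\<close>, so the zero algebra is allowed.\<close>

class complex_algebra = complex_vector + ring + monoid_mult +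
  assumes mult_scaleC_left: "(c *\<^sub>C x) * y = c *\<^sub>C (x * y)"
    and mult_scaleC_right: "x * (c *\<^sub>C y) = c *\<^sub>C (x * y)"

interpretation complex_vector: vector_space "scaleC :: complex \<Rightarrow> 'a \<Rightarrow> 'a::complex_vector"
  by standard (simp_all add: scaleC_add_right scaleC_add_left scaleC_scaleC scaleC_one)

interpretation complex_vector: vector_space_pair
  "scaleC :: complex \<Rightarrow> 'a \<Rightarrow> 'a::complex_vector" "scaleC :: complex \<Rightarrow> 'b \<Rightarrow> 'b::complex_vector"
  ..

abbreviation clinear :: "('a::complex_vector \<Rightarrow> 'b::complex_vector) \<Rightarrow> bool" where
  "clinear \<equiv> Vector_Spaces.linear scaleC scaleC"

abbreviation cspan :: "'a::complex_vector set \<Rightarrow> 'a set" where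
  "cspan \<equiv> complex_vector.span"

abbreviation csubspace :: "'a::complex_vector set \<Rightarrow> bool" where
  "csubspace \<equiv> complex_vector.subspace"

definition antilinear :: "('a::complex_vector \<Rightarrow> 'b::complex_vector) \<Rightarrow> bool" where
  "antilinear f \<longleftrightarrow> (\<forall>x y. f (x + y) = f x + f y) \<and> (\<forall>c x. f (c *\<^sub>C x) = cnj c *\<^sub>C f x)"

instantiation complex :: complex_vector
begin
definition scaleC_complex_def: "scaleC c (z::complex) = c * z"
instance by standard (simp_all add: scaleC_complex_def algebra_simps)
end

instantiation "fun" :: (type, complex_vector) complex_vector
begin
definition scaleC_fun_def: "scaleC c f = (\<lambda>x. c *\<^sub>C f x)"
instance
  by standard (simp_all add: scaleC_fun_def fun_eq_iff scaleC_add_right scaleC_add_left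
      scaleC_scaleC scaleC_one)
end

instantiation poly_mapping :: (type, complex_vector) complex_vector
begin
definition scaleC_poly_mapping_def: "scaleC c p = Poly_Mapping.map (scaleC c) p"

lemma lookup_scaleC:
  "Poly_Mapping.lookup (scaleC c p) k = c *\<^sub>C Poly_Mapping.lookup p k"
  by (simp add: scaleC_poly_mapping_def Poly_Mapping.map.rep_eq when_def
      complex_vector.scale_zero_right)

instance
  by standard (simp_all add: poly_mapping_eq_iff fun_eq_iff lookup_scaleC lookup_add
      scaleC_add_right scaleC_add_left scaleC_scaleC scaleC_one)
end


section \<open>Tensor products over the complex numbers\<close>

text \<open>The free vector space on pairs modulo the bilinearity relations.\<close>

definition tensor_relations ::
    "('a::complex_vector \<times> 'b::complex_vector \<Rightarrow>\<^sub>0 complex) set" where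
  "tensor_relations =
     {Poly_Mapping.single (x + x', y) 1 - Poly_Mapping.single (x, y) 1
        - Poly_Mapping.single (x', y) 1 | x x' y. True}
   \<union> {Poly_Mapping.single (x, y + y') 1 - Poly_Mapping.single (x, y) 1
        - Poly_Mapping.single (x, y') 1 | x y y'. True}
   \<union> {Poly_Mapping.single (c *\<^sub>C x, y) 1 - c *\<^sub>C Poly_Mapping.single (x, y) 1 | c x y. True}
   \<union> {Poly_Mapping.single (x, c *\<^sub>C y) 1 - c *\<^sub>C Poly_Mapping.single (x, y) 1 | c x y. True}"

quotient_type (overloaded) ('a, 'b) ctensor (infixr "\<otimes>\<^sub>C" 71) =
  "('a::complex_vector \<times> 'b::complex_vector) \<Rightarrow>\<^sub>0 complex" /
  "\<lambda>p q. p - q \<in> cspan tensor_relations"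
proof (rule equivpI)
  show "reflp (\<lambda>p q. p - q \<in> cspan (tensor_relations :: ('a \<times> 'b \<Rightarrow>\<^sub>0 complex) set))"
    by (rule reflpI) (simp add: complex_vector.span_zero)
  show "symp (\<lambda>p q. p - q \<in> cspan (tensor_relations :: ('a \<times> 'b \<Rightarrow>\<^sub>0 complex) set))"
    by (rule sympI) (metis complex_vector.span_neg minus_diff_eq)
  show "transp (\<lambda>p q. p - q \<in> cspan (tensor_relations :: ('a \<times> 'b \<Rightarrow>\<^sub>0 complex) set))"
    by (rule transpI) (metis (no_types, lifting) complex_vector.span_add diff_add_cancel
        add_diff_eq)
qed

instantiation ctensor :: (complex_vector, complex_vector) complex_vector
begin

lift_definition zero_ctensor :: "'a \<otimes>\<^sub>C 'b" is 0 .

lift_definition plus_ctensor :: "'a \<otimes>\<^sub>C 'b \<Rightarrow> 'a \<otimes>\<^sub>C 'b \<Rightarrow> 'a \<otimes>\<^sub>C 'b" is "(+)"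
  by (metis add_diff_add complex_vector.span_add)

lift_definition minus_ctensor :: "'a \<otimes>\<^sub>C 'b \<Rightarrow> 'a \<otimes>\<^sub>C 'b \<Rightarrow> 'a \<otimes>\<^sub>C 'b" is "(-)"
proof -
  fix p p' q q' :: "'a \<times> 'b \<Rightarrow>\<^sub>0 complex"
  assume "p - p' \<in> cspan tensor_relations" "q - q' \<in> cspan tensor_relations"
  then have "(p - p') - (q - q') \<in> cspan tensor_relations"
    by (rule complex_vector.span_diff)
  then show "p - q - (p' - q') \<in> cspan tensor_relations"
    by (simp add: algebra_simps)
qed

lift_definition uminus_ctensor :: "'a \<otimes>\<^sub>C 'b \<Rightarrow> 'a \<otimes>\<^sub>C 'b" is uminus
  by (metis complex_vector.span_neg minus_diff_minus)

lift_definition scaleC_ctensor :: "complex \<Rightarrow> 'a \<otimes>\<^sub>C 'b \<Rightarrow> 'a \<otimes>\<^sub>C 'b" is scaleC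
  by (metis complex_vector.span_scale complex_vector.scale_right_diff_distrib)

instance
  by standard (transfer, simp add: complex_vector.span_zero algebra_simps scaleC_add_right
      scaleC_add_left scaleC_scaleC scaleC_one)+

end

lift_definition tensor :: "'a::complex_vector \<Rightarrow> 'b::complex_vector \<Rightarrow> 'a \<otimes>\<^sub>C 'b"
    (infixr "\<otimes>\<^sub>C" 72)
  is "\<lambda>x y. Poly_Mapping.single (x, y) 1" .

text \<open>\<open>tensor_space X Y\<close> is \<open>X \<otimes> Y\<close>, viewed inside the tensor product of the ambient spaces.\<close>

definition tensor_space ::
    "'a::complex_vector set \<Rightarrow> 'b::complex_vector set \<Rightarrow> ('a \<otimes>\<^sub>C 'b) set" where
  "tensor_space X Y = cspan {x \<otimes>\<^sub>C y | x y. x \<in> X \<and> y \<in> Y}"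

text \<open>
  The additive map on \<open>X \<otimes> Y\<close> with \<open>x \<otimes> y \<mapsto> b x y\<close>, for \<open>b\<close> biadditive with
  \<open>b (c x) y = b x (c y)\<close> on subspaces \<open>X\<close> and \<open>Y\<close>. The map \<open>b\<close> may be conjugate-linear in both
  arguments, which is why the scalars are placed inside \<open>b\<close>.
\<close>

definition tensor_lift_on :: "'a::complex_vector set \<Rightarrow> 'b::complex_vector set \<Rightarrow>
    ('a \<Rightarrow> 'b \<Rightarrow> 'c::ab_group_add) \<Rightarrow> 'a \<otimes>\<^sub>C 'b \<Rightarrow> 'c" where
  "tensor_lift_on X Y b t =
     (let p = (SOME p. abs_ctensor p = t \<and> Poly_Mapping.keys p \<subseteq> X \<times> Y)
      in \<Sum>(x, y)\<in>Poly_Mapping.keys p. b (Poly_Mapping.lookup p (x, y) *\<^sub>C x) y)"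

abbreviation tensor_lift ::
    "('a::complex_vector \<Rightarrow> 'b::complex_vector \<Rightarrow> 'c::ab_group_add) \<Rightarrow> 'a \<otimes>\<^sub>C 'b \<Rightarrow> 'c" where
  "tensor_lift \<equiv> tensor_lift_on UNIV UNIV"

definition tensor_map :: "('a::complex_vector \<Rightarrow> 'c::complex_vector) \<Rightarrow>
    ('b::complex_vector \<Rightarrow> 'd::complex_vector) \<Rightarrow> 'a \<otimes>\<^sub>C 'b \<Rightarrow> 'c \<otimes>\<^sub>C 'd" where
  "tensor_map f g = tensor_lift (\<lambda>x y. f x \<otimes>\<^sub>C g y)"

definition tensor_assoc :: "('a::complex_vector \<otimes>\<^sub>C 'b::complex_vector) \<otimes>\<^sub>C 'c::complex_vector
    \<Rightarrow> 'a \<otimes>\<^sub>C 'b \<otimes>\<^sub>C 'c" where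
  "tensor_assoc = tensor_lift (\<lambda>s z. tensor_lift (\<lambda>x y. x \<otimes>\<^sub>C y \<otimes>\<^sub>C z) s)"

text \<open>\<open>(a \<otimes> x) (b \<otimes> y) = a b \<otimes> m x y\<close> for \<open>x\<close> in a subspace \<open>X\<close> on which \<open>m\<close> is linear.\<close>

definition tensor_mult_on :: "'x::complex_vector set \<Rightarrow> ('x \<Rightarrow> 'y::complex_vector \<Rightarrow> 'z::complex_vector) \<Rightarrow>
    'a::complex_algebra \<otimes>\<^sub>C 'x \<Rightarrow> 'a \<otimes>\<^sub>C 'y \<Rightarrow> 'a \<otimes>\<^sub>C 'z" where
  "tensor_mult_on X m s t =
     tensor_lift_on UNIV X (\<lambda>a x. tensor_lift (\<lambda>b y. (a * b) \<otimes>\<^sub>C m x y) t) s"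

abbreviation tensor_mult :: "('x::complex_vector \<Rightarrow> 'y::complex_vector \<Rightarrow> 'z::complex_vector) \<Rightarrow>
    'a::complex_algebra \<otimes>\<^sub>C 'x \<Rightarrow> 'a \<otimes>\<^sub>C 'y \<Rightarrow> 'a \<otimes>\<^sub>C 'z" where
  "tensor_mult \<equiv> tensor_mult_on UNIV"


section \<open>Balanced tensor products\<close>

text \<open>
  A quotient \<open>V / N\<close> is realised inside \<open>V\<close>: \<open>quot_proj N\<close> is a chosen linear projection with kernel
  \<open>N\<close>, so that \<open>v + N \<mapsto> quot_proj N v\<close> identifies \<open>V / N\<close> with the range of \<open>quot_proj N\<close>.
\<close>

definition quot_proj :: "'a::complex_vector set \<Rightarrow> 'a \<Rightarrow> 'a" where
  "quot_proj N = (SOME p. clinear p \<and> (\<forall>v. p (p v) = p v) \<and> {v. p v = 0} = N)"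

text \<open>
  \<open>X \<otimes>\<^sub>M Y\<close> for a right \<open>M\<close>-module \<open>X\<close> (action \<open>r\<close>) and a left \<open>M\<close>-module \<open>Y\<close> (action \<open>l\<close>) is the
  quotient of \<open>tensor_space X Y\<close> by the following subspace. Since the chosen representative of a
  class lies in the class, the map on \<open>X \<otimes>\<^sub>M Y\<close> induced by an \<open>M\<close>-balanced \<open>b\<close> is just
  \<open>tensor_lift_on X Y b\<close>.
\<close>

definition balancing_relations :: "'m set \<Rightarrow> 'x::complex_vector set \<Rightarrow> ('x \<Rightarrow> 'm \<Rightarrow> 'x) \<Rightarrow>
    'y::complex_vector set \<Rightarrow> ('m \<Rightarrow> 'y \<Rightarrow> 'y) \<Rightarrow> ('x \<otimes>\<^sub>C 'y) set" where
  "balancing_relations M X r Y l =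
     cspan {r x m \<otimes>\<^sub>C y - x \<otimes>\<^sub>C l m y | x m y. x \<in> X \<and> m \<in> M \<and> y \<in> Y}"

definition tensor_over :: "'m set \<Rightarrow> 'x::complex_vector set \<Rightarrow> ('x \<Rightarrow> 'm \<Rightarrow> 'x) \<Rightarrow>
    'y::complex_vector set \<Rightarrow> ('m \<Rightarrow> 'y \<Rightarrow> 'y) \<Rightarrow> 'x \<Rightarrow> 'y \<Rightarrow> 'x \<otimes>\<^sub>C 'y" where
  "tensor_over M X r Y l x y = quot_proj (balancing_relations M X r Y l) (x \<otimes>\<^sub>C y)"


subsection \<open>Universal properties\<close>

lemma exists_linear_projection_onto:
  fixes N :: "'a::complex_vector set"
  assumes "csubspace N"
  shows "\<exists>g :: 'a \<Rightarrow> 'a. clinear g \<and> range g \<subseteq> N \<and> (\<forall>v\<in>N. g v = v)"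
  using complex_vector.linear_exists_left_inverse_on[of "\<lambda>v::'a. v" N] assms
    complex_vector.linear_ident by auto

lemma quot_proj:
  fixes N :: "'a::complex_vector set"
  assumes "csubspace N"
  shows "clinear (quot_proj N)" and "quot_proj N (quot_proj N v) = quot_proj N v"
    and "quot_proj N v = 0 \<longleftrightarrow> v \<in> N"
proof -
  obtain g :: "'a \<Rightarrow> 'a" where g: "clinear g" "range g \<subseteq> N" "\<And>v. v \<in> N \<Longrightarrow> g v = v"
    using exists_linear_projection_onto[OF assms] by blast
  define p where "p = (\<lambda>v. v - g v)"
  have lin: "clinear p"
    unfolding p_def by (intro complex_vector.linear_compose_sub complex_vector.linear_ident g)
  have gN: "g v \<in> N" for v using g(2) by auto
  have idem: "p (p v) = p v" for v
    using g(3)[OF gN] by (simp add: p_def complex_vector.linear_diff[OF g(1)])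
  have ker: "{v. p v = 0} = N"
    using g(3) gN by (auto simp: p_def) (metis)
  have "clinear (quot_proj N) \<and> (\<forall>v. quot_proj N (quot_proj N v) = quot_proj N v)
      \<and> {v. quot_proj N v = 0} = N"
    unfolding quot_proj_def by (rule someI[of _ p]) (use lin idem ker in auto)
  then show "clinear (quot_proj N)" "quot_proj N (quot_proj N v) = quot_proj N v"
    "quot_proj N v = 0 \<longleftrightarrow> v \<in> N" by auto
qed

lemma tensor_add_left: "(x + x') \<otimes>\<^sub>C y = x \<otimes>\<^sub>C y + x' \<otimes>\<^sub>C y"
  by transfer (rule complex_vector.span_base, unfold tensor_relations_def diff_diff_eq[symmetric], blast)

lemma tensor_add_right: "x \<otimes>\<^sub>C (y + y') = x \<otimes>\<^sub>C y + x \<otimes>\<^sub>C y'"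
  by transfer (rule complex_vector.span_base, unfold tensor_relations_def diff_diff_eq[symmetric], blast)

lemma tensor_scaleC_left: "(c *\<^sub>C x) \<otimes>\<^sub>C y = c *\<^sub>C (x \<otimes>\<^sub>C y)"
  by transfer (rule complex_vector.span_base, unfold tensor_relations_def, blast)

lemma tensor_scaleC_right: "x \<otimes>\<^sub>C (c *\<^sub>C y) = c *\<^sub>C (x \<otimes>\<^sub>C y)"
  by transfer (rule complex_vector.span_base, unfold tensor_relations_def, blast)

definition balanced_on :: "'a::complex_vector set \<Rightarrow> 'b::complex_vector set \<Rightarrow>
    ('a \<Rightarrow> 'b \<Rightarrow> 'c::ab_group_add) \<Rightarrow> bool" where
  "balanced_on X Y b \<longleftrightarrow>
     (\<forall>x\<in>X. \<forall>x'\<in>X. \<forall>y\<in>Y. b (x + x') y = b x y + b x' y) \<and>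
     (\<forall>x\<in>X. \<forall>y\<in>Y. \<forall>y'\<in>Y. b x (y + y') = b x y + b x y') \<and>
     (\<forall>c. \<forall>x\<in>X. \<forall>y\<in>Y. b (c *\<^sub>C x) y = b x (c *\<^sub>C y))"

definition formal_eval :: "('a::complex_vector \<Rightarrow> 'b::complex_vector \<Rightarrow> 'c::ab_group_add) \<Rightarrow>
    ('a \<times> 'b \<Rightarrow>\<^sub>0 complex) \<Rightarrow> 'c" where
  "formal_eval b p = (\<Sum>(x, y)\<in>Poly_Mapping.keys p. b (Poly_Mapping.lookup p (x, y) *\<^sub>C x) y)"

lemma formal_eval_superset:
  assumes b0: "\<And>y. b 0 y = 0" and "finite S" "Poly_Mapping.keys p \<subseteq> S"
  shows "formal_eval b p = (\<Sum>(x, y)\<in>S. b (Poly_Mapping.lookup p (x, y) *\<^sub>C x) y)"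
  unfolding formal_eval_def using assms
  by (intro sum.mono_neutral_left) (auto simp: in_keys_iff)

lemma formal_eval_add:
  assumes b: "balanced_on UNIV UNIV b"
  shows "formal_eval b (p + q) = formal_eval b p + formal_eval b q"
proof -
  have add: "b (x + x') y = b x y + b x' y" for x x' y using b by (auto simp: balanced_on_def)
  have b0: "b 0 y = 0" for y using add[of 0 0 y] by simp
  let ?S = "Poly_Mapping.keys p \<union> Poly_Mapping.keys q"
  have "Poly_Mapping.keys (p + q) \<subseteq> ?S" by (rule Poly_Mapping.keys_add)
  then show ?thesis
    by (simp add: formal_eval_superset[where b = b, OF b0, of ?S] sum.distrib[symmetric] case_prod_unfold
        lookup_add scaleC_add_left add)
qed

lemma formal_eval_single:
  assumes b0: "\<And>y. b 0 y = 0"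
  shows "formal_eval b (Poly_Mapping.single (x, y) c) = b (c *\<^sub>C x) y"
  by (subst formal_eval_superset[where b = b, OF b0, of "{(x, y)}"]) auto

lemma scaleC_single: "c *\<^sub>C Poly_Mapping.single k (e::complex) = Poly_Mapping.single k (c * e)"
  by (rule poly_mapping_eqI) (auto simp: lookup_scaleC lookup_single when_def scaleC_complex_def)

lemma formal_eval_relations:
  assumes b: "balanced_on UNIV UNIV b" and p: "p \<in> cspan tensor_relations"
  shows "formal_eval b p = 0"
  using p
proof (induction rule: complex_vector.span_induct_alt)
  have add: "b (x + x') y = b x y + b x' y" for x x' y using b by (auto simp: balanced_on_def)
  have addr: "b x (y + y') = b x y + b x y'" for x y y' using b by (auto simp: balanced_on_def)
  have bal: "b (c *\<^sub>C x) y = b x (c *\<^sub>C y)" for c x y using b by (auto simp: balanced_on_def)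
  have b0: "b 0 y = 0" for y using add[of 0 0 y] by simp
  show "formal_eval b 0 = 0" by (simp add: formal_eval_def)
  have minus: "formal_eval b (p - q) = formal_eval b p - formal_eval b q" for p q
    using formal_eval_add[OF b, of "p - q" q] by simp
  fix c :: complex and q r :: "'a \<times> 'b \<Rightarrow>\<^sub>0 complex"
  assume q: "q \<in> tensor_relations" and r: "formal_eval b r = 0"
  have "formal_eval b (c *\<^sub>C q) = 0"
    using q by (auto simp: tensor_relations_def complex_vector.scale_right_diff_distrib
        minus formal_eval_single[where b = b, OF b0] scaleC_single scaleC_add_right add addr
        scaleC_scaleC) (metis bal mult.commute scaleC_scaleC)+
  then show "formal_eval b (c *\<^sub>C q + r) = 0"
    using r by (simp add: formal_eval_add[OF b])
qed
lemma tensor_lift_on_abs: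
  assumes X: "csubspace X" and Y: "csubspace Y" and b: "balanced_on X Y b"
    and p: "Poly_Mapping.keys p \<subseteq> X \<times> Y"
  shows "tensor_lift_on X Y b (abs_ctensor p) = formal_eval b p"
proof -
  obtain f where f: "clinear f" "range f \<subseteq> X" "\<And>v. v \<in> X \<Longrightarrow> f v = v"
    using exists_linear_projection_onto[OF X] by blast
  obtain g where g: "clinear g" "range g \<subseteq> Y" "\<And>v. v \<in> Y \<Longrightarrow> g v = v"
    using exists_linear_projection_onto[OF Y] by blast
  define b' where "b' = (\<lambda>x y. b (f x) (g y))"
  have fX: "f x \<in> X" and gY: "g y \<in> Y" for x y using f g by auto
  have b': "balanced_on UNIV UNIV b'"
    using b fX gY by (simp add: balanced_on_def b'_def complex_vector.linear_add[OF f(1)]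
        complex_vector.linear_add[OF g(1)] complex_vector.linear_scale[OF f(1)]
        complex_vector.linear_scale[OF g(1)])
  have eq: "formal_eval b q = formal_eval b' q" if "Poly_Mapping.keys q \<subseteq> X \<times> Y" for q
    unfolding formal_eval_def b'_def using that
    by (intro sum.cong refl) (auto simp: f(3) g(3) complex_vector.subspace_scale[OF X] subset_iff)
  define q where "q = (SOME q. abs_ctensor q = abs_ctensor p \<and> Poly_Mapping.keys q \<subseteq> X \<times> Y)"
  have q: "abs_ctensor q = abs_ctensor p" "Poly_Mapping.keys q \<subseteq> X \<times> Y"
    using someI[of "\<lambda>q. abs_ctensor q = abs_ctensor p \<and> Poly_Mapping.keys q \<subseteq> X \<times> Y" p] p
    by (auto simp: q_def)
  have "q - p \<in> cspan tensor_relations"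
    using q(1) by (simp add: ctensor.abs_eq_iff)
  then have "formal_eval b' (q - p) = 0" by (rule formal_eval_relations[OF b'])
  then have "formal_eval b' q = formal_eval b' p"
    using formal_eval_add[OF b', of "q - p" p] by simp
  then have "formal_eval b q = formal_eval b p" using eq p q(2) by simp
  then show ?thesis
    unfolding tensor_lift_on_def Let_def q_def[symmetric] formal_eval_def[symmetric] .
qed

lemma tensor_space_rep:
  assumes X: "csubspace X" and Y: "csubspace Y" and t: "t \<in> tensor_space X Y"
  obtains p where "t = abs_ctensor p" "Poly_Mapping.keys p \<subseteq> X \<times> Y"
proof -
  have "\<exists>p. t = abs_ctensor p \<and> Poly_Mapping.keys p \<subseteq> X \<times> Y"
    using t unfolding tensor_space_def
  proof (induction rule: complex_vector.span_induct_alt)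
    case base
    show ?case by (rule exI[of _ 0]) (simp add: zero_ctensor.abs_eq)
  next
    case (step c u v)
    then obtain x y p where u: "u = x \<otimes>\<^sub>C y" "x \<in> X" "y \<in> Y"
      and p: "v = abs_ctensor p" "Poly_Mapping.keys p \<subseteq> X \<times> Y" by blast
    have "c *\<^sub>C u + v = abs_ctensor (Poly_Mapping.single (x, y) c + p)"
      using u p by (simp add: tensor.abs_eq scaleC_ctensor.abs_eq plus_ctensor.abs_eq scaleC_single)
    moreover have "Poly_Mapping.keys (Poly_Mapping.single (x, y) c + p) \<subseteq> X \<times> Y"
      using Poly_Mapping.keys_add[of "Poly_Mapping.single (x, y) c" p] u p by (auto split: if_splits)
    ultimately show ?case by blast
  qed
  then show ?thesis using that by blast
qed

text \<open>The universal property of \<^const>\<open>tensor_space\<close>.\<close>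

lemma tensor_lift_on_tensor:
  assumes "csubspace X" "csubspace Y" "balanced_on X Y b" "x \<in> X" "y \<in> Y"
  shows "tensor_lift_on X Y b (x \<otimes>\<^sub>C y) = b x y"
proof -
  have "tensor_lift_on X Y b (x \<otimes>\<^sub>C y) = formal_eval b (Poly_Mapping.single (x, y) 1)"
    using assms by (simp add: tensor.abs_eq tensor_lift_on_abs)
  also have "\<dots> = b x y"
    by (simp add: formal_eval_def scaleC_one)
  finally show ?thesis .
qed

lemma tensor_lift_on_add:
  assumes X: "csubspace X" and Y: "csubspace Y" and b: "balanced_on X Y b"
    and "s \<in> tensor_space X Y" "t \<in> tensor_space X Y"
  shows "tensor_lift_on X Y b (s + t) = tensor_lift_on X Y b s + tensor_lift_on X Y b t"
proof -
  obtain p q where p: "s = abs_ctensor p" "Poly_Mapping.keys p \<subseteq> X \<times> Y"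
    and q: "t = abs_ctensor q" "Poly_Mapping.keys q \<subseteq> X \<times> Y"
    using tensor_space_rep[OF X Y] assms(4,5) by metis
  have add: "b (x + x') y = b x y + b x' y" if "x \<in> X" "x' \<in> X" "y \<in> Y" for x x' y
    using b that by (auto simp: balanced_on_def)
  have b0: "b 0 y = 0" if "y \<in> Y" for y
    using add[of 0 0 y] that complex_vector.subspace_0[OF X] by simp
  let ?S = "Poly_Mapping.keys p \<union> Poly_Mapping.keys q"
  have ev: "formal_eval b r = (\<Sum>(x, y)\<in>?S. b (Poly_Mapping.lookup r (x, y) *\<^sub>C x) y)"
    if "Poly_Mapping.keys r \<subseteq> ?S" for r
    unfolding formal_eval_def using that p q b0
    by (intro sum.mono_neutral_left) (auto simp: in_keys_iff)
  have sub: "Poly_Mapping.keys (p + q) \<subseteq> ?S" by (rule Poly_Mapping.keys_add)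
  have "formal_eval b (p + q) = formal_eval b p + formal_eval b q"
    unfolding ev[OF sub] ev[OF Un_upper1] ev[OF Un_upper2] sum.distrib[symmetric]
    by (rule sum.cong) (use p q in \<open>auto simp: lookup_add scaleC_add_left
        intro!: add complex_vector.subspace_scale[OF X]\<close>)
  moreover have "s + t = abs_ctensor (p + q)" by (simp add: p q plus_ctensor.abs_eq)
  moreover have "Poly_Mapping.keys (p + q) \<subseteq> X \<times> Y" using sub p q by blast
  ultimately show ?thesis
    using p q by (simp add: tensor_lift_on_abs[OF X Y b])
qed

text \<open>The universal property of the balanced tensor product.\<close>

lemma tensor_over_balanced:
  assumes "x \<in> X" "m \<in> M" "y \<in> Y"
  shows "tensor_over M X r Y l (r x m) y = tensor_over M X r Y l x (l m y)"
proof -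
  let ?N = "balancing_relations M X r Y l"
  have N: "csubspace ?N" by (simp add: balancing_relations_def complex_vector.subspace_span)
  have "r x m \<otimes>\<^sub>C y - x \<otimes>\<^sub>C l m y \<in> ?N"
    unfolding balancing_relations_def using assms by (intro complex_vector.span_base) blast
  then have "quot_proj ?N (r x m \<otimes>\<^sub>C y - x \<otimes>\<^sub>C l m y) = 0"
    using quot_proj(3)[OF N] by blast
  then show ?thesis
    by (simp add: tensor_over_def complex_vector.linear_diff[OF quot_proj(1)[OF N]])
qed

lemma tensor_lift_on_tensor_over:
  assumes X: "csubspace X" and Y: "csubspace Y" and b: "balanced_on X Y b"
    and r: "\<And>x m. x \<in> X \<Longrightarrow> m \<in> M \<Longrightarrow> r x m \<in> X" and l: "\<And>y m. y \<in> Y \<Longrightarrow> m \<in> M \<Longrightarrow> l m y \<in> Y"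
    and rc: "\<And>c x m. x \<in> X \<Longrightarrow> m \<in> M \<Longrightarrow> r (c *\<^sub>C x) m = c *\<^sub>C r x m"
    and bal: "\<And>x m y. x \<in> X \<Longrightarrow> m \<in> M \<Longrightarrow> y \<in> Y \<Longrightarrow> b (r x m) y = b x (l m y)"
    and x: "x \<in> X" and y: "y \<in> Y"
  shows "tensor_over M X r Y l x y \<in> tensor_space X Y"
    and "tensor_lift_on X Y b (tensor_over M X r Y l x y) = b x y"
proof -
  let ?R = "{r x m \<otimes>\<^sub>C y - x \<otimes>\<^sub>C l m y | x m y. x \<in> X \<and> m \<in> M \<and> y \<in> Y}"
  let ?L = "tensor_lift_on X Y b"
  have T: "csubspace (tensor_space X Y)"
    by (simp add: tensor_space_def complex_vector.subspace_span)
  have pure: "x \<otimes>\<^sub>C y \<in> tensor_space X Y" if "x \<in> X" "y \<in> Y" for x y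
    unfolding tensor_space_def using that by (intro complex_vector.span_base) blast
  have RT: "?R \<subseteq> tensor_space X Y"
    using r l by (auto intro!: complex_vector.subspace_diff[OF T] pure)
  have kill: "n \<in> tensor_space X Y \<and> ?L n = 0" if "n \<in> cspan ?R" for n
    using that
  proof (induction rule: complex_vector.span_induct_alt)
    case base
    have "?L (0 + 0) = ?L 0 + ?L 0"
      using complex_vector.subspace_0[OF T] by (intro tensor_lift_on_add[OF X Y b])
    then show ?case using complex_vector.subspace_0[OF T] by simp
  next
    case (step c u v)
    then obtain x m y where u: "u = r x m \<otimes>\<^sub>C y - x \<otimes>\<^sub>C l m y" and xmy: "x \<in> X" "m \<in> M" "y \<in> Y"
      by blast
    have cy: "c *\<^sub>C y \<in> Y" and cx: "c *\<^sub>C x \<in> X" and crx: "c *\<^sub>C r x m \<in> X"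
      using xmy r complex_vector.subspace_scale X Y by blast+
    have cu: "c *\<^sub>C u + (c *\<^sub>C x) \<otimes>\<^sub>C l m y = (c *\<^sub>C r x m) \<otimes>\<^sub>C y"
      by (simp add: u tensor_scaleC_left complex_vector.scale_right_diff_distrib)
    have cuT: "c *\<^sub>C u \<in> tensor_space X Y"
      using step(1) RT complex_vector.subspace_scale[OF T] by blast
    have "?L (c *\<^sub>C u) + b (c *\<^sub>C x) (l m y) = b (c *\<^sub>C r x m) y"
      using tensor_lift_on_add[OF X Y b cuT pure[OF cx l[OF xmy(3,2)]]] cu
        tensor_lift_on_tensor[OF X Y b cx l[OF xmy(3,2)]]
        tensor_lift_on_tensor[OF X Y b crx xmy(3)] by simp
    moreover have "b (c *\<^sub>C r x m) y = b (c *\<^sub>C x) (l m y)"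
      using bal[OF cx xmy(2,3)] rc[OF xmy(1,2)] by simp
    ultimately have "?L (c *\<^sub>C u) = 0" by simp
    then show ?case
      using step cuT tensor_lift_on_add[OF X Y b cuT] complex_vector.subspace_add[OF T] by auto
  qed
  let ?p = "quot_proj (cspan ?R)"
  have R: "csubspace (cspan ?R)" by (rule complex_vector.subspace_span)
  have "?p (?p (x \<otimes>\<^sub>C y) - x \<otimes>\<^sub>C y) = 0"
    by (simp only: complex_vector.linear_diff[OF quot_proj(1)[OF R]] quot_proj(2)[OF R] diff_self)
  then have n: "?p (x \<otimes>\<^sub>C y) - x \<otimes>\<^sub>C y \<in> cspan ?R"
    by (simp only: quot_proj(3)[OF R])
  have eq: "tensor_over M X r Y l x y = x \<otimes>\<^sub>C y + (?p (x \<otimes>\<^sub>C y) - x \<otimes>\<^sub>C y)"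
    by (simp add: tensor_over_def balancing_relations_def)
  show "tensor_over M X r Y l x y \<in> tensor_space X Y"
    using kill[OF n] pure[OF x y] complex_vector.subspace_add[OF T] unfolding eq by blast
  show "?L (tensor_over M X r Y l x y) = b x y"
    unfolding eq tensor_lift_on_add[OF X Y b pure[OF x y] conjunct1[OF kill[OF n]]]
    by (simp only: kill[OF n] tensor_lift_on_tensor[OF X Y b x y] add_0_right)
qed


section \<open>Hopf star-algebras and comodules\<close>

record (overloaded) 'a hopf =
  comult :: "'a \<Rightarrow> 'a \<otimes>\<^sub>C 'a"
  counit :: "'a \<Rightarrow> complex"
  antipode :: "'a \<Rightarrow> 'a"
  hstar :: "'a \<Rightarrow> 'a"

definition left_comodule ::
    "('a::complex_algebra) hopf \<Rightarrow> ('v::complex_vector \<Rightarrow> 'a \<otimes>\<^sub>C 'v) \<Rightarrow> bool" where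
  "left_comodule H \<delta> \<longleftrightarrow>
     clinear \<delta> \<and>
     (\<forall>v. tensor_assoc (tensor_map (comult H) id (\<delta> v)) = tensor_map id \<delta> (\<delta> v)) \<and>
     (\<forall>v. tensor_lift (\<lambda>a w. counit H a *\<^sub>C w) (\<delta> v) = v)"

text \<open>
  That the counit is a star-map and that \<open>S (S (a\<^sup>*)\<^sup>*) = a\<close> follows from these axioms.
\<close>

definition hopf_star_algebra :: "('a::complex_algebra) hopf \<Rightarrow> bool" where
  "hopf_star_algebra H \<longleftrightarrow>
     \<comment> \<open>coalgebra\<close>
     left_comodule H (comult H) \<and>
     clinear (counit H) \<and>
     (\<forall>a. tensor_lift (\<lambda>x y. counit H y *\<^sub>C x) (comult H a) = a) \<and>
     \<comment> \<open>bialgebra\<close>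
     (\<forall>a b. comult H (a * b) = tensor_mult (*) (comult H a) (comult H b)) \<and>
     comult H 1 = 1 \<otimes>\<^sub>C 1 \<and>
     (\<forall>a b. counit H (a * b) = counit H a * counit H b) \<and>
     counit H 1 = 1 \<and>
     \<comment> \<open>antipode\<close>
     clinear (antipode H) \<and>
     (\<forall>a. tensor_lift (\<lambda>x y. antipode H x * y) (comult H a) = counit H a *\<^sub>C 1) \<and>
     (\<forall>a. tensor_lift (\<lambda>x y. x * antipode H y) (comult H a) = counit H a *\<^sub>C 1) \<and>
     \<comment> \<open>star\<close>
     antilinear (hstar H) \<and>
     (\<forall>a. hstar H (hstar H a) = a) \<and>
     (\<forall>a b. hstar H (a * b) = hstar H b * hstar H a) \<and>
     (\<forall>a. comult H (hstar H a) = tensor_map (hstar H) (hstar H) (comult H a))"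


section \<open>Differential star-calculi and complex structures\<close>

definition decomposition ::
    "('i \<Rightarrow> 'w::complex_vector set) \<Rightarrow> 'w \<Rightarrow> ('i \<Rightarrow> 'w) \<Rightarrow> bool" where
  "decomposition V x c \<longleftrightarrow>
     (\<forall>i. c i \<in> V i) \<and> finite {i. c i \<noteq> 0} \<and> x = (\<Sum>i | c i \<noteq> 0. c i)"

text \<open>The ambient space is the internal direct sum of the \<open>V i\<close>.\<close>

definition direct_sum :: "('i \<Rightarrow> 'w::complex_vector set) \<Rightarrow> bool" where
  "direct_sum V \<longleftrightarrow> (\<forall>i. csubspace (V i)) \<and> (\<forall>x. \<exists>!c. decomposition V x c)"

definition component :: "('i \<Rightarrow> 'w::complex_vector set) \<Rightarrow> 'i \<Rightarrow> 'w \<Rightarrow> 'w" where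
  "component V i x = (THE c. decomposition V x c) i"

text \<open>
  The total algebra \<open>\<Omega>\<^sup>\<bullet>\<close> is the type \<open>'w\<close>, its product is \<open>(*)\<close>, and the base algebra \<open>M\<close> is
  the degree zero part.
\<close>

record (overloaded) ('a, 'w) calculus =
  form :: "nat \<Rightarrow> 'w set"
  ext_d :: "'w \<Rightarrow> 'w"
  fstar :: "'w \<Rightarrow> 'w"
  fcoact :: "'w \<Rightarrow> 'a \<otimes>\<^sub>C 'w"

record (overloaded) ('a, 'w) complex_calculus = "('a, 'w) calculus" +
  biform :: "nat \<times> nat \<Rightarrow> 'w set"
  del :: "'w \<Rightarrow> 'w"
  delbar :: "'w \<Rightarrow> 'w"

abbreviation base :: "('a::complex_vector, 'w::complex_vector, 'z) calculus_scheme \<Rightarrow> 'w set" where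
  "base \<Omega> \<equiv> form \<Omega> 0"

definition star_calculus ::
    "('a::complex_algebra) hopf \<Rightarrow> ('a, 'w::complex_algebra, 'z) calculus_scheme \<Rightarrow> bool" where
  "star_calculus H \<Omega> \<longleftrightarrow>
     \<comment> \<open>graded algebra\<close>
     direct_sum (form \<Omega>) \<and>
     1 \<in> form \<Omega> 0 \<and>
     (\<forall>k l. \<forall>\<omega>\<in>form \<Omega> k. \<forall>\<nu>\<in>form \<Omega> l. \<omega> * \<nu> \<in> form \<Omega> (k + l)) \<and>
     \<comment> \<open>differential\<close>
     clinear (ext_d \<Omega>) \<and>
     (\<forall>k. \<forall>\<omega>\<in>form \<Omega> k. ext_d \<Omega> \<omega> \<in> form \<Omega> (Suc k)) \<and>
     (\<forall>\<omega>. ext_d \<Omega> (ext_d \<Omega> \<omega>) = 0) \<and>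
     (\<forall>k. \<forall>\<omega>\<in>form \<Omega> k. \<forall>\<nu>.
        ext_d \<Omega> (\<omega> * \<nu>) = ext_d \<Omega> \<omega> * \<nu> + (-1) ^ k *\<^sub>C (\<omega> * ext_d \<Omega> \<nu>)) \<and>
     \<comment> \<open>generated by the base algebra as a differential graded algebra\<close>
     (\<forall>U. csubspace U \<and> base \<Omega> \<subseteq> U \<and> (\<forall>x\<in>U. \<forall>y\<in>U. x * y \<in> U) \<and>
        (\<forall>x\<in>U. ext_d \<Omega> x \<in> U) \<longrightarrow> U = UNIV) \<and>
     \<comment> \<open>involution\<close>
     antilinear (fstar \<Omega>) \<and>
     (\<forall>\<omega>. fstar \<Omega> (fstar \<Omega> \<omega>) = \<omega>) \<and>
     (\<forall>k. \<forall>\<omega>\<in>form \<Omega> k. fstar \<Omega> \<omega> \<in> form \<Omega> k) \<and>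
     (\<forall>\<omega>. fstar \<Omega> (ext_d \<Omega> \<omega>) = ext_d \<Omega> (fstar \<Omega> \<omega>)) \<and>
     (\<forall>k l. \<forall>\<omega>\<in>form \<Omega> k. \<forall>\<nu>\<in>form \<Omega> l.
        fstar \<Omega> (\<omega> * \<nu>) = (-1) ^ (k * l) *\<^sub>C (fstar \<Omega> \<nu> * fstar \<Omega> \<omega>)) \<and>
     \<comment> \<open>graded coaction\<close>
     left_comodule H (fcoact \<Omega>) \<and>
     (\<forall>k. \<forall>\<omega>\<in>form \<Omega> k. fcoact \<Omega> \<omega> \<in> tensor_space UNIV (form \<Omega> k)) \<and>
     (\<forall>\<omega> \<nu>. fcoact \<Omega> (\<omega> * \<nu>) = tensor_mult (*) (fcoact \<Omega> \<omega>) (fcoact \<Omega> \<nu>)) \<and>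
     fcoact \<Omega> 1 = 1 \<otimes>\<^sub>C 1 \<and>
     (\<forall>\<omega>. fcoact \<Omega> (ext_d \<Omega> \<omega>) = tensor_map id (ext_d \<Omega>) (fcoact \<Omega> \<omega>)) \<and>
     (\<forall>\<omega>. fcoact \<Omega> (fstar \<Omega> \<omega>) = tensor_map (hstar H) (fstar \<Omega>) (fcoact \<Omega> \<omega>))"

text \<open>
  The conditions on \<open>del\<close> and \<open>delbar\<close> say that they are the components of \<open>d\<close> of bidegree
  \<open>(1, 0)\<close> and \<open>(0, 1)\<close>, and that \<open>d\<close> has no others. Each bigraded piece is automatically a
  subbimodule over the base, which is the piece of bidegree \<open>(0, 0)\<close>.
\<close>

definition complex_structure :: "('a::complex_algebra, 'w::complex_algebra) complex_calculus \<Rightarrow> bool" where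
  "complex_structure \<Omega> \<longleftrightarrow>
     direct_sum (biform \<Omega>) \<and>
     (\<forall>k. form \<Omega> k = cspan (\<Union>(a, b)\<in>{(a, b). a + b = k}. biform \<Omega> (a, b))) \<and>
     (\<forall>a b a' b'. \<forall>\<omega>\<in>biform \<Omega> (a, b). \<forall>\<nu>\<in>biform \<Omega> (a', b').
        \<omega> * \<nu> \<in> biform \<Omega> (a + a', b + b')) \<and>
     (\<forall>p. \<forall>\<omega>\<in>biform \<Omega> p. fcoact \<Omega> \<omega> \<in> tensor_space UNIV (biform \<Omega> p)) \<and>
     (\<forall>a b. fstar \<Omega> ` biform \<Omega> (a, b) = biform \<Omega> (b, a)) \<and>
     clinear (del \<Omega>) \<and> clinear (delbar \<Omega>) \<and>
     (\<forall>a b. \<forall>\<omega>\<in>biform \<Omega> (a, b). del \<Omega> \<omega> \<in> biform \<Omega> (Suc a, b)) \<and>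
     (\<forall>a b. \<forall>\<omega>\<in>biform \<Omega> (a, b). delbar \<Omega> \<omega> \<in> biform \<Omega> (a, Suc b)) \<and>
     (\<forall>\<omega>. ext_d \<Omega> \<omega> = del \<Omega> \<omega> + delbar \<Omega> \<omega>)"

definition grade_inv :: "('a::complex_vector, 'w::complex_vector, 'z) calculus_scheme \<Rightarrow> 'w \<Rightarrow> 'w" where
  "grade_inv \<Omega> \<omega> =
     (\<Sum>k | component (form \<Omega>) k \<omega> \<noteq> 0. (-1) ^ k *\<^sub>C component (form \<Omega>) k \<omega>)"


section \<open>Vector bundles\<close>

text \<open>The module \<open>\<F>\<close> is the type \<open>'f\<close>; only the action of elements of \<open>base \<Omega>\<close> matters.\<close>

record (overloaded) ('a, 'w, 'f) vbundle =
  act :: "'w \<Rightarrow> 'f \<Rightarrow> 'f"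
  vcoact :: "'f \<Rightarrow> 'a \<otimes>\<^sub>C 'f"

definition left_module ::
    "('a::complex_vector, 'w::complex_algebra, 'z) calculus_scheme \<Rightarrow> ('w \<Rightarrow> 'f::complex_vector \<Rightarrow> 'f) \<Rightarrow> bool" where
  "left_module \<Omega> l \<longleftrightarrow>
     (\<forall>m\<in>base \<Omega>. clinear (l m)) \<and>
     (\<forall>m\<in>base \<Omega>. \<forall>n\<in>base \<Omega>. \<forall>f. l (m + n) f = l m f + l n f) \<and>
     (\<forall>c. \<forall>m\<in>base \<Omega>. \<forall>f. l (c *\<^sub>C m) f = c *\<^sub>C l m f) \<and>
     (\<forall>m\<in>base \<Omega>. \<forall>n\<in>base \<Omega>. \<forall>f. l (m * n) f = l m (l n f)) \<and>
     (\<forall>f. l 1 f = f)"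

definition free_module ::
    "('a::complex_vector, 'w::complex_algebra, 'z) calculus_scheme \<Rightarrow> nat \<Rightarrow> (nat \<Rightarrow> 'w) set" where
  "free_module \<Omega> n = {v. (\<forall>i<n. v i \<in> base \<Omega>) \<and> (\<forall>i\<ge>n. v i = 0)}"

text \<open>Finitely generated projective: a direct summand of a free module of finite rank.\<close>

definition fg_projective ::
    "('a::complex_vector, 'w::complex_algebra, 'z) calculus_scheme \<Rightarrow> ('w \<Rightarrow> 'f::complex_vector \<Rightarrow> 'f) \<Rightarrow> bool" where
  "fg_projective \<Omega> l \<longleftrightarrow>
     (\<exists>n (s :: 'f \<Rightarrow> nat \<Rightarrow> 'w) (r :: (nat \<Rightarrow> 'w) \<Rightarrow> 'f).
        (\<forall>f. s f \<in> free_module \<Omega> n) \<and>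
        (\<forall>f g. s (f + g) = s f + s g) \<and>
        (\<forall>m\<in>base \<Omega>. \<forall>f. s (l m f) = (\<lambda>i. m * s f i)) \<and>
        (\<forall>u\<in>free_module \<Omega> n. \<forall>v\<in>free_module \<Omega> n. r (u + v) = r u + r v) \<and>
        (\<forall>m\<in>base \<Omega>. \<forall>v\<in>free_module \<Omega> n. r (\<lambda>i. m * v i) = l m (r v)) \<and>
        (\<forall>f. r (s f) = f))"

definition vector_bundle :: "('a::complex_algebra) hopf \<Rightarrow>
    ('a, 'w::complex_algebra, 'z) calculus_scheme \<Rightarrow> ('a, 'w, 'f::complex_vector) vbundle \<Rightarrow> bool" where
  "vector_bundle H \<Omega> F \<longleftrightarrow>
     left_module \<Omega> (act F) \<and>
     fg_projective \<Omega> (act F) \<and>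
     left_comodule H (vcoact F) \<and>
     (\<forall>m\<in>base \<Omega>. \<forall>f. vcoact F (act F m f) =
        tensor_mult_on (base \<Omega>) (act F) (fcoact \<Omega> m) (vcoact F f))"

text \<open>The dual module, with right action \<open>(\<phi> m) f = \<phi> f * m\<close>.\<close>

definition dual :: "('a::complex_vector, 'w::complex_algebra, 'z) calculus_scheme \<Rightarrow>
    ('a, 'w, 'f::complex_vector) vbundle \<Rightarrow> ('f \<Rightarrow> 'w) set" where
  "dual \<Omega> F = {\<phi>. (\<forall>f. \<phi> f \<in> base \<Omega>) \<and> (\<forall>f g. \<phi> (f + g) = \<phi> f + \<phi> g) \<and>
     (\<forall>m\<in>base \<Omega>. \<forall>f. \<phi> (act F m f) = m * \<phi> f)}"

definition dual_act :: "('f \<Rightarrow> 'w::complex_algebra) \<Rightarrow> 'w \<Rightarrow> 'f \<Rightarrow> 'w" where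
  "dual_act \<phi> m = (\<lambda>f. \<phi> f * m)"

text \<open>
  The coaction on the dual: the element of \<open>A \<otimes> dual\<close> whose evaluation at each \<open>f\<close> is
  \<open>S (f_(-1)) (\<phi> (f_(0)))_(-1) \<otimes> (\<phi> (f_(0)))_(0)\<close>, as in Sweedler notation.
\<close>

definition dual_coact :: "('a::complex_algebra) hopf \<Rightarrow>
    ('a, 'w::complex_algebra, 'z) calculus_scheme \<Rightarrow> ('a, 'w, 'f::complex_vector) vbundle \<Rightarrow>
    ('f \<Rightarrow> 'w) \<Rightarrow> 'a \<otimes>\<^sub>C ('f \<Rightarrow> 'w)" where
  "dual_coact H \<Omega> F \<phi> =
     (THE t. t \<in> tensor_space UNIV (dual \<Omega> F) \<and>
        (\<forall>f. tensor_map id (\<lambda>\<psi>. \<psi> f) t =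
           tensor_lift (\<lambda>a g. tensor_map ((*) (antipode H a)) id (fcoact \<Omega> (\<phi> g))) (vcoact F f)))"

text \<open>Pure tensors in \<open>\<Omega>\<^sup>\<bullet> \<otimes>\<^sub>M \<F>\<close> and in \<open>\<^sup>\<or>\<F> \<otimes>\<^sub>M \<Omega>\<^sup>\<bullet>\<close>.\<close>

definition ftensor :: "('a::complex_vector, 'w::complex_algebra, 'z) calculus_scheme \<Rightarrow>
    ('a, 'w, 'f::complex_vector) vbundle \<Rightarrow> 'w \<Rightarrow> 'f \<Rightarrow> 'w \<otimes>\<^sub>C 'f" where
  "ftensor \<Omega> F = tensor_over (base \<Omega>) UNIV (*) UNIV (act F)"

definition dtensor :: "('a::complex_vector, 'w::complex_algebra, 'z) calculus_scheme \<Rightarrow>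
    ('a, 'w, 'f::complex_vector) vbundle \<Rightarrow> ('f \<Rightarrow> 'w) \<Rightarrow> 'w \<Rightarrow> ('f \<Rightarrow> 'w) \<otimes>\<^sub>C 'w" where
  "dtensor \<Omega> F = tensor_over (base \<Omega>) (dual \<Omega> F) dual_act UNIV (*)"

text \<open>
  For a set \<open>V\<close> of forms spanning a subbimodule, \<open>fspace \<Omega> F V\<close> is the part \<open>V \<otimes>\<^sub>M \<F>\<close> of
  \<open>\<Omega>\<^sup>\<bullet> \<otimes>\<^sub>M \<F>\<close>, and \<open>dspace \<Omega> F V\<close> is the part \<open>\<^sup>\<or>\<F> \<otimes>\<^sub>M V\<close> of \<open>\<^sup>\<or>\<F> \<otimes>\<^sub>M \<Omega>\<^sup>\<bullet>\<close>.
\<close>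

definition fspace :: "('a::complex_vector, 'w::complex_algebra, 'z) calculus_scheme \<Rightarrow>
    ('a, 'w, 'f::complex_vector) vbundle \<Rightarrow> 'w set \<Rightarrow> ('w \<otimes>\<^sub>C 'f) set" where
  "fspace \<Omega> F V = cspan {ftensor \<Omega> F \<omega> f | \<omega> f. \<omega> \<in> V}"

definition dspace :: "('a::complex_vector, 'w::complex_algebra, 'z) calculus_scheme \<Rightarrow>
    ('a, 'w, 'f::complex_vector) vbundle \<Rightarrow> 'w set \<Rightarrow> (('f \<Rightarrow> 'w) \<otimes>\<^sub>C 'w) set" where
  "dspace \<Omega> F V = cspan {dtensor \<Omega> F \<phi> \<omega> | \<phi> \<omega>. \<phi> \<in> dual \<Omega> F \<and> \<omega> \<in> V}"

definition fwedge :: "('a::complex_vector, 'w::complex_algebra, 'z) calculus_scheme \<Rightarrow>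
    ('a, 'w, 'f::complex_vector) vbundle \<Rightarrow> 'w \<Rightarrow> 'w \<otimes>\<^sub>C 'f \<Rightarrow> 'w \<otimes>\<^sub>C 'f" where
  "fwedge \<Omega> F \<eta> = tensor_lift (\<lambda>\<omega> f. ftensor \<Omega> F (\<eta> * \<omega>) f)"

definition dwedge :: "('a::complex_vector, 'w::complex_algebra, 'z) calculus_scheme \<Rightarrow>
    ('a, 'w, 'f::complex_vector) vbundle \<Rightarrow> ('f \<Rightarrow> 'w) \<otimes>\<^sub>C 'w \<Rightarrow> 'w \<Rightarrow> ('f \<Rightarrow> 'w) \<otimes>\<^sub>C 'w" where
  "dwedge \<Omega> F t \<eta> = tensor_lift_on (dual \<Omega> F) UNIV (\<lambda>\<phi> \<omega>. dtensor \<Omega> F \<phi> (\<omega> * \<eta>)) t"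

definition ftensor_coact :: "('a::complex_algebra, 'w::complex_algebra, 'z) calculus_scheme \<Rightarrow>
    ('a, 'w, 'f::complex_vector) vbundle \<Rightarrow> 'w \<otimes>\<^sub>C 'f \<Rightarrow> 'a \<otimes>\<^sub>C 'w \<otimes>\<^sub>C 'f" where
  "ftensor_coact \<Omega> F =
     tensor_lift (\<lambda>\<omega> f. tensor_mult (ftensor \<Omega> F) (fcoact \<Omega> \<omega>) (vcoact F f))"

definition ev_wedge :: "'w::complex_algebra \<otimes>\<^sub>C 'f::complex_vector \<Rightarrow> ('f \<Rightarrow> 'w) \<otimes>\<^sub>C 'w \<Rightarrow> 'w" where
  "ev_wedge s t = tensor_lift (\<lambda>\<omega> f. tensor_lift (\<lambda>\<phi> \<nu>. \<omega> * \<phi> f * \<nu>) t) s"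


section \<open>Connections and holomorphic structures\<close>

text \<open>
  \<open>covariant_operator \<Omega> F D V \<nabla>\<close>: an \<open>A\<close>-comodule map \<open>\<nabla> : \<F> \<rightarrow> V \<otimes>\<^sub>M \<F>\<close> with
  \<open>\<nabla> (m f) = D m \<otimes> f + m \<nabla> f\<close>.
\<close>

definition covariant_operator ::
    "('a::complex_algebra, 'w::complex_algebra, 'z) calculus_scheme \<Rightarrow>
     ('a, 'w, 'f::complex_vector) vbundle \<Rightarrow> ('w \<Rightarrow> 'w) \<Rightarrow> 'w set \<Rightarrow> ('f \<Rightarrow> 'w \<otimes>\<^sub>C 'f) \<Rightarrow> bool" where
  "covariant_operator \<Omega> F D V nabla \<longleftrightarrow>
     clinear nabla \<and>
     (\<forall>f. nabla f \<in> fspace \<Omega> F V) \<and>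
     (\<forall>f. ftensor_coact \<Omega> F (nabla f) = tensor_map id nabla (vcoact F f)) \<and>
     (\<forall>m\<in>base \<Omega>. \<forall>f. nabla (act F m f) = ftensor \<Omega> F (D m) f + fwedge \<Omega> F m (nabla f))"

text \<open>The extension \<open>\<omega> \<otimes> f \<mapsto> D \<omega> \<otimes> f + (-1)^k \<omega> \<and> \<nabla> f\<close> for \<open>\<omega>\<close> of degree \<open>k\<close>.\<close>

definition extension :: "('a::complex_vector, 'w::complex_algebra, 'z) calculus_scheme \<Rightarrow>
    ('a, 'w, 'f::complex_vector) vbundle \<Rightarrow> ('w \<Rightarrow> 'w) \<Rightarrow> ('f \<Rightarrow> 'w \<otimes>\<^sub>C 'f) \<Rightarrow>
    'w \<otimes>\<^sub>C 'f \<Rightarrow> 'w \<otimes>\<^sub>C 'f" where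
  "extension \<Omega> F D nabla =
     tensor_lift (\<lambda>\<omega> f. ftensor \<Omega> F (D \<omega>) f + fwedge \<Omega> F (grade_inv \<Omega> \<omega>) (nabla f))"

definition holomorphic_structure :: "('a::complex_algebra, 'w::complex_algebra) complex_calculus \<Rightarrow>
    ('a, 'w, 'f::complex_vector) vbundle \<Rightarrow> ('f \<Rightarrow> 'w \<otimes>\<^sub>C 'f) \<Rightarrow> bool" where
  "holomorphic_structure \<Omega> F nabla \<longleftrightarrow>
     covariant_operator \<Omega> F (delbar \<Omega>) (biform \<Omega> (0, 1)) nabla \<and>
     (\<forall>t\<in>fspace \<Omega> F (\<Union>k. biform \<Omega> (0, k)).
        extension \<Omega> F (delbar \<Omega>) nabla (extension \<Omega> F (delbar \<Omega>) nabla t) = 0)"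

definition antiholomorphic_structure :: "('a::complex_algebra, 'w::complex_algebra) complex_calculus \<Rightarrow>
    ('a, 'w, 'f::complex_vector) vbundle \<Rightarrow> ('f \<Rightarrow> 'w \<otimes>\<^sub>C 'f) \<Rightarrow> bool" where
  "antiholomorphic_structure \<Omega> F nabla \<longleftrightarrow>
     covariant_operator \<Omega> F (del \<Omega>) (biform \<Omega> (1, 0)) nabla \<and>
     (\<forall>t\<in>fspace \<Omega> F (\<Union>k. biform \<Omega> (k, 0)).
        extension \<Omega> F (del \<Omega>) nabla (extension \<Omega> F (del \<Omega>) nabla t) = 0)"

text \<open>
  The dual holomorphic structure on \<open>\<^sup>\<or>\<F>\<close> and its extension to \<open>\<^sup>\<or>\<F> \<otimes>\<^sub>M \<Omega>\<^sup>\<bullet>\<close>. Elements \<open>f\<close> of \<open>\<F>\<close>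
  and \<open>\<phi>\<close> of \<open>\<^sup>\<or>\<F>\<close> enter the pairing as \<open>1 \<otimes> f\<close> and \<open>\<phi> \<otimes> 1\<close>.
\<close>

definition dual_delbar :: "('a::complex_algebra, 'w::complex_algebra) complex_calculus \<Rightarrow>
    ('a, 'w, 'f::complex_vector) vbundle \<Rightarrow> ('f \<Rightarrow> 'w \<otimes>\<^sub>C 'f) \<Rightarrow>
    ('f \<Rightarrow> 'w) \<Rightarrow> ('f \<Rightarrow> 'w) \<otimes>\<^sub>C 'w" where
  "dual_delbar \<Omega> F dbar \<phi> =
     (THE t. t \<in> dspace \<Omega> F (biform \<Omega> (0, 1)) \<and>
        (\<forall>f. ev_wedge (ftensor \<Omega> F 1 f) t =
           delbar \<Omega> (\<phi> f) - ev_wedge (dbar f) (dtensor \<Omega> F \<phi> 1)))"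

definition dual_extension :: "('a::complex_algebra, 'w::complex_algebra) complex_calculus \<Rightarrow>
    ('a, 'w, 'f::complex_vector) vbundle \<Rightarrow> ('f \<Rightarrow> 'w \<otimes>\<^sub>C 'f) \<Rightarrow>
    ('f \<Rightarrow> 'w) \<otimes>\<^sub>C 'w \<Rightarrow> ('f \<Rightarrow> 'w) \<otimes>\<^sub>C 'w" where
  "dual_extension \<Omega> F dbar = tensor_lift_on (dual \<Omega> F) UNIV
     (\<lambda>\<phi> \<omega>. dwedge \<Omega> F (dual_delbar \<Omega> F dbar \<phi>) \<omega> + dtensor \<Omega> F \<phi> (delbar \<Omega> \<omega>))"


section \<open>Hermitian structures and the Chern connection\<close>

text \<open>
  The conjugate space of \<open>\<F>\<close> has the same elements, so \<open>h f\<close> stands for \<open>h\<close> applied to the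
  conjugate of \<open>f\<close>; the conjugate scalar action, right action and coaction are written out.
\<close>

definition hermitian_structure :: "('a::complex_algebra) hopf \<Rightarrow>
    ('a, 'w::complex_algebra, 'z) calculus_scheme \<Rightarrow> ('a, 'w, 'f::complex_vector) vbundle \<Rightarrow>
    ('f \<Rightarrow> 'f \<Rightarrow> 'w) \<Rightarrow> bool" where
  "hermitian_structure H \<Omega> F h \<longleftrightarrow>
     antilinear h \<and>
     bij_betw h UNIV (dual \<Omega> F) \<and>
     (\<forall>m\<in>base \<Omega>. \<forall>f. h (act F (fstar \<Omega> m) f) = dual_act (h f) m) \<and>
     (\<forall>f. dual_coact H \<Omega> F (h f) = tensor_lift (\<lambda>a g. hstar H a \<otimes>\<^sub>C h g) (vcoact F f)) \<and>
     (\<forall>f g. h f g = fstar \<Omega> (h g f))"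

definition chern_map :: "('a::complex_vector, 'w::complex_algebra, 'z) calculus_scheme \<Rightarrow>
    ('a, 'w, 'f::complex_vector) vbundle \<Rightarrow> ('f \<Rightarrow> 'f \<Rightarrow> 'w) \<Rightarrow>
    'w \<otimes>\<^sub>C 'f \<Rightarrow> ('f \<Rightarrow> 'w) \<otimes>\<^sub>C 'w" where
  "chern_map \<Omega> F h = tensor_lift (\<lambda>\<omega> f. dtensor \<Omega> F (h f) (fstar \<Omega> \<omega>))"

text \<open>\<open>C\<^sub>h\<^sup>-\<^sup>1 \<circ> \<partial>bar \<circ> C\<^sub>h\<close>, with the inverse taken on \<open>\<Omega>\<^sup>\<bullet> \<otimes>\<^sub>M \<F>\<close>.\<close>

definition conj_del :: "('a::complex_algebra, 'w::complex_algebra) complex_calculus \<Rightarrow>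
    ('a, 'w, 'f::complex_vector) vbundle \<Rightarrow> ('f \<Rightarrow> 'w \<otimes>\<^sub>C 'f) \<Rightarrow> ('f \<Rightarrow> 'f \<Rightarrow> 'w) \<Rightarrow>
    'w \<otimes>\<^sub>C 'f \<Rightarrow> 'w \<otimes>\<^sub>C 'f" where
  "conj_del \<Omega> F dbar h =
     inv_into (fspace \<Omega> F UNIV) (chern_map \<Omega> F h) \<circ> dual_extension \<Omega> F dbar \<circ> chern_map \<Omega> F h"

definition herm :: "('a::complex_vector, 'w::complex_algebra, 'z) calculus_scheme \<Rightarrow>
    ('f::complex_vector \<Rightarrow> 'f \<Rightarrow> 'w) \<Rightarrow> 'w \<otimes>\<^sub>C 'f \<Rightarrow> 'w \<otimes>\<^sub>C 'f \<Rightarrow> 'w" where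
  "herm \<Omega> h s t = tensor_lift (\<lambda>\<omega> f. tensor_lift (\<lambda>\<nu> g. \<omega> * h g f * fstar \<Omega> \<nu>) t) s"

definition covariant_connection :: "('a::complex_algebra, 'w::complex_algebra, 'z) calculus_scheme \<Rightarrow>
    ('a, 'w, 'f::complex_vector) vbundle \<Rightarrow> ('f \<Rightarrow> 'w \<otimes>\<^sub>C 'f) \<Rightarrow> bool" where
  "covariant_connection \<Omega> F nabla \<longleftrightarrow> covariant_operator \<Omega> F (ext_d \<Omega>) (form \<Omega> 1) nabla"

definition hermitian_connection :: "('a::complex_algebra, 'w::complex_algebra, 'z) calculus_scheme \<Rightarrow>
    ('a, 'w, 'f::complex_vector) vbundle \<Rightarrow> ('f \<Rightarrow> 'f \<Rightarrow> 'w) \<Rightarrow> ('f \<Rightarrow> 'w \<otimes>\<^sub>C 'f) \<Rightarrow> bool" where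
  "hermitian_connection \<Omega> F h nabla \<longleftrightarrow>
     covariant_connection \<Omega> F nabla \<and>
     (\<forall>f g. ext_d \<Omega> (herm \<Omega> h (ftensor \<Omega> F 1 f) (ftensor \<Omega> F 1 g)) =
        herm \<Omega> h (nabla f) (ftensor \<Omega> F 1 g) + herm \<Omega> h (ftensor \<Omega> F 1 f) (nabla g))"

definition part01 :: "('a::complex_algebra, 'w::complex_algebra) complex_calculus \<Rightarrow>
    ('a, 'w, 'f::complex_vector) vbundle \<Rightarrow> ('f \<Rightarrow> 'w \<otimes>\<^sub>C 'f) \<Rightarrow> 'f \<Rightarrow> 'w \<otimes>\<^sub>C 'f" where
  "part01 \<Omega> F nabla f =
     tensor_lift (\<lambda>\<omega> g. ftensor \<Omega> F (component (biform \<Omega>) (0, 1) \<omega>) g) (nabla f)"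

definition is_chern_connection :: "('a::complex_algebra, 'w::complex_algebra) complex_calculus \<Rightarrow>
    ('a, 'w, 'f::complex_vector) vbundle \<Rightarrow> ('f \<Rightarrow> 'w \<otimes>\<^sub>C 'f) \<Rightarrow> ('f \<Rightarrow> 'f \<Rightarrow> 'w) \<Rightarrow>
    ('f \<Rightarrow> 'w \<otimes>\<^sub>C 'f) \<Rightarrow> bool" where
  "is_chern_connection \<Omega> F dbar h nabla \<longleftrightarrow>
     hermitian_connection \<Omega> F h nabla \<and> part01 \<Omega> F nabla = dbar \<and>
     (\<forall>nabla'. hermitian_connection \<Omega> F h nabla' \<and> part01 \<Omega> F nabla' = dbar \<longrightarrow> nabla' = nabla)"

end

theory Submission
  imports Defs
begin

text \<open>
  Write \<open>\<langle>f, g\<rangle>\<close> for \<open>h g f\<close> and also for its extension \<^const>\<open>herm\<close> to forms with values in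
  \<open>\<F>\<close>. Everything rests on the nondegeneracy of this pairing. A Hermitian connection with
  \<open>(0, 1)\<close>-part \<open>dbar\<close> must have a \<open>(1, 0)\<close>-part \<open>D\<close> with
  \<open>\<langle>D f, g\<rangle> = \<partial>\<langle>f, g\<rangle> - \<langle>f, dbar g\<rangle>\<close>, by comparing bidegrees. The right-hand side is
  conjugate-linear over \<open>M\<close> in \<open>g\<close>, so a Riesz representation theorem (\<open>herm_represent\<close>, which
  is the dual basis of the projective module \<open>\<F>\<close> seen through \<open>h\<close>) gives a unique such \<open>D\<close>,
  called \<open>chern10\<close> below.

  Conjugating the equation for \<open>D\<close> turns it into the equation that determines the dual
  holomorphic structure, so \<open>C\<^sub>h (D f)\<close> is the dual operator applied to \<open>h f\<close>
  (\<open>dual_delbar_h\<close>). Hence the extension of \<open>D\<close> to forms, which raises the holomorphic degree by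
  one, is \<open>C\<^sub>h\<^sup>-\<^sup>1 \<circ> \<partial>bar \<circ> C\<^sub>h\<close> (\<open>conj_del_eq\<close>), and every claim about the latter is a claim about \<open>D\<close>
  that can be tested by pairing with sections. The Leibniz rule is immediate. For flatness,
  pairing \<open>D (D s)\<close> with \<open>g\<close> and moving both operators to the other side leaves only
  \<open>\<partial>\<^sup>2\<close> and \<open>\<langle>s, dbar\<^sup>2 g\<rangle>\<close>, which vanish (\<open>chern10_ext_twice\<close>).

  For covariance, the comodule condition on \<open>h\<close> is first rewritten as
  \<open>\<langle>f, g\<rangle>_(-1) \<otimes> \<langle>f, g\<rangle>_(0) = f_(-1) g_(-1)^* \<otimes> \<langle>f_(0), g_(0)\<rangle>\<close> (\<open>fcoact_h\<close>). This needs the coaction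
  on the dual to exist, which is where the antipode and projectivity enter (\<open>dual_coact\<close>). All
  terms of the equation for \<open>D\<close> other than \<open>D f\<close> are then covariant, and the antipode together
  with nondegeneracy allows \<open>g\<close> to be cancelled (\<open>sesq_mult_cancel\<close>, \<open>chern10_coact\<close>).
  Finally \<open>dbar + D\<close> is Hermitian because the equation for \<open>D\<close> and its conjugate are the two
  bidegree components of the Hermitian condition, and the same comparison shows that no other
  Hermitian connection has \<open>(0, 1)\<close>-part \<open>dbar\<close> (\<open>chern_unique\<close>).
\<close>

section \<open>Linearity and tensor products\<close>

text \<open>
  Every computation with coactions below is the verification that two maps agree on pure tensors.
  The rules collected here let the simplifier discharge the linearity conditions that make
  \<^const>\<open>tensor_lift\<close> well behaved. They come in two families, since the integrand of a lift
  may be linear in both arguments or, when an involution or \<open>h\<close> is involved, conjugate-linear in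
  both.
\<close>

named_theorems lin

abbreviation balanced :: "('a::complex_vector \<Rightarrow> 'b::complex_vector \<Rightarrow> 'c::ab_group_add) \<Rightarrow> bool" where
  "balanced \<equiv> balanced_on UNIV UNIV"

lemma clinearI:
  assumes "\<And>x y. f (x + y) = f x + f y" "\<And>c x. f (c *\<^sub>C x) = c *\<^sub>C f x"
  shows "clinear f"
  using assms by (simp add: Vector_Spaces.linear_iff complex_vector.vector_space_axioms)

lemma clinearD:
  assumes "clinear f"
  shows "f (x + y) = f x + f y" "f (c *\<^sub>C x) = c *\<^sub>C f x" "f 0 = 0" "f (x - y) = f x - f y" "f (- x) = - f x"
  using assms by (auto simp: Vector_Spaces.linear_iff complex_vector.linear_0
      complex_vector.linear_diff complex_vector.linear_neg)

lemma antilinearI: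
  assumes "\<And>x y. f (x + y) = f x + f y" "\<And>c x. f (c *\<^sub>C x) = cnj c *\<^sub>C f x"
  shows "antilinear f"
  using assms by (simp add: antilinear_def)

lemma antilinearD:
  fixes f :: "'a::complex_vector \<Rightarrow> 'b::complex_vector"
  assumes "antilinear f"
  shows "f (x + y) = f x + f y" "f (c *\<^sub>C x) = cnj c *\<^sub>C f x" "f 0 = 0" "f (x - y) = f x - f y" "f (- x) = - f x"
proof -
  show add: "f (x + y) = f x + f y" for x y using assms by (simp add: antilinear_def)
  show "f (c *\<^sub>C x) = cnj c *\<^sub>C f x" using assms by (simp add: antilinear_def)
  show zero: "f 0 = 0" using add[of 0 0] by simp
  show diff: "f (x - y) = f x - f y" for x y using add[of "x - y" y] by simp
  show "f (- x) = - f x" using diff[of 0 x] zero by simp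
qed

lemma antilinear_sum:
  assumes "antilinear f"
  shows "f (\<Sum>i\<in>I. x i) = (\<Sum>i\<in>I. f (x i))"
  by (induction I rule: infinite_finite_induct) (simp_all add: antilinearD[OF assms])

lemma sum_fun_apply: "(\<Sum>i\<in>I. g i) x = (\<Sum>i\<in>I. g i x)" for g :: "'i \<Rightarrow> 'x \<Rightarrow> 'b::comm_monoid_add"
  by (induction I rule: infinite_finite_induct) auto

lemma balancedD:
  assumes "balanced_on X Y b"
  shows "x \<in> X \<Longrightarrow> x' \<in> X \<Longrightarrow> y \<in> Y \<Longrightarrow> b (x + x') y = b x y + b x' y"
    "x \<in> X \<Longrightarrow> y \<in> Y \<Longrightarrow> y' \<in> Y \<Longrightarrow> b x (y + y') = b x y + b x y'"
    "x \<in> X \<Longrightarrow> y \<in> Y \<Longrightarrow> b (c *\<^sub>C x) y = b x (c *\<^sub>C y)"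
  using assms by (auto simp: balanced_on_def)

lemma balanced_clinear [lin]:
  assumes "\<And>y. clinear (\<lambda>x. b x y)" "\<And>x. clinear (\<lambda>y. b x y)"
  shows "balanced_on X Y b"
  by (simp add: balanced_on_def clinearD[OF assms(1)] clinearD[OF assms(2)])

lemma balanced_antilinear [lin]:
  assumes "\<And>y. antilinear (\<lambda>x. b x y)" "\<And>x. antilinear (\<lambda>y. b x y)"
  shows "balanced_on X Y b"
  by (simp add: balanced_on_def antilinearD[OF assms(1)] antilinearD[OF assms(2)])

lemma balanced_add: "balanced b \<Longrightarrow> balanced b' \<Longrightarrow> balanced (\<lambda>x y. b x y + b' x y)"
  by (simp add: balanced_on_def algebra_simps)

subsection \<open>Induction over pure tensors\<close>

lemma csubspace_UNIV [simp]: "csubspace UNIV"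
  by (simp add: complex_vector.subspace_UNIV)

lemma tensor_space_subspace [simp]: "csubspace (tensor_space X Y)"
  by (simp add: tensor_space_def complex_vector.subspace_span)

lemma tensor_in_tensor_space: "x \<in> X \<Longrightarrow> y \<in> Y \<Longrightarrow> x \<otimes>\<^sub>C y \<in> tensor_space X Y"
  unfolding tensor_space_def by (intro complex_vector.span_base) blast

lemma scale_closed_span_induct:
  assumes t: "t \<in> cspan B" and scale: "\<And>c b. b \<in> B \<Longrightarrow> c *\<^sub>C b \<in> B"
    and zero: "P 0" and base: "\<And>b. b \<in> B \<Longrightarrow> P b" and add: "\<And>s t. P s \<Longrightarrow> P t \<Longrightarrow> P (s + t)"
  shows "P t"
  using t by (induction rule: complex_vector.span_induct_alt) (auto intro: zero base add scale)

lemma tensor_zero [simp]: "0 \<otimes>\<^sub>C y = 0" "x \<otimes>\<^sub>C 0 = 0"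
  using tensor_add_left[of 0 0 y] tensor_add_right[of x 0 0] by auto

text \<open>
  The pure tensors are closed under scalars, so a property that is additive and holds for pure
  tensors holds everywhere.
\<close>

lemma tensor_space_induct [consumes 3, case_names tensor add]:
  assumes X: "csubspace X" and Y: "csubspace Y" and t: "t \<in> tensor_space X Y"
    and tensor: "\<And>x y. x \<in> X \<Longrightarrow> y \<in> Y \<Longrightarrow> P (x \<otimes>\<^sub>C y)"
    and add: "\<And>s t. s \<in> tensor_space X Y \<Longrightarrow> t \<in> tensor_space X Y \<Longrightarrow> P s \<Longrightarrow> P t \<Longrightarrow> P (s + t)"
  shows "P t"
proof -
  have "P t \<and> t \<in> tensor_space X Y"
    using t unfolding tensor_space_def
  proof (rule scale_closed_span_induct, fold tensor_space_def)
    show "P 0 \<and> 0 \<in> tensor_space X Y"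
      using tensor[OF complex_vector.subspace_0[OF X] complex_vector.subspace_0[OF Y]]
        complex_vector.subspace_0[of "tensor_space X Y"]
      by simp
    show "c *\<^sub>C b \<in> {x \<otimes>\<^sub>C y | x y. x \<in> X \<and> y \<in> Y}"
      if b: "b \<in> {x \<otimes>\<^sub>C y | x y. x \<in> X \<and> y \<in> Y}" for c b
    proof -
      obtain x y where "b = x \<otimes>\<^sub>C y" "x \<in> X" "y \<in> Y" using b by blast
      then have "c *\<^sub>C b = (c *\<^sub>C x) \<otimes>\<^sub>C y" "c *\<^sub>C x \<in> X" "y \<in> Y"
        by (simp_all add: tensor_scaleC_left complex_vector.subspace_scale[OF X])
      then show ?thesis by blast
    qed
  qed (use tensor add in \<open>auto intro: tensor_in_tensor_space complex_vector.subspace_add\<close>)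
  then show ?thesis ..
qed

lemma tensor_space_UNIV [simp]: "t \<in> tensor_space UNIV UNIV"
proof -
  obtain p where "t = abs_ctensor p"
    using ctensor.abs_induct[of "\<lambda>t. \<exists>p. t = abs_ctensor p" t] by blast
  moreover have "abs_ctensor p \<in> tensor_space UNIV (UNIV :: 'b set)"
    for p :: "'a \<times> 'b \<Rightarrow>\<^sub>0 complex"
  proof (induction p rule: update_induct)
    case const
    show ?case by (simp add: complex_vector.subspace_0 flip: zero_ctensor.abs_eq)
  next
    case (update p k c)
    have split: "Poly_Mapping.update k c p = Poly_Mapping.single k c + p"
      using update(1) by (intro poly_mapping_eqI)
        (auto simp: lookup_update lookup_add lookup_single when_def in_keys_iff)
    obtain x y where k: "k = (x, y)" by (cases k)
    have "abs_ctensor (Poly_Mapping.single k c) = c *\<^sub>C (x \<otimes>\<^sub>C y)"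
      by (simp add: k tensor.abs_eq scaleC_ctensor.abs_eq scaleC_single)
    then show ?case
      using update(3) unfolding split plus_ctensor.abs_eq[symmetric]
      by (simp add: tensor_in_tensor_space complex_vector.subspace_scale complex_vector.subspace_add)
  qed
  ultimately show ?thesis by blast
qed

lemma tensor_induct [case_names tensor add]:
  assumes "\<And>x y. P (x \<otimes>\<^sub>C y)" "\<And>s t. P s \<Longrightarrow> P t \<Longrightarrow> P (s + t)"
  shows "P t"
  by (rule tensor_space_induct[OF csubspace_UNIV csubspace_UNIV tensor_space_UNIV]) (use assms in auto)

lemma tensor_lift_tensor: "balanced b \<Longrightarrow> tensor_lift b (x \<otimes>\<^sub>C y) = b x y"
  by (simp add: tensor_lift_on_tensor)

lemma tensor_lift_add: "balanced b \<Longrightarrow> tensor_lift b (s + t) = tensor_lift b s + tensor_lift b t"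
  by (simp add: tensor_lift_on_add)

text \<open>
  A map such as \<open>(\<phi>, \<nu>) \<mapsto> \<phi> f \<nu>\<close> is bilinear for arbitrary functions \<open>\<phi>\<close>, not only for elements of
  the dual module; its lift may then be computed without regard to the subspace.
\<close>

lemma tensor_lift_on_eq_tensor_lift:
  assumes "csubspace X" "csubspace Y" "balanced b" "t \<in> tensor_space X Y"
  shows "tensor_lift_on X Y b t = tensor_lift b t"
proof -
  have b: "balanced_on X Y b" using assms(3) by (auto simp: balanced_on_def)
  show ?thesis
    using assms(1,2,4)
    by (induction t rule: tensor_space_induct)
      (simp_all add: tensor_lift_on_tensor[OF assms(1,2) b] tensor_lift_tensor[OF assms(3)]
        tensor_lift_on_add[OF assms(1,2) b] tensor_lift_add[OF assms(3)])
qed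

lemma tensor_lift_zero: "balanced b \<Longrightarrow> tensor_lift b 0 = 0"
  using tensor_lift_add[of b 0 0] by simp

lemma tensor_lift_scale:
  fixes b :: "'a::complex_vector \<Rightarrow> 'b::complex_vector \<Rightarrow> 'c::complex_vector"
  assumes "balanced b" "\<And>x y. b (c *\<^sub>C x) y = c' *\<^sub>C b x y"
  shows "tensor_lift b (c *\<^sub>C t) = c' *\<^sub>C tensor_lift b t"
  by (induction t rule: tensor_induct)
    (simp_all add: assms tensor_lift_tensor tensor_lift_add scaleC_add_right flip: tensor_scaleC_left)

lemma tensor_lift_fun_add:
  assumes "balanced b" "balanced b'" "balanced (\<lambda>x y. b x y + b' x y)"
  shows "tensor_lift (\<lambda>x y. b x y + b' x y) t = tensor_lift b t + tensor_lift b' t"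
  by (induction t rule: tensor_induct) (simp_all add: assms tensor_lift_tensor tensor_lift_add)

lemma tensor_lift_fun_diff:
  assumes "balanced b" "balanced b'" "balanced (\<lambda>x y. b x y - b' x y)"
  shows "tensor_lift (\<lambda>x y. b x y - b' x y) t = tensor_lift b t - tensor_lift b' t"
  by (induction t rule: tensor_induct) (simp_all add: assms tensor_lift_tensor tensor_lift_add)

lemma tensor_lift_fun_zero: "tensor_lift (\<lambda>x y. 0 :: 'c::ab_group_add) t = 0"
  using tensor_lift_fun_diff[of "\<lambda>x y. 0 :: 'c" "\<lambda>x y. 0" t] by (simp add: balanced_on_def)

subsection \<open>Linearity of composite maps\<close>

lemma clinear_id [lin]: "clinear (\<lambda>x. x)" by (rule clinearI) auto
lemma clinear_id' [lin]: "clinear id" by (rule clinearI) auto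
lemma clinear_const [lin]: "clinear (\<lambda>x. 0)" by (rule clinearI) auto
lemma clinear_add [lin]: "clinear f \<Longrightarrow> clinear g \<Longrightarrow> clinear (\<lambda>x. f x + g x)"
  by (rule clinearI) (simp_all add: clinearD scaleC_add_right)
lemma clinear_diff [lin]: "clinear f \<Longrightarrow> clinear g \<Longrightarrow> clinear (\<lambda>x. f x - g x)"
  by (rule clinearI) (simp_all add: clinearD complex_vector.scale_right_diff_distrib)

lemma clinear_scaleC [lin]: "clinear f \<Longrightarrow> clinear (\<lambda>x. c *\<^sub>C f x)"
  by (rule clinearI) (simp_all add: clinearD scaleC_add_right scaleC_scaleC mult.commute)
lemma clinear_scaleC_left [lin]: "clinear f \<Longrightarrow> clinear (\<lambda>x. (f x :: complex) *\<^sub>C v)"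
  by (rule clinearI) (simp_all add: clinearD scaleC_add_left scaleC_scaleC scaleC_complex_def)
lemma clinear_mult_left [lin]: "clinear f \<Longrightarrow> clinear (\<lambda>x. f x * (y::'a::complex_algebra))"
  by (rule clinearI) (simp_all add: clinearD distrib_right mult_scaleC_left)
lemma clinear_mult_right [lin]: "clinear f \<Longrightarrow> clinear (\<lambda>x. (y::'a::complex_algebra) * f x)"
  by (rule clinearI) (simp_all add: clinearD distrib_left mult_scaleC_right)
lemma clinear_tensor_left [lin]: "clinear f \<Longrightarrow> clinear (\<lambda>x. f x \<otimes>\<^sub>C y)"
  by (rule clinearI) (simp_all add: clinearD tensor_add_left tensor_scaleC_left)
lemma clinear_tensor_right [lin]: "clinear f \<Longrightarrow> clinear (\<lambda>x. y \<otimes>\<^sub>C f x)"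
  by (rule clinearI) (simp_all add: clinearD tensor_add_right tensor_scaleC_right)
lemma clinear_eval [lin]: "clinear (\<lambda>\<phi> :: 'i \<Rightarrow> 'b::complex_vector. \<phi> x)"
  by (rule clinearI) (simp_all add: scaleC_fun_def)
lemma clinear_quot_proj: "csubspace N \<Longrightarrow> clinear f \<Longrightarrow> clinear (\<lambda>x. quot_proj N (f x))"
  by (rule clinearI) (simp_all add: clinearD quot_proj(1))
lemma clinear_comp: "clinear g \<Longrightarrow> clinear f \<Longrightarrow> clinear (\<lambda>x. g (f x))"
  by (rule clinearI) (simp_all add: clinearD)

lemma antilinear_add [lin]: "antilinear f \<Longrightarrow> antilinear g \<Longrightarrow> antilinear (\<lambda>x. f x + g x)"
  by (rule antilinearI) (simp_all add: antilinearD scaleC_add_right)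
lemma antilinear_diff [lin]: "antilinear f \<Longrightarrow> antilinear g \<Longrightarrow> antilinear (\<lambda>x. f x - g x)"
  by (rule antilinearI) (simp_all add: antilinearD complex_vector.scale_right_diff_distrib)

lemma antilinear_mult_left [lin]: "antilinear f \<Longrightarrow> antilinear (\<lambda>x. f x * (y::'a::complex_algebra))"
  by (rule antilinearI) (simp_all add: antilinearD distrib_right mult_scaleC_left)
lemma antilinear_mult_right [lin]: "antilinear f \<Longrightarrow> antilinear (\<lambda>x. (y::'a::complex_algebra) * f x)"
  by (rule antilinearI) (simp_all add: antilinearD distrib_left mult_scaleC_right)
lemma antilinear_tensor_left [lin]: "antilinear f \<Longrightarrow> antilinear (\<lambda>x. f x \<otimes>\<^sub>C y)"
  by (rule antilinearI) (simp_all add: antilinearD tensor_add_left tensor_scaleC_left)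
lemma antilinear_tensor_right [lin]: "antilinear f \<Longrightarrow> antilinear (\<lambda>x. y \<otimes>\<^sub>C f x)"
  by (rule antilinearI) (simp_all add: antilinearD tensor_add_right tensor_scaleC_right)

lemma antilinear_comp: "clinear g \<Longrightarrow> antilinear f \<Longrightarrow> antilinear (\<lambda>x. g (f x))"
  by (rule antilinearI) (simp_all add: clinearD antilinearD)
lemma antilinear_comp': "antilinear g \<Longrightarrow> clinear f \<Longrightarrow> antilinear (\<lambda>x. g (f x))"
  by (rule antilinearI) (simp_all add: clinearD antilinearD)

lemma tensor_lift_scale_clinear:
  "(\<And>y. clinear (\<lambda>x. b x y)) \<Longrightarrow> balanced b \<Longrightarrow> tensor_lift b (c *\<^sub>C t) = c *\<^sub>C tensor_lift b t"
  by (rule tensor_lift_scale) (auto dest: clinearD(2))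

lemma tensor_lift_scale_antilinear:
  "(\<And>y. antilinear (\<lambda>x. b x y)) \<Longrightarrow> balanced b \<Longrightarrow> tensor_lift b (c *\<^sub>C t) = cnj c *\<^sub>C tensor_lift b t"
  by (rule tensor_lift_scale) (auto dest: antilinearD(2))

lemma clinear_tensor_lift [lin]:
  "(\<And>y. clinear (\<lambda>x. b x y)) \<Longrightarrow> balanced b \<Longrightarrow> clinear f \<Longrightarrow> clinear (\<lambda>x. tensor_lift b (f x))"
  by (rule clinearI) (simp_all add: clinearD tensor_lift_add tensor_lift_scale_clinear)

lemma antilinear_tensor_lift' [lin]:
  "(\<And>y. antilinear (\<lambda>x. b x y)) \<Longrightarrow> balanced b \<Longrightarrow> clinear f \<Longrightarrow> antilinear (\<lambda>x. tensor_lift b (f x))"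
  by (rule antilinearI) (simp_all add: clinearD tensor_lift_add tensor_lift_scale_antilinear)

lemma tensor_lift_fun_additive:
  assumes "\<And>a v. b (x + y) a v = b x a v + b y a v" "\<And>x. balanced (b x)"
  shows "tensor_lift (b (x + y)) t = tensor_lift (b x) t + tensor_lift (b y) t"
proof -
  have "b (x + y) = (\<lambda>a v. b x a v + b y a v)" using assms(1) by blast
  then show ?thesis using assms(2) tensor_lift_fun_add[of "b x" "b y" t] by metis
qed

lemma tensor_lift_fun_scale:
  fixes b :: "'x \<Rightarrow> 'a::complex_vector \<Rightarrow> 'b::complex_vector \<Rightarrow> 'c::complex_vector"
  assumes eq: "\<And>a v. b x a v = c *\<^sub>C b y a v" and bal: "\<And>x. balanced (b x)"
  shows "tensor_lift (b x) t = c *\<^sub>C tensor_lift (b y) t"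
proof (induction t rule: tensor_induct)
  case (tensor a v)
  show ?case unfolding tensor_lift_tensor[OF bal] by (rule eq)
next
  case (add s t)
  then show ?case by (simp add: tensor_lift_add bal scaleC_add_right)
qed

lemma clinear_tensor_lift_fun [lin]:
  assumes "\<And>a v. clinear (\<lambda>x. b x a v)" "\<And>x. balanced (b x)"
  shows "clinear (\<lambda>x. tensor_lift (b x) t)"
  by (rule clinearI) (auto intro!: tensor_lift_fun_additive tensor_lift_fun_scale
      simp: assms(2) clinearD[OF assms(1)])

lemma antilinear_tensor_lift_fun [lin]:
  assumes "\<And>a v. antilinear (\<lambda>x. b x a v)" "\<And>x. balanced (b x)"
  shows "antilinear (\<lambda>x. tensor_lift (b x) t)"
  by (rule antilinearI) (auto intro!: tensor_lift_fun_additive tensor_lift_fun_scale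
      simp: assms(2) antilinearD[OF assms(1)])

lemma tensor_map_tensor:
  "balanced (\<lambda>x y. f x \<otimes>\<^sub>C g y) \<Longrightarrow> tensor_map f g (x \<otimes>\<^sub>C y) = f x \<otimes>\<^sub>C g y"
  by (simp add: tensor_map_def tensor_lift_tensor)

lemma tensor_map_add:
  "balanced (\<lambda>x y. f x \<otimes>\<^sub>C g y) \<Longrightarrow> tensor_map f g (s + t) = tensor_map f g s + tensor_map f g t"
  by (simp add: tensor_map_def tensor_lift_add)

lemma clinear_mult_map: "clinear ((*) (a :: 'x::complex_algebra))"
  using clinear_mult_right[OF clinear_id, of a] by simp

lemma clinear_tensor_map [lin]:
  "clinear f \<Longrightarrow> clinear g \<Longrightarrow> clinear k \<Longrightarrow> clinear (\<lambda>x. tensor_map f g (k x))"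
  unfolding tensor_map_def by (simp add: lin clinear_comp)

lemma clinear_tensor_mult_left [lin]:
  assumes "\<And>y. clinear (\<lambda>x. m x y)" "\<And>x. clinear (\<lambda>y. m x y)" "clinear k"
  shows "clinear (\<lambda>x. tensor_mult m (k x) t)"
  unfolding tensor_mult_on_def
  by (simp add: lin clinear_comp assms clinear_comp[OF assms(1)] clinear_comp[OF assms(2)])

lemma clinear_tensor_mult_right [lin]:
  assumes "\<And>y. clinear (\<lambda>x. m x y)" "\<And>x. clinear (\<lambda>y. m x y)" "clinear k"
  shows "clinear (\<lambda>x. tensor_mult m t (k x))"
  unfolding tensor_mult_on_def
  by (simp add: lin clinear_comp assms clinear_comp[OF assms(1)] clinear_comp[OF assms(2)])

lemma tensor_mult_add:
  assumes "\<And>y. clinear (\<lambda>x. m x y)" "\<And>x. clinear (\<lambda>y. m x y)"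
  shows "tensor_mult m (s + s') t = tensor_mult m s t + tensor_mult m s' t"
    and "tensor_mult m s (t + t') = tensor_mult m s t + tensor_mult m s t'"
  using clinearD(1)[OF clinear_tensor_mult_left[OF assms clinear_id, of t]]
    clinearD(1)[OF clinear_tensor_mult_right[OF assms clinear_id, of s]] by auto

lemma tensor_mult_tensor:
  assumes "\<And>y. clinear (\<lambda>x. m x y)" "\<And>x. clinear (\<lambda>y. m x y)"
  shows "tensor_mult m (a \<otimes>\<^sub>C x) (b \<otimes>\<^sub>C y) = (a * b) \<otimes>\<^sub>C m x y"
  unfolding tensor_mult_on_def
  by (simp add: lin clinear_comp assms clinear_comp[OF assms(1)] clinear_comp[OF assms(2)] tensor_lift_tensor)

lemma tensor_lift_comp:
  assumes b: "balanced b" and g: "\<And>x y. g (x + y) = g x + g y"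
  shows "g (tensor_lift b t) = tensor_lift (\<lambda>x y. g (b x y)) t"
proof -
  have gb: "balanced (\<lambda>x y. g (b x y))"
    using balancedD[OF b] by (simp add: balanced_on_def g)
  show ?thesis
    by (induction t rule: tensor_induct) (simp_all add: b gb g tensor_lift_tensor tensor_lift_add)
qed

text \<open>
  The condition on a function of three arguments under which it may be evaluated on iterated
  coproducts; it covers maps that are linear, or conjugate-linear, in all arguments.
\<close>

definition tribalanced ::
    "('a::complex_vector \<Rightarrow> 'b::complex_vector \<Rightarrow> 'c::complex_vector \<Rightarrow> 'd::ab_group_add) \<Rightarrow> bool" where
  "tribalanced b \<longleftrightarrow>
     (\<forall>x x' y z. b (x + x') y z = b x y z + b x' y z) \<and>
     (\<forall>x y y' z. b x (y + y') z = b x y z + b x y' z) \<and>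
     (\<forall>x y z z'. b x y (z + z') = b x y z + b x y z') \<and>
     (\<forall>c x y z. b (c *\<^sub>C x) y z = b x (c *\<^sub>C y) z) \<and>
     (\<forall>c x y z. b x (c *\<^sub>C y) z = b x y (c *\<^sub>C z))"

lemma tribalanced_clinear [lin]:
  assumes "\<And>y z. clinear (\<lambda>x. b x y z)" "\<And>x z. clinear (\<lambda>y. b x y z)" "\<And>x y. clinear (\<lambda>z. b x y z)"
  shows "tribalanced b"
  by (simp add: tribalanced_def clinearD[OF assms(1)] clinearD[OF assms(2)] clinearD[OF assms(3)])

lemma tribalanced_antilinear [lin]:
  assumes "\<And>y z. antilinear (\<lambda>x. b x y z)" "\<And>x z. antilinear (\<lambda>y. b x y z)" "\<And>x y. antilinear (\<lambda>z. b x y z)"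
  shows "tribalanced b"
  by (simp add: tribalanced_def antilinearD[OF assms(1)] antilinearD[OF assms(2)] antilinearD[OF assms(3)])

lemma tribalanced_imp_balanced:
  assumes b: "tribalanced b"
  shows "balanced (b x)" "balanced (\<lambda>x y. b x y z)"
    "balanced (\<lambda>x t. tensor_lift (b x) t)" "balanced (\<lambda>s z. tensor_lift (\<lambda>x y. b x y z) s)"
proof -
  show 1: "balanced (b x)" for x using b by (simp add: tribalanced_def balanced_on_def)
  show 2: "balanced (\<lambda>x y. b x y z)" for z using b by (simp add: tribalanced_def balanced_on_def)
  have "tensor_lift (b (x + x')) t = tensor_lift (b x) t + tensor_lift (b x') t" for x x' t
    using b by (intro tensor_lift_fun_additive) (simp_all add: tribalanced_def 1)
  moreover have "tensor_lift (b (c *\<^sub>C x)) t = tensor_lift (b x) (c *\<^sub>C t)" for c x t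
  proof (induction t rule: tensor_induct)
    case (tensor y z)
    then show ?case
      using b unfolding tribalanced_def by (metis 1 tensor_lift_tensor tensor_scaleC_left)
  qed (simp add: tensor_lift_add 1 scaleC_add_right)
  ultimately show "balanced (\<lambda>x t. tensor_lift (b x) t)"
    by (simp add: balanced_on_def tensor_lift_add[OF 1])
  have "tensor_lift (\<lambda>x y. b x y (z + z')) t
      = tensor_lift (\<lambda>x y. b x y z) t + tensor_lift (\<lambda>x y. b x y z') t" for z z' t
    using tensor_lift_fun_additive[of "\<lambda>z x y. b x y z" z z' t] b by (simp add: tribalanced_def 2)
  moreover have "tensor_lift (\<lambda>x y. b x y z) (c *\<^sub>C t) = tensor_lift (\<lambda>x y. b x y (c *\<^sub>C z)) t" for c z t
  proof (induction t rule: tensor_induct)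
    case (tensor x y)
    then show ?case
      using b unfolding tribalanced_def by (metis 2 tensor_lift_tensor tensor_scaleC_left)
  qed (simp add: tensor_lift_add 2 scaleC_add_right)
  ultimately show "balanced (\<lambda>s z. tensor_lift (\<lambda>x y. b x y z) s)"
    by (simp add: balanced_on_def tensor_lift_add[OF 2])
qed

lemma tensor_assoc_tensor: "tensor_assoc (s \<otimes>\<^sub>C z) = tensor_lift (\<lambda>x y. x \<otimes>\<^sub>C y \<otimes>\<^sub>C z) s"
  unfolding tensor_assoc_def by (simp add: lin tensor_lift_tensor)

lemma tensor_assoc_add: "tensor_assoc (s + t) = tensor_assoc s + tensor_assoc t"
  unfolding tensor_assoc_def by (simp add: lin tensor_lift_add)

section \<open>Sweedler calculus\<close>

lemma comodule_clinear: "left_comodule H \<delta> \<Longrightarrow> clinear \<delta>"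
  by (simp add: left_comodule_def)

text \<open>
  This is what allows the notation \<open>b v_(-2) v_(-1) v_(0)\<close> of Sweedler: either leg of \<open>\<delta> v\<close> may be
  split again.
\<close>

lemma comodule_coassoc:
  assumes \<delta>: "left_comodule H \<delta>" and \<Delta>: "clinear (comult H)" and b: "tribalanced b"
  shows "tensor_lift (\<lambda>a v. tensor_lift (\<lambda>a1 a2. b a1 a2 v) (comult H a)) (\<delta> v)
    = tensor_lift (\<lambda>a w. tensor_lift (b a) (\<delta> w)) (\<delta> v)"
proof -
  note bal = tribalanced_imp_balanced[OF b] and lins = clinearD[OF \<Delta>] clinearD[OF comodule_clinear[OF \<delta>]]
  let ?L = "tensor_lift (\<lambda>a t. tensor_lift (b a) t)"
  have [lin]: "clinear (\<lambda>x. comult H (f x))" if "clinear f" for f :: "'x::complex_vector \<Rightarrow> 'a"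
    using that \<Delta> by (rule clinear_comp[rotated])
  have [lin]: "clinear (\<lambda>x. \<delta> (f x))" if "clinear f" for f :: "'x::complex_vector \<Rightarrow> 'b"
    using that comodule_clinear[OF \<delta>] by (rule clinear_comp[rotated])
  have inner: "?L (tensor_assoc (s \<otimes>\<^sub>C w)) = tensor_lift (\<lambda>a1 a2. b a1 a2 w) s" for s w
    by (induction s rule: tensor_induct)
      (simp_all add: tensor_assoc_tensor tensor_assoc_add tensor_add_left tensor_lift_tensor tensor_lift_add bal lin)
  have bl: "balanced (\<lambda>a v. tensor_lift (\<lambda>a1 a2. b a1 a2 v) (comult H a))"
    and br: "balanced (\<lambda>a w. tensor_lift (b a) (\<delta> w))"
    using balancedD[OF bal(4)] balancedD[OF bal(3)] by (simp_all add: balanced_on_def lins)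
  have "?L (tensor_assoc (tensor_map (comult H) id t))
      = tensor_lift (\<lambda>a v. tensor_lift (\<lambda>a1 a2. b a1 a2 v) (comult H a)) t" for t
    by (induction t rule: tensor_induct)
      (simp_all add: tensor_map_tensor tensor_map_add tensor_assoc_add tensor_lift_add tensor_lift_tensor
        lin inner bl bal)
  moreover have "?L (tensor_map id \<delta> t) = tensor_lift (\<lambda>a w. tensor_lift (b a) (\<delta> w)) t" for t
    by (induction t rule: tensor_induct)
      (simp_all add: tensor_map_tensor tensor_map_add tensor_lift_add tensor_lift_tensor lin br bal)
  ultimately show ?thesis using \<delta> by (metis left_comodule_def)
qed

text \<open>
  Additivity of \<open>g\<close> is assumed instead of linearity because the lemma is also applied to
  conjugate-linear maps.
\<close>

lemma comodule_counit:
  assumes \<delta>: "left_comodule H \<delta>" and \<epsilon>: "clinear (counit H)" and g: "\<And>x y. g (x + y) = g x + g y"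
  shows "tensor_lift (\<lambda>a w. g (counit H a *\<^sub>C w)) (\<delta> v) = g v"
proof -
  have "balanced (\<lambda>a w. counit H a *\<^sub>C w)" by (simp add: lin \<epsilon>)
  from tensor_lift_comp[where g = g, OF this g] show ?thesis using \<delta> by (metis left_comodule_def)
qed

locale hopf_star =
  fixes H :: "('a::complex_algebra) hopf"
  assumes hopf: "hopf_star_algebra H"
begin

lemma comult_comodule: "left_comodule H (comult H)"
  and comult_mult: "comult H (a * b) = tensor_mult (*) (comult H a) (comult H b)"
  and comult_right: "tensor_lift (\<lambda>x y. counit H y *\<^sub>C x) (comult H a) = a"
  and counit_mult: "counit H (a * b) = counit H a * counit H b"
  and antipode_left: "tensor_lift (\<lambda>x y. antipode H x * y) (comult H a) = counit H a *\<^sub>C 1"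
  and antipode_right: "tensor_lift (\<lambda>x y. x * antipode H y) (comult H a) = counit H a *\<^sub>C 1"
  and hstar_hstar [simp]: "hstar H (hstar H a) = a"
  and hstar_mult: "hstar H (a * b) = hstar H b * hstar H a"
  using hopf by (auto simp: hopf_star_algebra_def)

lemma clinear_comult: "clinear (comult H)" and clinear_counit: "clinear (counit H)"
  and clinear_antipode: "clinear (antipode H)" and antilinear_hstar: "antilinear (hstar H)"
  using hopf by (auto simp: hopf_star_algebra_def left_comodule_def)

lemmas [lin] = clinear_comp[OF clinear_comult] clinear_comp[OF clinear_counit]
  clinear_comp[OF clinear_antipode] antilinear_comp'[OF antilinear_hstar]
  antilinear_comp[OF clinear_comult] antilinear_comp[OF clinear_antipode]

text \<open>
  Both \<open>S (a\<^sub>1 b) a\<^sub>2\<close> and \<open>\<epsilon>(a) S b\<close> equal \<open>S (a\<^sub>1 b\<^sub>1) a\<^sub>2 b\<^sub>2 S (b\<^sub>3)\<close>: on the one hand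
  \<open>S (c\<^sub>1) c\<^sub>2 = \<epsilon>(c)\<close> for \<open>c = a b\<^sub>1\<close>, on the other hand \<open>b\<^sub>2 S (b\<^sub>3) = \<epsilon>(b\<^sub>2)\<close>. It replaces the
  antimultiplicativity of the antipode.
\<close>

lemma antipode_absorb:
  "tensor_lift (\<lambda>x y. antipode H (x * b) * y) (comult H a) = counit H a *\<^sub>C antipode H b"
proof -
  let ?S = "antipode H" and ?\<epsilon> = "counit H" and ?\<Delta> = "comult H"
  have conv: "tensor_lift (\<lambda>u v. ?S u * v) (tensor_mult (*) (x1 \<otimes>\<^sub>C x2) Y)
      = tensor_lift (\<lambda>y1 y2. ?S (x1 * y1) * (x2 * y2)) Y" for x1 x2 Y
    by (induction Y rule: tensor_induct)
      (simp_all add: tensor_mult_tensor tensor_lift_tensor tensor_lift_add tensor_mult_add lin)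
  \<comment> \<open>The coproduct of \<open>a\<close> is replaced by an arbitrary \<open>X\<close>, to permit induction over pure tensors.\<close>
  have *: "tensor_lift (\<lambda>b1 b2. tensor_lift (\<lambda>u v. ?S u * v) (tensor_mult (*) X (?\<Delta> b1)) * ?S b2) (?\<Delta> b)
      = tensor_lift (\<lambda>x1 x2. ?S (x1 * b) * x2) X" for X
  proof (induction X rule: tensor_induct)
    case (tensor x1 x2)
    have "tensor_lift (\<lambda>b1 b2. tensor_lift (\<lambda>u v. ?S u * v) (tensor_mult (*) (x1 \<otimes>\<^sub>C x2) (?\<Delta> b1)) * ?S b2) (?\<Delta> b)
      = tensor_lift (\<lambda>b1 b2. tensor_lift (\<lambda>y1 y2. ?S (x1 * y1) * (x2 * y2) * ?S b2) (?\<Delta> b1)) (?\<Delta> b)"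
      unfolding conv by (subst tensor_lift_comp[where g = "\<lambda>z. z * _"]) (simp_all add: lin distrib_right)
    also have "\<dots> = tensor_lift (\<lambda>b1 w. tensor_lift (\<lambda>y z. ?S (x1 * b1) * (x2 * y) * ?S z) (?\<Delta> w)) (?\<Delta> b)"
      by (rule comodule_coassoc[OF comult_comodule clinear_comult]) (simp add: lin)
    also have "\<dots> = tensor_lift (\<lambda>b1 w. ?S (x1 * b1) * x2 * tensor_lift (\<lambda>y z. y * ?S z) (?\<Delta> w)) (?\<Delta> b)"
      by (subst tensor_lift_comp[where g = "\<lambda>z. _ * z"]) (simp_all add: lin distrib_left mult.assoc)
    also have "\<dots> = tensor_lift (\<lambda>b1 w. ?S (x1 * (?\<epsilon> w *\<^sub>C b1)) * x2) (?\<Delta> b)"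
      by (simp add: antipode_right mult_scaleC_right mult_scaleC_left clinearD[OF clinear_antipode])
    also have "\<dots> = ?S (x1 * b) * x2"
      by (subst tensor_lift_comp[where g = "\<lambda>z. ?S (x1 * z) * x2", symmetric])
        (simp_all add: lin distrib_left distrib_right clinearD[OF clinear_antipode] comult_right)
    finally show ?case by (simp add: tensor_lift_tensor lin)
  next
    case (add s t)
    have "tensor_lift (\<lambda>b1 b2. tensor_lift (\<lambda>u v. ?S u * v) (tensor_mult (*) (s + t) (?\<Delta> b1)) * ?S b2) (?\<Delta> b)
      = tensor_lift (\<lambda>b1 b2. tensor_lift (\<lambda>u v. ?S u * v) (tensor_mult (*) s (?\<Delta> b1)) * ?S b2) (?\<Delta> b)
      + tensor_lift (\<lambda>b1 b2. tensor_lift (\<lambda>u v. ?S u * v) (tensor_mult (*) t (?\<Delta> b1)) * ?S b2) (?\<Delta> b)"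
      by (rule tensor_lift_fun_additive[of "\<lambda>X b1 b2. tensor_lift (\<lambda>u v. ?S u * v) (tensor_mult (*) X (?\<Delta> b1)) * ?S b2"])
        (simp_all add: lin tensor_lift_add distrib_right tensor_mult_add)
    then show ?case using add by (simp add: tensor_lift_add lin)
  qed
  have "tensor_lift (\<lambda>x y. ?S (x * b) * y) (?\<Delta> a)
      = tensor_lift (\<lambda>b1 b2. tensor_lift (\<lambda>u v. ?S u * v) (?\<Delta> (a * b1)) * ?S b2) (?\<Delta> b)"
    by (simp add: * comult_mult)
  also have "\<dots> = tensor_lift (\<lambda>b1 b2. ?\<epsilon> a *\<^sub>C ?S (?\<epsilon> b1 *\<^sub>C b2)) (?\<Delta> b)"
    by (simp add: antipode_left counit_mult mult_scaleC_left clinearD[OF clinear_antipode] scaleC_scaleC)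
  also have "\<dots> = ?\<epsilon> a *\<^sub>C ?S b"
    by (rule comodule_counit[OF comult_comodule clinear_counit])
      (simp add: clinearD[OF clinear_antipode] scaleC_add_right)
  finally show ?thesis .
qed

end

section \<open>Internal direct sums\<close>

lemma decomposition_single:
  assumes V: "\<And>i. csubspace (V i)" and x: "x \<in> V i"
  shows "decomposition V x (\<lambda>j. if j = i then x else 0)"
proof -
  have S: "{j. (if j = i then x else 0) \<noteq> 0} = (if x = 0 then {} else {i})" by auto
  show ?thesis
    unfolding decomposition_def S using x complex_vector.subspace_0[OF V] by auto
qed

lemma decomposition_superset:
  assumes "decomposition V x c" "finite S" "{i. c i \<noteq> 0} \<subseteq> S"
  shows "x = (\<Sum>i\<in>S. c i)"
  using assms unfolding decomposition_def by (metis (mono_tags, lifting) DiffD2 mem_Collect_eq sum.mono_neutral_left)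

lemma decomposition_add:
  assumes V: "\<And>i. csubspace (V i)" and c: "decomposition V x c" and e: "decomposition V y e"
  shows "decomposition V (x + y) (\<lambda>i. c i + e i)"
proof -
  let ?S = "{i. c i \<noteq> 0} \<union> {i. e i \<noteq> 0}"
  have fin: "finite ?S" using c e by (simp add: decomposition_def)
  have sub: "{i. c i + e i \<noteq> 0} \<subseteq> ?S" by auto
  have "x + y = (\<Sum>i\<in>?S. c i + e i)"
    using decomposition_superset[OF c fin] decomposition_superset[OF e fin] by (simp add: sum.distrib)
  also have "\<dots> = (\<Sum>i | c i + e i \<noteq> 0. c i + e i)"
    by (rule sum.mono_neutral_right[OF fin sub]) auto
  finally show ?thesis
    using c e finite_subset[OF sub fin] complex_vector.subspace_add[OF V] by (simp add: decomposition_def)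
qed

lemma decomposition_scale:
  assumes V: "\<And>i. csubspace (V i)" and c: "decomposition V x c"
  shows "decomposition V (z *\<^sub>C x) (\<lambda>i. z *\<^sub>C c i)"
proof (cases "z = 0")
  case True
  then show ?thesis by (simp add: decomposition_def complex_vector.subspace_0[OF V])
next
  case False
  then show ?thesis
    using c complex_vector.subspace_scale[OF V]
    by (auto simp: decomposition_def complex_vector.scale_sum_right)
qed

context
  fixes V :: "'i \<Rightarrow> 'w::complex_vector set"
  assumes V: "direct_sum V"
begin

lemma direct_sum_subspace: "csubspace (V i)"
  using V by (simp add: direct_sum_def)

lemma component_eqI: "decomposition V x c \<Longrightarrow> component V i x = c i"
  using V unfolding component_def direct_sum_def by (metis the_equality)

lemma decomposition_component: "decomposition V x (\<lambda>i. component V i x)"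
proof -
  obtain c where "decomposition V x c" using V unfolding direct_sum_def by blast
  then show ?thesis using component_eqI[of x c] by simp
qed

lemma component_in: "component V i x \<in> V i"
  using decomposition_component[of x] by (simp add: decomposition_def)

lemma component_of: "x \<in> V i \<Longrightarrow> component V j x = (if j = i then x else 0)"
  using component_eqI[OF decomposition_single[OF direct_sum_subspace]] .

lemma clinear_component: "clinear (component V i)"
  by (rule clinearI)
    (auto intro!: component_eqI decomposition_add decomposition_scale direct_sum_subspace decomposition_component)

lemma direct_sum_induct [case_names component add]:
  assumes comp: "\<And>i x. x \<in> V i \<Longrightarrow> P x" and add: "\<And>x y. P x \<Longrightarrow> P y \<Longrightarrow> P (x + y)"
  shows "P x"
proof -
  have "P (\<Sum>i\<in>I. component V i x)" for I
    by (induction I rule: infinite_finite_induct)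
      (auto intro: add comp[OF component_in] comp[OF complex_vector.subspace_0[OF direct_sum_subspace]])
  then show ?thesis
    using decomposition_component[of x] unfolding decomposition_def by metis
qed

end

section \<open>Complex structures on differential star-calculi\<close>

locale complex_star_calculus = hopf_star H for H :: "('a::complex_algebra) hopf" +
  fixes \<Omega> :: "('a, 'w::complex_algebra) complex_calculus"
  assumes calculus: "star_calculus H \<Omega>" and complex: "complex_structure \<Omega>"
begin

lemma direct_sum_form: "direct_sum (form \<Omega>)"
  and one_base [simp]: "1 \<in> base \<Omega>"
  and form_mult: "\<omega> \<in> form \<Omega> k \<Longrightarrow> \<nu> \<in> form \<Omega> l \<Longrightarrow> \<omega> * \<nu> \<in> form \<Omega> (k + l)"
  and clinear_ext_d: "clinear (ext_d \<Omega>)"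
  and ext_d_ext_d: "ext_d \<Omega> (ext_d \<Omega> \<omega>) = 0"
  and ext_d_mult: "\<omega> \<in> form \<Omega> k \<Longrightarrow>
    ext_d \<Omega> (\<omega> * \<nu>) = ext_d \<Omega> \<omega> * \<nu> + (-1) ^ k *\<^sub>C (\<omega> * ext_d \<Omega> \<nu>)"
  and antilinear_fstar: "antilinear (fstar \<Omega>)"
  and fstar_fstar [simp]: "fstar \<Omega> (fstar \<Omega> \<omega>) = \<omega>"
  and fstar_form: "\<omega> \<in> form \<Omega> k \<Longrightarrow> fstar \<Omega> \<omega> \<in> form \<Omega> k"
  and fstar_ext_d: "fstar \<Omega> (ext_d \<Omega> \<omega>) = ext_d \<Omega> (fstar \<Omega> \<omega>)"
  and fstar_mult_form: "\<omega> \<in> form \<Omega> k \<Longrightarrow> \<nu> \<in> form \<Omega> l \<Longrightarrow>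
    fstar \<Omega> (\<omega> * \<nu>) = (-1) ^ (k * l) *\<^sub>C (fstar \<Omega> \<nu> * fstar \<Omega> \<omega>)"
  and comodule_forms: "left_comodule H (fcoact \<Omega>)"
  and fcoact_form: "\<omega> \<in> form \<Omega> k \<Longrightarrow> fcoact \<Omega> \<omega> \<in> tensor_space UNIV (form \<Omega> k)"
  and fcoact_mult: "fcoact \<Omega> (\<omega> * \<nu>) = tensor_mult (*) (fcoact \<Omega> \<omega>) (fcoact \<Omega> \<nu>)"
  and fcoact_one: "fcoact \<Omega> 1 = 1 \<otimes>\<^sub>C 1"
  and fcoact_ext_d: "fcoact \<Omega> (ext_d \<Omega> \<omega>) = tensor_map id (ext_d \<Omega>) (fcoact \<Omega> \<omega>)"
  and fcoact_fstar: "fcoact \<Omega> (fstar \<Omega> \<omega>) = tensor_map (hstar H) (fstar \<Omega>) (fcoact \<Omega> \<omega>)"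
  using calculus by (auto simp: star_calculus_def)

lemma direct_sum_biform: "direct_sum (biform \<Omega>)"
  and form_eq_span: "form \<Omega> k = cspan (\<Union>(a, b)\<in>{(a, b). a + b = k}. biform \<Omega> (a, b))"
  and biform_mult: "\<omega> \<in> biform \<Omega> (a, b) \<Longrightarrow> \<nu> \<in> biform \<Omega> (a', b') \<Longrightarrow> \<omega> * \<nu> \<in> biform \<Omega> (a + a', b + b')"
  and clinear_del: "clinear (del \<Omega>)" and clinear_delbar: "clinear (delbar \<Omega>)"
  and del_biform: "\<omega> \<in> biform \<Omega> (a, b) \<Longrightarrow> del \<Omega> \<omega> \<in> biform \<Omega> (Suc a, b)"
  and delbar_biform: "\<omega> \<in> biform \<Omega> (a, b) \<Longrightarrow> delbar \<Omega> \<omega> \<in> biform \<Omega> (a, Suc b)"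
  and ext_d_eq: "ext_d \<Omega> \<omega> = del \<Omega> \<omega> + delbar \<Omega> \<omega>"
  using complex by (auto simp: complex_structure_def)

lemma fcoact_biform: "\<omega> \<in> biform \<Omega> p \<Longrightarrow> fcoact \<Omega> \<omega> \<in> tensor_space UNIV (biform \<Omega> p)"
  using complex unfolding complex_structure_def by blast

lemma fstar_biform: "\<omega> \<in> biform \<Omega> (a, b) \<Longrightarrow> fstar \<Omega> \<omega> \<in> biform \<Omega> (b, a)"
  using complex unfolding complex_structure_def by blast

lemmas clinear_fcoact = comodule_clinear[OF comodule_forms]

abbreviation part :: "nat \<times> nat \<Rightarrow> 'w \<Rightarrow> 'w" where "part \<equiv> component (biform \<Omega>)"

lemmas part_in = component_in[OF direct_sum_biform]
  and part_of = component_of[OF direct_sum_biform]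
  and clinear_part = clinear_component[OF direct_sum_biform]
  and biform_subspace [simp] = direct_sum_subspace[OF direct_sum_biform]
  and form_subspace [simp] = direct_sum_subspace[OF direct_sum_form]
  and biform_induct = direct_sum_induct[OF direct_sum_biform, case_names component add]
  and form_induct = direct_sum_induct[OF direct_sum_form, case_names component add]

lemmas part_linear = clinearD[OF clinear_part]
  and del_linear = clinearD[OF clinear_del]
  and delbar_linear = clinearD[OF clinear_delbar]
  and fstar_antilinear = antilinearD[OF antilinear_fstar]
  and ext_d_linear = clinearD[OF clinear_ext_d]
  and fcoact_linear = clinearD[OF clinear_fcoact]

lemma biform_subset_form: "\<omega> \<in> biform \<Omega> (a, b) \<Longrightarrow> \<omega> \<in> form \<Omega> (a + b)"
  unfolding form_eq_span by (intro complex_vector.span_base) auto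

lemma base_eq: "base \<Omega> = biform \<Omega> (0, 0)"
  unfolding form_eq_span by (simp add: complex_vector.span_eq_iff[THEN iffD2])

lemma base_closed: "m \<in> base \<Omega> \<Longrightarrow> n \<in> base \<Omega> \<Longrightarrow> m * n \<in> base \<Omega>"
  and base_scale: "m \<in> base \<Omega> \<Longrightarrow> c *\<^sub>C m \<in> base \<Omega>"
  and base_add: "m \<in> base \<Omega> \<Longrightarrow> n \<in> base \<Omega> \<Longrightarrow> m + n \<in> base \<Omega>"
  and base_zero: "0 \<in> base \<Omega>"
  using form_mult[of m 0 n 0]
  by (simp_all add: complex_vector.subspace_scale complex_vector.subspace_add complex_vector.subspace_0)

lemma form_1_parts:
  assumes "\<omega> \<in> form \<Omega> 1"
  shows "\<omega> = part (1, 0) \<omega> + part (0, 1) \<omega>"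
  using assms unfolding form_eq_span[of 1]
proof (induction rule: complex_vector.span_induct_alt)
  case base
  show ?case by (simp add: part_linear)
next
  case (step c x y)
  then have "x \<in> biform \<Omega> (1, 0) \<or> x \<in> biform \<Omega> (0, 1)" by (auto simp: add_is_1)
  then have "x = part (1, 0) x + part (0, 1) x" by (auto simp: part_of)
  from arg_cong[OF this, of "(*\<^sub>C) c"]
  have "c *\<^sub>C x = c *\<^sub>C part (1, 0) x + c *\<^sub>C part (0, 1) x" by (simp only: scaleC_add_right)
  from arg_cong2[where f = "(+)", OF this step(2)]
  have "c *\<^sub>C x + y
    = (c *\<^sub>C part (1, 0) x + c *\<^sub>C part (0, 1) x) + (part (1, 0) y + part (0, 1) y)" .
  also have "\<dots> = part (1, 0) (c *\<^sub>C x + y) + part (0, 1) (c *\<^sub>C x + y)"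
    by (simp add: part_linear algebra_simps)
  finally show ?case .
qed

lemma grade_inv_form:
  assumes "\<omega> \<in> form \<Omega> k"
  shows "grade_inv \<Omega> \<omega> = (-1) ^ k *\<^sub>C \<omega>"
proof -
  have "{j. component (form \<Omega>) j \<omega> \<noteq> 0} = (if \<omega> = 0 then {} else {k})"
    using component_of[OF direct_sum_form assms] by auto
  then show ?thesis using component_of[OF direct_sum_form assms] by (simp add: grade_inv_def)
qed

lemma grade_inv_biform: "\<omega> \<in> biform \<Omega> (a, b) \<Longrightarrow> grade_inv \<Omega> \<omega> = (-1) ^ (a + b) *\<^sub>C \<omega>"
  by (rule grade_inv_form[OF biform_subset_form])

lemma clinear_grade_inv: "clinear (grade_inv \<Omega>)"
proof -
  note lins = clinearD[OF clinear_component[OF direct_sum_form]]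
  have sup: "grade_inv \<Omega> \<omega> = (\<Sum>k\<in>S. (-1) ^ k *\<^sub>C component (form \<Omega>) k \<omega>)"
    if "finite S" "{k. component (form \<Omega>) k \<omega> \<noteq> 0} \<subseteq> S" for S \<omega>
    unfolding grade_inv_def using that by (intro sum.mono_neutral_left) auto
  have fin: "finite {k. component (form \<Omega>) k \<omega> \<noteq> 0}" for \<omega>
    using decomposition_component[OF direct_sum_form, of \<omega>] by (simp add: decomposition_def)
  show ?thesis
  proof (rule clinearI)
    fix x y :: 'w and c
    let ?S = "{k. component (form \<Omega>) k x \<noteq> 0} \<union> {k. component (form \<Omega>) k y \<noteq> 0}"
    have "finite ?S" using fin by simp
    from sup[OF this] show "grade_inv \<Omega> (x + y) = grade_inv \<Omega> x + grade_inv \<Omega> y"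
      by (subst (1 2 3) sup[of ?S]) (auto simp: fin lins scaleC_add_right sum.distrib)
    show "grade_inv \<Omega> (c *\<^sub>C x) = c *\<^sub>C grade_inv \<Omega> x"
      by (subst (1 2) sup[OF fin[of x]])
        (auto simp: lins complex_vector.scale_sum_right scaleC_scaleC mult.commute)
  qed
qed

lemmas grade_inv_linear = clinearD[OF clinear_grade_inv]

lemma grade_inv_mult_base: "m \<in> base \<Omega> \<Longrightarrow> grade_inv \<Omega> (\<omega> * m) = grade_inv \<Omega> \<omega> * m"
proof (induction \<omega> rule: form_induct)
  case (component k \<omega>)
  then have "\<omega> * m \<in> form \<Omega> k" using form_mult[of \<omega> k m 0] by simp
  then show ?case using component by (simp add: grade_inv_form mult_scaleC_left)
qed (simp add: grade_inv_linear distrib_right)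

lemma grade_inv_grade_inv: "grade_inv \<Omega> (grade_inv \<Omega> \<omega>) = \<omega>"
  by (induction \<omega> rule: form_induct)
    (simp_all add: grade_inv_linear grade_inv_form scaleC_scaleC scaleC_one flip: power_mult_distrib)

lemma grade_inv_mult: "grade_inv \<Omega> (\<omega> * \<nu>) = grade_inv \<Omega> \<omega> * grade_inv \<Omega> \<nu>"
proof (induction \<omega> rule: form_induct)
  case (component k \<omega>)
  show ?case
  proof (induction \<nu> rule: form_induct)
    case (component l \<nu>)
    then show ?case
      using \<open>\<omega> \<in> form \<Omega> k\<close> form_mult[of \<omega> k \<nu> l]
      by (simp add: grade_inv_form power_add mult_scaleC_left mult_scaleC_right scaleC_scaleC)
  qed (simp add: grade_inv_linear distrib_left)
qed (simp add: grade_inv_linear distrib_right)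

lemma grade_inv_base: "m \<in> base \<Omega> \<Longrightarrow> grade_inv \<Omega> m = m"
  by (simp add: grade_inv_form scaleC_one)

lemma grade_inv_form_1: "\<omega> \<in> form \<Omega> 1 \<Longrightarrow> grade_inv \<Omega> \<omega> = - \<omega>"
  by (simp add: grade_inv_form scaleC_one)

lemmas [lin] = clinear_comp[OF clinear_ext_d] clinear_comp[OF clinear_del] clinear_comp[OF clinear_delbar]
  clinear_comp[OF clinear_fcoact] clinear_comp[OF clinear_part] clinear_comp[OF clinear_grade_inv]
  antilinear_comp'[OF antilinear_fstar]
  antilinear_comp[OF clinear_del] antilinear_comp[OF clinear_delbar] antilinear_comp[OF clinear_fcoact]
  antilinear_comp[OF clinear_part] antilinear_comp[OF clinear_grade_inv] antilinear_comp[OF clinear_ext_d]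

text \<open>
  Moving a form of degree one past \<open>\<omega>\<close> costs the sign \<open>(-1)\<^sup>k\<close> on the part of \<open>\<omega>\<close> of degree \<open>k\<close>, and
  \<^const>\<open>grade_inv\<close> carries this sign without requiring \<open>\<omega>\<close> to be homogeneous.
\<close>

lemma fstar_mult_grade:
  assumes "\<nu> \<in> form \<Omega> 1"
  shows "fstar \<Omega> (\<omega> * \<nu>) = fstar \<Omega> \<nu> * fstar \<Omega> (grade_inv \<Omega> \<omega>)"
    and "fstar \<Omega> (\<nu> * \<omega>) = fstar \<Omega> (grade_inv \<Omega> \<omega>) * fstar \<Omega> \<nu>"
proof -
  have [simp]: "cnj ((-1) ^ k) = (-1) ^ k" for k by simp
  show "fstar \<Omega> (\<omega> * \<nu>) = fstar \<Omega> \<nu> * fstar \<Omega> (grade_inv \<Omega> \<omega>)"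
    by (induction \<omega> rule: form_induct)
      (simp_all add: fstar_mult_form[OF _ assms] grade_inv_form fstar_antilinear mult_scaleC_right
        grade_inv_linear distrib_left distrib_right)
  show "fstar \<Omega> (\<nu> * \<omega>) = fstar \<Omega> (grade_inv \<Omega> \<omega>) * fstar \<Omega> \<nu>"
    by (induction \<omega> rule: form_induct)
      (simp_all add: fstar_mult_form[OF assms] grade_inv_form fstar_antilinear mult_scaleC_left
        grade_inv_linear distrib_left distrib_right)
qed

lemma fstar_mult_base:
  assumes "m \<in> base \<Omega>"
  shows "fstar \<Omega> (\<omega> * m) = fstar \<Omega> m * fstar \<Omega> \<omega>"
    and "fstar \<Omega> (m * \<omega>) = fstar \<Omega> \<omega> * fstar \<Omega> m"
proof -
  show "fstar \<Omega> (\<omega> * m) = fstar \<Omega> m * fstar \<Omega> \<omega>"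
    by (induction \<omega> rule: form_induct)
      (simp_all add: fstar_mult_form[OF _ assms] scaleC_one fstar_antilinear distrib_left distrib_right)
  show "fstar \<Omega> (m * \<omega>) = fstar \<Omega> \<omega> * fstar \<Omega> m"
    by (induction \<omega> rule: form_induct)
      (simp_all add: fstar_mult_form[OF assms] scaleC_one fstar_antilinear distrib_left distrib_right)
qed

lemma fstar_one [simp]: "fstar \<Omega> 1 = 1"
  using fstar_mult_base(1)[OF one_base, of "fstar \<Omega> 1"] by simp

text \<open>Both operators are bigraded parts of \<open>d\<close>, so identities for \<open>d\<close> split by bidegree.\<close>

lemma del_eq_part: "\<omega> \<in> biform \<Omega> (a, b) \<Longrightarrow> del \<Omega> \<omega> = part (Suc a, b) (ext_d \<Omega> \<omega>)"
  and delbar_eq_part: "\<omega> \<in> biform \<Omega> (a, b) \<Longrightarrow> delbar \<Omega> \<omega> = part (a, Suc b) (ext_d \<Omega> \<omega>)"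
  by (simp_all add: ext_d_eq part_linear part_of[OF del_biform] part_of[OF delbar_biform])

lemma del_mult: "del \<Omega> (\<omega> * \<nu>) = del \<Omega> \<omega> * \<nu> + grade_inv \<Omega> \<omega> * del \<Omega> \<nu>"
  and delbar_mult: "delbar \<Omega> (\<omega> * \<nu>) = delbar \<Omega> \<omega> * \<nu> + grade_inv \<Omega> \<omega> * delbar \<Omega> \<nu>"
proof -
  have "del \<Omega> (\<omega> * \<nu>) = del \<Omega> \<omega> * \<nu> + grade_inv \<Omega> \<omega> * del \<Omega> \<nu> \<and>
    delbar \<Omega> (\<omega> * \<nu>) = delbar \<Omega> \<omega> * \<nu> + grade_inv \<Omega> \<omega> * delbar \<Omega> \<nu>"
    if \<omega>: "\<omega> \<in> biform \<Omega> (a, b)" and \<nu>: "\<nu> \<in> biform \<Omega> (a', b')" for \<omega> \<nu> a b a' b'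
  proof -
    have d: "ext_d \<Omega> (\<omega> * \<nu>) = del \<Omega> \<omega> * \<nu> + delbar \<Omega> \<omega> * \<nu>
        + (-1) ^ (a + b) *\<^sub>C (\<omega> * del \<Omega> \<nu>) + (-1) ^ (a + b) *\<^sub>C (\<omega> * delbar \<Omega> \<nu>)"
      unfolding ext_d_mult[OF biform_subset_form[OF \<omega>]]
      by (simp add: ext_d_eq distrib_left distrib_right scaleC_add_right)
    have mem: "del \<Omega> \<omega> * \<nu> \<in> biform \<Omega> (Suc (a + a'), b + b')"
      "delbar \<Omega> \<omega> * \<nu> \<in> biform \<Omega> (a + a', Suc (b + b'))"
      "\<omega> * del \<Omega> \<nu> \<in> biform \<Omega> (Suc (a + a'), b + b')"
      "\<omega> * delbar \<Omega> \<nu> \<in> biform \<Omega> (a + a', Suc (b + b'))"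
      using biform_mult[OF del_biform[OF \<omega>] \<nu>] biform_mult[OF delbar_biform[OF \<omega>] \<nu>]
        biform_mult[OF \<omega> del_biform[OF \<nu>]] biform_mult[OF \<omega> delbar_biform[OF \<nu>]] by simp_all
    show ?thesis
      unfolding del_eq_part[OF biform_mult[OF \<omega> \<nu>]] delbar_eq_part[OF biform_mult[OF \<omega> \<nu>]] d
        grade_inv_biform[OF \<omega>]
      by (simp add: part_linear part_of[OF mem(1)] part_of[OF mem(2)] part_of[OF mem(3)] part_of[OF mem(4)]
          mult_scaleC_left)
  qed
  then have "del \<Omega> (\<omega> * \<nu>) = del \<Omega> \<omega> * \<nu> + grade_inv \<Omega> \<omega> * del \<Omega> \<nu> \<and>
    delbar \<Omega> (\<omega> * \<nu>) = delbar \<Omega> \<omega> * \<nu> + grade_inv \<Omega> \<omega> * delbar \<Omega> \<nu>" if "\<omega> \<in> biform \<Omega> p" for \<omega> p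
    using that
    by (induction \<nu> rule: biform_induct)
      (metis surj_pair, simp add: del_linear delbar_linear distrib_left)
  then have "del \<Omega> (\<omega> * \<nu>) = del \<Omega> \<omega> * \<nu> + grade_inv \<Omega> \<omega> * del \<Omega> \<nu> \<and>
    delbar \<Omega> (\<omega> * \<nu>) = delbar \<Omega> \<omega> * \<nu> + grade_inv \<Omega> \<omega> * delbar \<Omega> \<nu>"
    by (induction \<omega> rule: biform_induct) (auto simp: del_linear delbar_linear distrib_right grade_inv_linear)
  then show "del \<Omega> (\<omega> * \<nu>) = del \<Omega> \<omega> * \<nu> + grade_inv \<Omega> \<omega> * del \<Omega> \<nu>"
    "delbar \<Omega> (\<omega> * \<nu>) = delbar \<Omega> \<omega> * \<nu> + grade_inv \<Omega> \<omega> * delbar \<Omega> \<nu>" by auto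
qed

lemma fstar_delbar: "fstar \<Omega> (delbar \<Omega> \<omega>) = del \<Omega> (fstar \<Omega> \<omega>)"
proof (induction \<omega> rule: biform_induct)
  case (component p \<omega>)
  obtain a b where \<omega>: "\<omega> \<in> biform \<Omega> (a, b)" using component by (cases p) auto
  have "fstar \<Omega> (del \<Omega> \<omega>) + fstar \<Omega> (delbar \<Omega> \<omega>) = ext_d \<Omega> (fstar \<Omega> \<omega>)"
    using fstar_ext_d[of \<omega>] by (simp add: ext_d_eq fstar_antilinear)
  then have "part (Suc b, a) (fstar \<Omega> (del \<Omega> \<omega>) + fstar \<Omega> (delbar \<Omega> \<omega>)) = del \<Omega> (fstar \<Omega> \<omega>)"
    by (simp add: del_eq_part[OF fstar_biform[OF \<omega>]])
  then show ?case
    by (simp add: part_linear part_of[OF fstar_biform[OF del_biform[OF \<omega>]]]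
        part_of[OF fstar_biform[OF delbar_biform[OF \<omega>]]])
qed (simp add: fstar_antilinear del_linear delbar_linear)

lemma fstar_del: "fstar \<Omega> (del \<Omega> \<omega>) = delbar \<Omega> (fstar \<Omega> \<omega>)"
  by (metis fstar_delbar fstar_fstar)

lemma del_del: "del \<Omega> (del \<Omega> \<omega>) = 0"
proof (induction \<omega> rule: biform_induct)
  case (component p \<omega>)
  obtain a b where \<omega>: "\<omega> \<in> biform \<Omega> (a, b)" using component by (cases p) auto
  note mem = del_biform[OF del_biform[OF \<omega>]] delbar_biform[OF del_biform[OF \<omega>]]
    del_biform[OF delbar_biform[OF \<omega>]] delbar_biform[OF delbar_biform[OF \<omega>]]
  have "del \<Omega> (del \<Omega> \<omega>) = part (Suc (Suc a), b) (ext_d \<Omega> (ext_d \<Omega> \<omega>))"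
    by (simp add: ext_d_eq del_linear delbar_linear part_linear part_of[OF mem(1)] part_of[OF mem(2)]
        part_of[OF mem(3)] part_of[OF mem(4)])
  then show ?case by (simp add: ext_d_ext_d part_linear)
qed (simp add: del_linear)

lemma part_fstar: "fstar \<Omega> (part (a, b) \<omega>) = part (b, a) (fstar \<Omega> \<omega>)"
proof (induction \<omega> rule: biform_induct)
  case (component p \<omega>)
  obtain a' b' where \<omega>: "\<omega> \<in> biform \<Omega> (a', b')" using component by (cases p) auto
  show ?case by (auto simp: part_of[OF \<omega>] part_of[OF fstar_biform[OF \<omega>]] fstar_antilinear)
qed (simp add: fstar_antilinear part_linear)

lemma part_mult_base:
  assumes m: "m \<in> base \<Omega>"
  shows "part p (\<omega> * m) = part p \<omega> * m" "part p (m * \<omega>) = m * part p \<omega>"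
proof -
  have "part p (\<omega> * m) = part p \<omega> * m \<and> part p (m * \<omega>) = m * part p \<omega>"
  proof (induction \<omega> rule: biform_induct)
    case (component q \<omega>)
    obtain a b where \<omega>: "\<omega> \<in> biform \<Omega> (a, b)" and q: "q = (a, b)" using component by (cases q) auto
    have "\<omega> * m \<in> biform \<Omega> q" "m * \<omega> \<in> biform \<Omega> q"
      using biform_mult[OF \<omega>] biform_mult[OF _ \<omega>] m by (force simp: base_eq q)+
    then show ?case using component by (simp add: part_of)
  qed (simp add: part_linear distrib_left distrib_right)
  then show "part p (\<omega> * m) = part p \<omega> * m" "part p (m * \<omega>) = m * part p \<omega>" by auto
qed

lemma del_grade_inv: "del \<Omega> (grade_inv \<Omega> \<omega>) = - grade_inv \<Omega> (del \<Omega> \<omega>)"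
proof (induction \<omega> rule: biform_induct)
  case (component p \<omega>)
  obtain a b where \<omega>: "\<omega> \<in> biform \<Omega> (a, b)" using component by (cases p) auto
  show ?case
    using grade_inv_biform[OF \<omega>] grade_inv_biform[OF del_biform[OF \<omega>]]
    by (simp add: del_linear complex_vector.scale_minus_left)
qed (simp add: del_linear grade_inv_linear)

lemma del_one: "del \<Omega> 1 = 0" and delbar_one: "delbar \<Omega> 1 = 0"
  using del_mult[of 1 1] delbar_mult[of 1 1] by (simp_all add: grade_inv_base)

lemma delbar_form:
  assumes "\<omega> \<in> form \<Omega> k"
  shows "delbar \<Omega> \<omega> \<in> form \<Omega> (Suc k)"
  using assms unfolding form_eq_span[of k]
proof (induction rule: complex_vector.span_induct_alt)
  case (step c x y)
  then obtain a b where "x \<in> biform \<Omega> (a, b)" "a + b = k" by auto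
  then have "delbar \<Omega> x \<in> form \<Omega> (Suc k)"
    using biform_subset_form[OF delbar_biform] by fastforce
  then show ?case
    using step(2) by (simp add: delbar_linear complex_vector.subspace_add complex_vector.subspace_scale)
qed (simp add: delbar_linear complex_vector.subspace_0)

lemma biform_01_form: "biform \<Omega> (0, 1) \<subseteq> form \<Omega> 1" and biform_10_form: "biform \<Omega> (1, 0) \<subseteq> form \<Omega> 1"
  using biform_subset_form[of _ 0 1] biform_subset_form[of _ 1 0] by auto

text \<open>The coaction preserves bidegrees and commutes with \<open>d\<close>, hence commutes with \<open>del\<close>.\<close>

lemma fcoact_del: "fcoact \<Omega> (del \<Omega> \<omega>) = tensor_map id (del \<Omega>) (fcoact \<Omega> \<omega>)"
proof (induction \<omega> rule: biform_induct)
  case (component p \<omega>)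
  obtain a b where \<omega>: "\<omega> \<in> biform \<Omega> (a, b)" using component by (cases p) auto
  have fix_part: "tensor_map id (part p) t = (if p = q then t else 0)"
    if "t \<in> tensor_space UNIV (biform \<Omega> q)" for p q t
    using csubspace_UNIV biform_subspace that
    by (induction t rule: tensor_space_induct) (simp_all add: tensor_map_tensor tensor_map_add lin part_of)
  have del_part: "tensor_map id (part (Suc a, b)) (tensor_map id (ext_d \<Omega>) t) = tensor_map id (del \<Omega>) t"
    if "t \<in> tensor_space UNIV (biform \<Omega> (a, b))" for t
    using csubspace_UNIV biform_subspace that
    by (induction t rule: tensor_space_induct) (simp_all add: tensor_map_tensor tensor_map_add lin del_eq_part)
  have "fcoact \<Omega> (del \<Omega> \<omega>) = tensor_map id (part (Suc a, b)) (fcoact \<Omega> (del \<Omega> \<omega>) + fcoact \<Omega> (delbar \<Omega> \<omega>))"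
    by (simp add: tensor_map_add lin fix_part[OF fcoact_biform[OF del_biform[OF \<omega>]]]
        fix_part[OF fcoact_biform[OF delbar_biform[OF \<omega>]]])
  also have "\<dots> = tensor_map id (part (Suc a, b)) (tensor_map id (ext_d \<Omega>) (fcoact \<Omega> \<omega>))"
    by (simp add: ext_d_eq fcoact_linear flip: fcoact_ext_d)
  finally show ?case by (simp only: del_part[OF fcoact_biform[OF \<omega>]])
qed (simp add: del_linear fcoact_linear tensor_map_add lin)

end

section \<open>Bundles and their duals\<close>

locale covariant_bundle = complex_star_calculus H \<Omega>
  for H :: "('a::complex_algebra) hopf" and \<Omega> :: "('a, 'w::complex_algebra) complex_calculus" +
  fixes F :: "('a, 'w, 'f::complex_vector) vbundle"
  assumes covariant: "vector_bundle H \<Omega> F"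
begin

lemma clinear_act: "m \<in> base \<Omega> \<Longrightarrow> clinear (act F m)"
  and act_add_left: "m \<in> base \<Omega> \<Longrightarrow> n \<in> base \<Omega> \<Longrightarrow> act F (m + n) f = act F m f + act F n f"
  and act_scale_left: "m \<in> base \<Omega> \<Longrightarrow> act F (c *\<^sub>C m) f = c *\<^sub>C act F m f"
  and act_mult: "m \<in> base \<Omega> \<Longrightarrow> n \<in> base \<Omega> \<Longrightarrow> act F (m * n) f = act F m (act F n f)"
  and act_one [simp]: "act F 1 f = f"
  and comodule_bundle: "left_comodule H (vcoact F)"
  and vcoact_act: "m \<in> base \<Omega> \<Longrightarrow>
    vcoact F (act F m f) = tensor_mult_on (base \<Omega>) (act F) (fcoact \<Omega> m) (vcoact F f)"
  using covariant by (auto simp: vector_bundle_def left_module_def)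

lemmas clinear_vcoact = comodule_clinear[OF comodule_bundle]
lemmas [lin] = clinear_comp[OF clinear_vcoact] antilinear_comp[OF clinear_vcoact]

text \<open>
  Embed \<open>\<F>\<close> as a direct summand of a free module: the \<open>\<phi> i\<close> are the coordinates of the embedding
  and the \<open>e i\<close> are the projections of the unit vectors.
\<close>

lemma dual_basis:
  obtains n and e :: "nat \<Rightarrow> 'f" and \<phi> :: "nat \<Rightarrow> 'f \<Rightarrow> 'w"
  where "\<forall>i. \<phi> i \<in> dual \<Omega> F" "\<forall>f. f = (\<Sum>i<n. act F (\<phi> i f) (e i))"
proof -
  obtain n and s :: "'f \<Rightarrow> nat \<Rightarrow> 'w" and r :: "(nat \<Rightarrow> 'w) \<Rightarrow> 'f" where
    "\<forall>f. s f \<in> free_module \<Omega> n" "\<forall>f g. s (f + g) = s f + s g"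
    "\<forall>m\<in>base \<Omega>. \<forall>f. s (act F m f) = (\<lambda>i. m * s f i)"
    "\<forall>u\<in>free_module \<Omega> n. \<forall>v\<in>free_module \<Omega> n. r (u + v) = r u + r v"
    "\<forall>m\<in>base \<Omega>. \<forall>v\<in>free_module \<Omega> n. r (\<lambda>i. m * v i) = act F m (r v)"
    "\<forall>f. r (s f) = f"
    using covariant unfolding vector_bundle_def fg_projective_def
    by (elim conjE exE) (rule that; assumption)
  then have s: "\<And>f. s f \<in> free_module \<Omega> n" "\<And>f g. s (f + g) = s f + s g"
       "\<And>m f. m \<in> base \<Omega> \<Longrightarrow> s (act F m f) = (\<lambda>i. m * s f i)"
    and r: "\<And>u v. u \<in> free_module \<Omega> n \<Longrightarrow> v \<in> free_module \<Omega> n \<Longrightarrow> r (u + v) = r u + r v"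
       "\<And>m v. m \<in> base \<Omega> \<Longrightarrow> v \<in> free_module \<Omega> n \<Longrightarrow> r (\<lambda>i. m * v i) = act F m (r v)"
    and rs: "\<And>f. r (s f) = f"
    by auto
  define u :: "nat \<Rightarrow> nat \<Rightarrow> 'w" where "u i = (\<lambda>j. if j = i then 1 else 0)" for i
  have u: "u i \<in> free_module \<Omega> n" if "i < n" for i
    using that by (auto simp: u_def free_module_def base_zero)
  have sb: "s f i \<in> base \<Omega>" for f i
    using s(1)[of f] base_zero by (cases "i < n") (auto simp: free_module_def)
  have zero: "0 \<in> free_module \<Omega> n" by (simp add: free_module_def base_zero)
  \<comment> \<open>The retraction \<open>r\<close> is linear only on the free module, so \<open>s f\<close> is built up one coordinate at
    a time without leaving that module.\<close>
  have partial: "r (\<lambda>j. if j < k then s f j else 0) = (\<Sum>i<k. act F (s f i) (r (u i)))"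
    if "k \<le> n" for f k
    using that
  proof (induction k)
    case 0
    have "r 0 = 0" using r(1)[OF zero zero] by simp
    then show ?case by (simp add: zero_fun_def)
  next
    case (Suc k)
    have "(\<lambda>j. if j < k then s f j else 0) \<in> free_module \<Omega> n"
      "(\<lambda>j. s f k * u k j) \<in> free_module \<Omega> n"
      using Suc.prems sb base_zero by (auto simp: free_module_def u_def)
    moreover have "(\<lambda>j. if j < Suc k then s f j else 0)
        = (\<lambda>j. if j < k then s f j else 0) + (\<lambda>j. s f k * u k j)"
      by (auto simp: fun_eq_iff u_def less_Suc_eq)
    ultimately show ?case
      using Suc r(1) r(2)[OF sb u] by simp
  qed
  have full: "(\<lambda>j. if j < n then s f j else 0) = s f" for f
    using s(1)[of f] by (auto simp: free_module_def fun_eq_iff)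
  show ?thesis
  proof
    show "\<forall>i. (\<lambda>f. s f i) \<in> dual \<Omega> F"
      using sb s(2,3) by (simp add: dual_def)
    show "\<forall>f. f = (\<Sum>i<n. act F (s f i) (r (u i)))"
      using partial[of n] by (simp add: full rs)
  qed
qed

lemma dual_base: "\<phi> \<in> dual \<Omega> F \<Longrightarrow> \<phi> f \<in> base \<Omega>"
  and dual_act_left: "\<phi> \<in> dual \<Omega> F \<Longrightarrow> m \<in> base \<Omega> \<Longrightarrow> \<phi> (act F m f) = m * \<phi> f"
  by (auto simp: dual_def)

text \<open>
  A complex scalar \<open>c\<close> acts on \<open>\<F>\<close> as the element \<open>c 1\<close> of \<open>M\<close>.
\<close>

lemma clinear_dual:
  assumes "\<phi> \<in> dual \<Omega> F"
  shows "clinear \<phi>"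
proof (rule clinearI)
  show "\<phi> (x + y) = \<phi> x + \<phi> y" for x y using assms by (simp add: dual_def)
  fix c x
  have "\<phi> (c *\<^sub>C x) = \<phi> (act F (c *\<^sub>C 1) x)" by (simp add: act_scale_left)
  also have "\<dots> = c *\<^sub>C \<phi> x"
    by (simp only: dual_act_left[OF assms base_scale[OF one_base]] mult_scaleC_left mult_1)
  finally show "\<phi> (c *\<^sub>C x) = c *\<^sub>C \<phi> x" .
qed

lemma dual_subspace [simp]: "csubspace (dual \<Omega> F)"
  by (rule complex_vector.subspaceI)
    (auto simp: dual_def base_zero base_add base_scale scaleC_fun_def distrib_left mult_scaleC_right scaleC_add_right)

lemma dual_act_closed: "\<phi> \<in> dual \<Omega> F \<Longrightarrow> m \<in> base \<Omega> \<Longrightarrow> dual_act \<phi> m \<in> dual \<Omega> F"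
  by (auto simp: dual_def dual_act_def base_closed distrib_right mult.assoc)

lemma dual_expansion:
  assumes basis: "\<forall>f. f = (\<Sum>i<n. act F (\<phi> i f) (e i))" and \<phi>: "\<And>i. \<phi> i \<in> dual \<Omega> F"
    and \<psi>: "\<psi> \<in> dual \<Omega> F"
  shows "\<psi> = (\<Sum>i<n. dual_act (\<phi> i) (\<psi> (e i)))"
proof
  fix f
  have "\<psi> f = \<psi> (\<Sum>i<n. act F (\<phi> i f) (e i))" using basis by simp
  also have "\<dots> = (\<Sum>i<n. \<psi> (act F (\<phi> i f) (e i)))"
    using clinear_dual[OF \<psi>] by (simp add: complex_vector.linear_sum)
  finally show "\<psi> f = (\<Sum>i<n. dual_act (\<phi> i) (\<psi> (e i))) f"
    by (simp add: dual_act_left[OF \<psi>] dual_base[OF \<phi>] dual_act_def sum_fun_apply)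
qed

lemma clinear_dual_act: "clinear (dual_act \<phi>)" "clinear (\<lambda>\<phi>. dual_act \<phi> m)"
  by (auto intro!: clinearI simp: dual_act_def fun_eq_iff distrib_left distrib_right scaleC_fun_def
      mult_scaleC_left mult_scaleC_right)

lemmas [lin] = clinear_comp[OF clinear_dual_act(1)]

subsection \<open>The module of forms with values in the bundle\<close>

lemma clinear_ftensor_left: "clinear (\<lambda>\<omega>. ftensor \<Omega> F \<omega> f)"
  and clinear_ftensor_right: "clinear (\<lambda>f. ftensor \<Omega> F \<omega> f)"
  unfolding ftensor_def tensor_over_def
  by (intro clinear_quot_proj; simp add: lin balancing_relations_def complex_vector.subspace_span)+

lemmas [lin] = clinear_comp[OF clinear_ftensor_left] clinear_comp[OF clinear_ftensor_right]
  antilinear_comp[OF clinear_ftensor_left] antilinear_comp[OF clinear_ftensor_right]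
lemmas ftensor_linear = clinearD[OF clinear_ftensor_left] clinearD[OF clinear_ftensor_right]

lemma ftensor_balanced: "m \<in> base \<Omega> \<Longrightarrow> ftensor \<Omega> F (\<omega> * m) f = ftensor \<Omega> F \<omega> (act F m f)"
  unfolding ftensor_def by (intro tensor_over_balanced) auto

lemma tensor_lift_ftensor:
  assumes "balanced b" "\<And>\<omega> m f. m \<in> base \<Omega> \<Longrightarrow> b (\<omega> * m) f = b \<omega> (act F m f)"
  shows "tensor_lift b (ftensor \<Omega> F \<omega> f) = b \<omega> f"
  unfolding ftensor_def
  by (rule tensor_lift_on_tensor_over) (use assms in \<open>auto simp: mult_scaleC_left\<close>)

lemma fspace_subspace [simp]: "csubspace (fspace \<Omega> F V)"
  by (simp add: fspace_def complex_vector.subspace_span)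

lemma ftensor_in_fspace: "\<omega> \<in> V \<Longrightarrow> ftensor \<Omega> F \<omega> f \<in> fspace \<Omega> F V"
  unfolding fspace_def by (intro complex_vector.span_base) blast

lemma ftensor_in [simp]: "ftensor \<Omega> F \<omega> f \<in> fspace \<Omega> F UNIV"
  by (simp add: ftensor_in_fspace)

lemma add_in [simp]: "s \<in> fspace \<Omega> F V \<Longrightarrow> t \<in> fspace \<Omega> F V \<Longrightarrow> s + t \<in> fspace \<Omega> F V"
  by (simp add: complex_vector.subspace_add)

lemma zero_in [simp]: "0 \<in> fspace \<Omega> F V"
  by (simp add: complex_vector.subspace_0)

lemma fspace_mono: "V \<subseteq> W \<Longrightarrow> fspace \<Omega> F V \<subseteq> fspace \<Omega> F W"
  unfolding fspace_def by (intro complex_vector.span_mono) blast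

lemma fspace_mono': "t \<in> fspace \<Omega> F V \<Longrightarrow> V \<subseteq> W \<Longrightarrow> t \<in> fspace \<Omega> F W"
  using fspace_mono by blast

lemma fspace_induct [consumes 1, case_names scale zero ftensor add]:
  assumes t: "t \<in> fspace \<Omega> F V" and scale: "\<And>c \<omega>. \<omega> \<in> V \<Longrightarrow> c *\<^sub>C \<omega> \<in> V" and zero: "P 0"
    and ftensor: "\<And>\<omega> f. \<omega> \<in> V \<Longrightarrow> P (ftensor \<Omega> F \<omega> f)"
    and add: "\<And>s t. s \<in> fspace \<Omega> F V \<Longrightarrow> t \<in> fspace \<Omega> F V \<Longrightarrow> P s \<Longrightarrow> P t \<Longrightarrow> P (s + t)"
  shows "P t"
proof -
  have "P t \<and> t \<in> fspace \<Omega> F V"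
    using t unfolding fspace_def
  proof (rule scale_closed_span_induct, fold fspace_def)
    fix c b assume "b \<in> {ftensor \<Omega> F \<omega> f |\<omega> f. \<omega> \<in> V}"
    then obtain \<omega> f where b: "b = ftensor \<Omega> F \<omega> f" "\<omega> \<in> V" by blast
    then have "c *\<^sub>C b = ftensor \<Omega> F (c *\<^sub>C \<omega>) f" by (simp add: ftensor_linear)
    then show "c *\<^sub>C b \<in> {ftensor \<Omega> F \<omega> f |\<omega> f. \<omega> \<in> V}" using scale b by blast
  qed (auto intro: zero ftensor add ftensor_in_fspace complex_vector.subspace_add
      complex_vector.subspace_0)
  then show ?thesis ..
qed

lemma fwedge_ftensor: "fwedge \<Omega> F \<eta> (ftensor \<Omega> F \<omega> f) = ftensor \<Omega> F (\<eta> * \<omega>) f"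
  unfolding fwedge_def
  by (rule tensor_lift_ftensor) (simp_all add: lin ftensor_balanced flip: mult.assoc)

lemma clinear_fwedge_left: "clinear (\<lambda>\<eta>. fwedge \<Omega> F \<eta> t)"
  and clinear_fwedge_right: "clinear (fwedge \<Omega> F \<eta>)"
  unfolding fwedge_def by (simp_all add: lin)

lemmas [lin] = clinear_comp[OF clinear_fwedge_left] clinear_comp[OF clinear_fwedge_right]
lemmas fwedge_linear = clinearD[OF clinear_fwedge_left] clinearD[OF clinear_fwedge_right]

lemma fwedge_in_fspace:
  assumes "t \<in> fspace \<Omega> F V" "\<And>c \<omega>. \<omega> \<in> V \<Longrightarrow> c *\<^sub>C \<omega> \<in> V" "\<And>\<omega>. \<omega> \<in> V \<Longrightarrow> \<eta> * \<omega> \<in> W"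
  shows "fwedge \<Omega> F \<eta> t \<in> fspace \<Omega> F W"
  using assms(1)
  by (induction t rule: fspace_induct)
    (auto simp: assms(2,3) fwedge_linear fwedge_ftensor
      intro: complex_vector.subspace_0 complex_vector.subspace_add ftensor_in_fspace)

lemma fwedge_mult:
  assumes "t \<in> fspace \<Omega> F UNIV"
  shows "fwedge \<Omega> F (\<omega> * \<eta>) t = fwedge \<Omega> F \<omega> (fwedge \<Omega> F \<eta> t)"
  using assms by (induction t rule: fspace_induct) (simp_all add: fwedge_linear fwedge_ftensor mult.assoc)

lemma fwedge_in [simp]: "t \<in> fspace \<Omega> F UNIV \<Longrightarrow> fwedge \<Omega> F \<omega> t \<in> fspace \<Omega> F UNIV"
  by (rule fwedge_in_fspace[of _ UNIV]) auto

lemma fwedge_one: "t \<in> fspace \<Omega> F UNIV \<Longrightarrow> fwedge \<Omega> F 1 t = t"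
  by (induction t rule: fspace_induct) (simp_all add: fwedge_linear fwedge_ftensor)

lemma tensor_lift_part_ftensor:
  "tensor_lift (\<lambda>\<omega> f. ftensor \<Omega> F (part p \<omega>) f) (ftensor \<Omega> F \<omega> f) = ftensor \<Omega> F (part p \<omega>) f"
  by (rule tensor_lift_ftensor) (simp_all add: lin part_mult_base ftensor_balanced)

lemma tensor_lift_part:
  assumes "t \<in> fspace \<Omega> F (biform \<Omega> q)"
  shows "tensor_lift (\<lambda>\<omega> f. ftensor \<Omega> F (part p \<omega>) f) t = (if p = q then t else 0)"
  using assms
proof (induction t rule: fspace_induct)
  case (ftensor \<omega> f)
  then show ?case by (simp add: tensor_lift_part_ftensor part_of ftensor_linear)
qed (simp_all add: tensor_lift_zero tensor_lift_add lin complex_vector.subspace_scale)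

text \<open>
  The Leibniz rule is exactly what makes \<^const>\<open>extension\<close> descend to the balanced tensor product.
\<close>

lemma
  assumes D: "clinear D" and D_mult: "\<And>\<omega> m. m \<in> base \<Omega> \<Longrightarrow> D (\<omega> * m) = D \<omega> * m + grade_inv \<Omega> \<omega> * D m"
    and nabla: "clinear nabla" "\<And>f. nabla f \<in> fspace \<Omega> F UNIV"
      "\<And>m f. m \<in> base \<Omega> \<Longrightarrow> nabla (act F m f) = ftensor \<Omega> F (D m) f + fwedge \<Omega> F m (nabla f)"
  shows extension_ftensor: "extension \<Omega> F D nabla (ftensor \<Omega> F \<omega> f)
      = ftensor \<Omega> F (D \<omega>) f + fwedge \<Omega> F (grade_inv \<Omega> \<omega>) (nabla f)"
    and clinear_extension: "clinear (extension \<Omega> F D nabla)"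
proof -
  note [lin] = clinear_comp[OF D] clinear_comp[OF nabla(1)]
  show "extension \<Omega> F D nabla (ftensor \<Omega> F \<omega> f)
      = ftensor \<Omega> F (D \<omega>) f + fwedge \<Omega> F (grade_inv \<Omega> \<omega>) (nabla f)"
    unfolding extension_def
    by (rule tensor_lift_ftensor)
      (simp_all add: lin D_mult nabla ftensor_linear fwedge_linear fwedge_ftensor grade_inv_mult_base
        fwedge_mult ftensor_balanced)
  show "clinear (extension \<Omega> F D nabla)"
    unfolding extension_def by (simp add: lin)
qed

subsection \<open>The coaction on forms with values in the bundle\<close>

text \<open>
  Nothing is known about \<open>act F m\<close> for forms \<open>m\<close> of positive degree, so this map is balanced only
  over \<open>M\<close>, and linearity in \<open>m\<close> has to be verified by hand.
\<close>

lemma balanced_on_tensor_mult_act: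
  "balanced_on UNIV (base \<Omega>) (\<lambda>(a :: 'a) m. tensor_lift (\<lambda>b f. (a * b) \<otimes>\<^sub>C act F m f) t)"
proof -
  have [lin]: "clinear (\<lambda>x. act F m (k x))" if "m \<in> base \<Omega>" "clinear k" for m k
    using clinear_comp[OF clinear_act that(2)] that(1) by simp
  let ?b = "\<lambda>a m. tensor_lift (\<lambda>b f. (a * b) \<otimes>\<^sub>C act F m f) t :: 'a \<otimes>\<^sub>C 'f"
  have "?b (a + a') m = ?b a m + ?b a' m" if "m \<in> base \<Omega>" for a a' m
    using that by (intro clinearD(1)[where f = "\<lambda>a. ?b a m"]) (simp add: lin)
  moreover have "?b a (m + m') = ?b a m + ?b a m'" if "m \<in> base \<Omega>" "m' \<in> base \<Omega>" for a m m'
    using that by (induction t rule: tensor_induct)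
      (simp_all add: lin tensor_lift_tensor tensor_lift_add act_add_left tensor_add_right base_add
        del: form_subspace)
  moreover have "?b (c *\<^sub>C a) m = ?b a (c *\<^sub>C m)" if "m \<in> base \<Omega>" for c a m
    using that by (induction t rule: tensor_induct)
      (simp_all add: lin tensor_lift_tensor tensor_lift_add act_scale_left tensor_scaleC_left
        tensor_scaleC_right base_scale mult_scaleC_left)
  ultimately show ?thesis unfolding balanced_on_def by blast
qed

lemma tensor_mult_act_tensor:
  assumes "m \<in> base \<Omega>"
  shows "tensor_mult_on (base \<Omega>) (act F) ((a :: 'a) \<otimes>\<^sub>C m) t = tensor_lift (\<lambda>b f. (a * b) \<otimes>\<^sub>C act F m f) t"
  unfolding tensor_mult_on_def
  using tensor_lift_on_tensor[OF csubspace_UNIV form_subspace balanced_on_tensor_mult_act UNIV_I assms] .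

lemma tensor_mult_act_add:
  assumes "(s :: 'a \<otimes>\<^sub>C 'w) \<in> tensor_space UNIV (base \<Omega>)" "s' \<in> tensor_space UNIV (base \<Omega>)"
  shows "tensor_mult_on (base \<Omega>) (act F) (s + s') t
    = tensor_mult_on (base \<Omega>) (act F) s t + tensor_mult_on (base \<Omega>) (act F) s' t"
  unfolding tensor_mult_on_def
  using tensor_lift_on_add[OF csubspace_UNIV form_subspace balanced_on_tensor_mult_act assms] .

text \<open>
  With the coactions of \<open>\<omega>\<close>, \<open>m\<close> and \<open>f\<close> in place of \<open>x\<close>, \<open>y\<close> and \<open>z\<close> this says that the diagonal
  coaction takes equal values on \<open>\<omega> m \<otimes> f\<close> and \<open>\<omega> \<otimes> m f\<close>.
\<close>

lemma tensor_mult_ftensor_assoc: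
  assumes "(y :: 'a \<otimes>\<^sub>C 'w) \<in> tensor_space UNIV (base \<Omega>)"
  shows "tensor_mult (ftensor \<Omega> F) (tensor_mult (*) x y) z
    = tensor_mult (ftensor \<Omega> F) x (tensor_mult_on (base \<Omega>) (act F) y z)"
  using csubspace_UNIV form_subspace assms
proof (induction y rule: tensor_space_induct)
  case (tensor b m)
  have [lin]: "clinear (\<lambda>x. act F m (k x))" if "clinear k" for k
    using clinear_comp[OF clinear_act that] tensor by simp
  show ?case
  proof (induction x rule: tensor_induct)
    case (tensor a \<omega>)
    show ?case
      using \<open>m \<in> base \<Omega>\<close>
      by (induction z rule: tensor_induct)
        (simp_all add: tensor_mult_act_tensor tensor_mult_tensor tensor_mult_add tensor_lift_add tensor_lift_tensor lin
          ftensor_balanced mult.assoc)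
  qed (simp add: tensor_mult_add lin)
qed (simp add: tensor_mult_add lin tensor_mult_act_add)

lemma ftensor_coact_ftensor:
  "ftensor_coact \<Omega> F (ftensor \<Omega> F \<omega> f) = tensor_mult (ftensor \<Omega> F) (fcoact \<Omega> \<omega>) (vcoact F f)"
  unfolding ftensor_coact_def
  by (rule tensor_lift_ftensor)
    (simp_all add: lin fcoact_mult vcoact_act tensor_mult_ftensor_assoc fcoact_form)

lemma clinear_ftensor_coact: "clinear (ftensor_coact \<Omega> F)"
  unfolding ftensor_coact_def by (simp add: lin)

lemmas [lin] = clinear_comp[OF clinear_ftensor_coact]
lemmas ftensor_coact_linear = clinearD[OF clinear_ftensor_coact]

lemma ftensor_coact_section:
  "ftensor_coact \<Omega> F (ftensor \<Omega> F 1 f) = tensor_map id (ftensor \<Omega> F 1) (vcoact F f)"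
proof -
  have "tensor_mult (ftensor \<Omega> F) (1 \<otimes>\<^sub>C 1) t = tensor_map id (ftensor \<Omega> F 1) t" for t :: "'a \<otimes>\<^sub>C 'f"
    by (induction t rule: tensor_induct)
      (simp_all add: tensor_mult_tensor tensor_mult_add tensor_map_tensor tensor_map_add lin)
  then show ?thesis by (simp only: ftensor_coact_ftensor fcoact_one)
qed

lemma ftensor_coact_in:
  assumes "t \<in> fspace \<Omega> F UNIV"
  shows "ftensor_coact \<Omega> F t \<in> tensor_space UNIV (fspace \<Omega> F UNIV)"
proof -
  have "tensor_mult (ftensor \<Omega> F) x y \<in> tensor_space UNIV (fspace \<Omega> F UNIV)" for x y
  proof (induction x rule: tensor_induct)
    case (tensor a \<omega>)
    show ?case
      by (induction y rule: tensor_induct)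
        (auto simp: tensor_mult_tensor tensor_mult_add lin
          intro: complex_vector.subspace_add tensor_in_tensor_space ftensor_in_fspace)
  qed (auto simp: tensor_mult_add lin intro: complex_vector.subspace_add)
  with assms show ?thesis
    by (induction t rule: fspace_induct)
      (auto simp: ftensor_coact_ftensor ftensor_coact_linear
        intro: complex_vector.subspace_add complex_vector.subspace_0)
qed

subsection \<open>Forms with values in the dual\<close>

lemma clinear_dtensor_left: "clinear (\<lambda>\<phi>. dtensor \<Omega> F \<phi> \<omega>)"
  and clinear_dtensor_right: "clinear (dtensor \<Omega> F \<phi>)"
  unfolding dtensor_def tensor_over_def
  by (intro clinear_quot_proj; simp add: lin balancing_relations_def complex_vector.subspace_span)+

lemmas [lin] = clinear_comp[OF clinear_dtensor_left] clinear_comp[OF clinear_dtensor_right]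
  antilinear_comp[OF clinear_dtensor_left] antilinear_comp[OF clinear_dtensor_right]
lemmas dtensor_linear = clinearD[OF clinear_dtensor_left] clinearD[OF clinear_dtensor_right]

lemma dtensor_balanced:
  "\<phi> \<in> dual \<Omega> F \<Longrightarrow> m \<in> base \<Omega> \<Longrightarrow> dtensor \<Omega> F (dual_act \<phi> m) \<omega> = dtensor \<Omega> F \<phi> (m * \<omega>)"
  unfolding dtensor_def by (intro tensor_over_balanced) auto

lemma dual_lift_dtensor:
  assumes "balanced_on (dual \<Omega> F) UNIV b"
    and "\<And>\<phi> m \<omega>. \<phi> \<in> dual \<Omega> F \<Longrightarrow> m \<in> base \<Omega> \<Longrightarrow> b (dual_act \<phi> m) \<omega> = b \<phi> (m * \<omega>)"
    and "\<phi> \<in> dual \<Omega> F"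
  shows "tensor_lift_on (dual \<Omega> F) UNIV b (dtensor \<Omega> F \<phi> \<omega>) = b \<phi> \<omega>"
  unfolding dtensor_def
  by (rule tensor_lift_on_tensor_over(2))
    (use assms dual_act_closed in \<open>auto simp: clinearD[OF clinear_dual_act(2)]\<close>)

lemma dtensor_in_tensor_space: "\<phi> \<in> dual \<Omega> F \<Longrightarrow> dtensor \<Omega> F \<phi> \<omega> \<in> tensor_space (dual \<Omega> F) UNIV"
  unfolding dtensor_def
  by (rule tensor_lift_on_tensor_over(1)[where b = "\<lambda>\<phi> \<omega>. 0 :: 'w"])
    (use dual_act_closed in \<open>auto simp: clinearD[OF clinear_dual_act(2)] balanced_on_def\<close>)

lemma dspace_subspace [simp]: "csubspace (dspace \<Omega> F V)"
  by (simp add: dspace_def complex_vector.subspace_span)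

lemma dtensor_in_dspace: "\<phi> \<in> dual \<Omega> F \<Longrightarrow> \<omega> \<in> V \<Longrightarrow> dtensor \<Omega> F \<phi> \<omega> \<in> dspace \<Omega> F V"
  unfolding dspace_def by (intro complex_vector.span_base) blast

lemma dspace_mono: "V \<subseteq> W \<Longrightarrow> dspace \<Omega> F V \<subseteq> dspace \<Omega> F W"
  unfolding dspace_def by (intro complex_vector.span_mono) blast

lemma dspace_in_tensor_space: "t \<in> dspace \<Omega> F V \<Longrightarrow> t \<in> tensor_space (dual \<Omega> F) UNIV"
  unfolding dspace_def
  using complex_vector.span_minimal[of "{dtensor \<Omega> F \<phi> \<omega> |\<phi> \<omega>. \<phi> \<in> dual \<Omega> F \<and> \<omega> \<in> V}"
      "tensor_space (dual \<Omega> F) UNIV"] dtensor_in_tensor_space tensor_space_subspace by blast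

lemma dspace_induct [consumes 1, case_names scale zero dtensor add]:
  assumes t: "t \<in> dspace \<Omega> F V" and scale: "\<And>c \<omega>. \<omega> \<in> V \<Longrightarrow> c *\<^sub>C \<omega> \<in> V" and zero: "P 0"
    and dtensor: "\<And>\<phi> \<omega>. \<phi> \<in> dual \<Omega> F \<Longrightarrow> \<omega> \<in> V \<Longrightarrow> P (dtensor \<Omega> F \<phi> \<omega>)"
    and add: "\<And>s t. s \<in> dspace \<Omega> F V \<Longrightarrow> t \<in> dspace \<Omega> F V \<Longrightarrow> P s \<Longrightarrow> P t \<Longrightarrow> P (s + t)"
  shows "P t"
proof -
  have "P t \<and> t \<in> dspace \<Omega> F V"
    using t unfolding dspace_def
  proof (rule scale_closed_span_induct, fold dspace_def)
    fix c b assume "b \<in> {dtensor \<Omega> F \<phi> \<omega> |\<phi> \<omega>. \<phi> \<in> dual \<Omega> F \<and> \<omega> \<in> V}"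
    then obtain \<phi> \<omega> where b: "b = dtensor \<Omega> F \<phi> \<omega>" "\<phi> \<in> dual \<Omega> F" "\<omega> \<in> V" by blast
    then have "c *\<^sub>C b = dtensor \<Omega> F \<phi> (c *\<^sub>C \<omega>)" by (simp add: dtensor_linear)
    then show "c *\<^sub>C b \<in> {dtensor \<Omega> F \<phi> \<omega> |\<phi> \<omega>. \<phi> \<in> dual \<Omega> F \<and> \<omega> \<in> V}" using scale b by blast
  qed (auto intro: zero dtensor add dtensor_in_dspace complex_vector.subspace_add
      complex_vector.subspace_0)
  then show ?thesis ..
qed

lemma eval_dtensor:
  assumes "\<phi> \<in> dual \<Omega> F"
  shows "tensor_lift (\<lambda>\<phi> \<nu>. \<omega> * \<phi> f * \<nu>) (dtensor \<Omega> F \<phi> \<nu>) = \<omega> * \<phi> f * \<nu>"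
proof -
  have bal: "balanced (\<lambda>\<phi> \<nu>. \<omega> * \<phi> f * (\<nu> :: 'w))" by (simp add: lin)
  have "tensor_lift_on (dual \<Omega> F) UNIV (\<lambda>\<phi> \<nu>. \<omega> * \<phi> f * \<nu>) (dtensor \<Omega> F \<phi> \<nu>) = \<omega> * \<phi> f * \<nu>"
    by (rule dual_lift_dtensor) (use bal assms in \<open>auto simp: balanced_on_def dual_act_def mult.assoc\<close>)
  then show ?thesis
    using tensor_lift_on_eq_tensor_lift[OF dual_subspace csubspace_UNIV bal dtensor_in_tensor_space[OF assms]]
    by simp
qed

text \<open>
  The outer lift in \<^const>\<open>ev_wedge\<close> has the integrand \<open>\<phi> f\<close> as a function of \<open>f\<close>, which is linear
  for \<open>\<phi>\<close> in the dual but not for arbitrary functions; hence the condition on \<open>t\<close>.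
\<close>

lemma
  assumes t: "t \<in> dspace \<Omega> F UNIV"
  shows ev_wedge_ftensor: "ev_wedge (ftensor \<Omega> F \<omega> f) t = tensor_lift (\<lambda>\<phi> \<nu>. \<omega> * \<phi> f * \<nu>) t"
    and ev_wedge_add_left: "ev_wedge (s + s') t = ev_wedge s t + ev_wedge s' t"
proof -
  have [lin]: "balanced (\<lambda>\<phi> \<nu>. \<omega> * \<phi> f * (\<nu> :: 'w))" for \<omega> f by (simp add: lin)
  have bal: "balanced (\<lambda>\<omega> f. tensor_lift (\<lambda>\<phi> \<nu>. \<omega> * \<phi> f * \<nu>) t)"
    using t
  proof (induction t rule: dspace_induct)
    case (dtensor \<phi> \<nu>)
    note clinear_comp[OF clinear_dual[OF dtensor(1)], lin]
    show ?case unfolding eval_dtensor[OF dtensor(1)] by (simp add: lin)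
  qed (simp_all add: tensor_lift_zero tensor_lift_add lin balanced_add)
  have bal_base: "tensor_lift (\<lambda>\<phi> \<nu>. \<omega> * m * \<phi> f * \<nu>) t = tensor_lift (\<lambda>\<phi> \<nu>. \<omega> * \<phi> (act F m f) * \<nu>) t"
    if "m \<in> base \<Omega>" for \<omega> m f
    using t
  proof (induction t rule: dspace_induct)
    case (dtensor \<phi> \<nu>)
    show ?case
      unfolding eval_dtensor[OF dtensor(1)] dual_act_left[OF dtensor(1) that] by (simp only: mult.assoc)
  qed (simp_all add: tensor_lift_zero tensor_lift_add lin)
  show "ev_wedge (ftensor \<Omega> F \<omega> f) t = tensor_lift (\<lambda>\<phi> \<nu>. \<omega> * \<phi> f * \<nu>) t"
    unfolding ev_wedge_def by (rule tensor_lift_ftensor[OF bal bal_base])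
  show "ev_wedge (s + s') t = ev_wedge s t + ev_wedge s' t"
    unfolding ev_wedge_def by (rule tensor_lift_add[OF bal])
qed

lemma ev_wedge_ftensor_dtensor:
  "\<phi> \<in> dual \<Omega> F \<Longrightarrow> ev_wedge (ftensor \<Omega> F \<omega> f) (dtensor \<Omega> F \<phi> \<nu>) = \<omega> * \<phi> f * \<nu>"
  by (simp add: ev_wedge_ftensor dtensor_in_dspace eval_dtensor)

lemma ev_wedge_add_right:
  "s \<in> dspace \<Omega> F UNIV \<Longrightarrow> t \<in> dspace \<Omega> F UNIV \<Longrightarrow>
    ev_wedge (ftensor \<Omega> F \<omega> f) (s + t) = ev_wedge (ftensor \<Omega> F \<omega> f) s + ev_wedge (ftensor \<Omega> F \<omega> f) t"
  by (simp add: ev_wedge_ftensor complex_vector.subspace_add tensor_lift_add lin)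

text \<open>
  The evaluations of \<open>s\<close> at the elements \<open>e i\<close> of a dual basis are its coefficients in
  \<open>\<Sum> \<phi> i \<otimes> \<omega> i\<close>.
\<close>

lemma dspace_eqI:
  assumes s: "s \<in> dspace \<Omega> F UNIV" and t: "t \<in> dspace \<Omega> F UNIV"
    and eq: "\<And>f. ev_wedge (ftensor \<Omega> F 1 f) s = ev_wedge (ftensor \<Omega> F 1 f) t"
  shows "s = t"
proof -
  obtain n :: nat and e \<phi> where "\<forall>i. \<phi> i \<in> dual \<Omega> F" and basis: "\<forall>f. f = (\<Sum>i<n. act F (\<phi> i f) (e i))"
    by (rule dual_basis)
  then have \<phi>: "\<And>i. \<phi> i \<in> dual \<Omega> F" by blast
  have "u = (\<Sum>i<n. dtensor \<Omega> F (\<phi> i) (ev_wedge (ftensor \<Omega> F 1 (e i)) u))"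
    if "u \<in> dspace \<Omega> F UNIV" for u
    using that
  proof (induction u rule: dspace_induct)
    case zero
    show ?case
      using complex_vector.subspace_0[OF dspace_subspace]
      by (simp add: ev_wedge_ftensor tensor_lift_zero lin dtensor_linear)
  next
    case (dtensor \<psi> \<omega>)
    have "\<psi> = (\<Sum>i<n. dual_act (\<phi> i) (\<psi> (e i)))"
      by (rule dual_expansion[OF basis \<phi> dtensor(1)])
    then have "dtensor \<Omega> F \<psi> \<omega> = dtensor \<Omega> F (\<Sum>i<n. dual_act (\<phi> i) (\<psi> (e i))) \<omega>"
      by (rule arg_cong)
    also have "\<dots> = (\<Sum>i<n. dtensor \<Omega> F (dual_act (\<phi> i) (\<psi> (e i))) \<omega>)"
      using complex_vector.linear_sum[OF clinear_dtensor_left] by simp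
    also have "\<dots> = (\<Sum>i<n. dtensor \<Omega> F (\<phi> i) (ev_wedge (ftensor \<Omega> F 1 (e i)) (dtensor \<Omega> F \<psi> \<omega>)))"
      by (simp add: ev_wedge_ftensor_dtensor dtensor dtensor_balanced \<phi> dual_base)
    finally show ?case .
  next
    case (add s t)
    then show ?case by (simp add: ev_wedge_add_right dtensor_linear sum.distrib)
  qed simp
  from this[OF s] this[OF t] show ?thesis by (simp add: eq)
qed

lemma dwedge_dtensor:
  "\<phi> \<in> dual \<Omega> F \<Longrightarrow> dwedge \<Omega> F (dtensor \<Omega> F \<phi> \<omega>) \<eta> = dtensor \<Omega> F \<phi> (\<omega> * \<eta>)"
  unfolding dwedge_def
  by (rule dual_lift_dtensor) (simp_all add: lin dtensor_balanced mult.assoc)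

lemma dwedge_add:
  "s \<in> dspace \<Omega> F UNIV \<Longrightarrow> t \<in> dspace \<Omega> F UNIV \<Longrightarrow>
    dwedge \<Omega> F (s + t) \<eta> = dwedge \<Omega> F s \<eta> + dwedge \<Omega> F t \<eta>"
  unfolding dwedge_def
  by (rule tensor_lift_on_add) (auto simp: lin intro: dspace_in_tensor_space)

lemma dwedge_zero: "dwedge \<Omega> F 0 \<eta> = 0"
  using dwedge_add[of 0 0 \<eta>] complex_vector.subspace_0[OF dspace_subspace] by simp

end

section \<open>Hermitian structures\<close>

locale hermitian_bundle = covariant_bundle H \<Omega> F
  for H :: "('a::complex_algebra) hopf" and \<Omega> :: "('a, 'w::complex_algebra) complex_calculus"
    and F :: "('a, 'w, 'f::complex_vector) vbundle" +
  fixes h :: "'f \<Rightarrow> 'f \<Rightarrow> 'w"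
  assumes hermitian: "hermitian_structure H \<Omega> F h"
begin

lemma antilinear_h: "antilinear h"
  and bij_h: "bij_betw h UNIV (dual \<Omega> F)"
  and h_act_fstar: "m \<in> base \<Omega> \<Longrightarrow> h (act F (fstar \<Omega> m) f) = dual_act (h f) m"
  and dual_coact_h: "dual_coact H \<Omega> F (h f) = tensor_lift (\<lambda>a g. hstar H a \<otimes>\<^sub>C h g) (vcoact F f)"
  using hermitian by (auto simp: hermitian_structure_def)

lemma h_fstar: "fstar \<Omega> (h g f) = h f g"
  using hermitian unfolding hermitian_structure_def by metis

lemma h_dual [simp]: "h f \<in> dual \<Omega> F"
  using bij_h by (auto simp: bij_betw_def)

lemma h_inj: "h f = h g \<Longrightarrow> f = g"
  using bij_h by (auto simp: bij_betw_def inj_on_def)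

lemma h_surj: "\<phi> \<in> dual \<Omega> F \<Longrightarrow> \<exists>f. \<phi> = h f"
  using bij_h by (auto simp: bij_betw_def)

lemma h_base [simp]: "h g f \<in> base \<Omega>"
  by (simp add: dual_base)

lemma clinear_h: "clinear (h g)"
  by (simp add: clinear_dual)

lemma antilinear_h_left: "antilinear (\<lambda>g. h g f)"
  using antilinearD[OF antilinear_h] by (intro antilinearI) (simp_all add: scaleC_fun_def)

lemmas [lin] = clinear_comp[OF clinear_h] antilinear_comp[OF clinear_h]
  antilinear_comp'[OF antilinear_h] antilinear_comp'[OF antilinear_h_left]

lemma h_act_right: "m \<in> base \<Omega> \<Longrightarrow> h g (act F m f) = m * h g f"
  by (simp add: dual_act_left)

lemma h_act_left: "m \<in> base \<Omega> \<Longrightarrow> h (act F m g) f = h g f * fstar \<Omega> m"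
  using h_act_fstar[OF fstar_form, of m g] by (simp add: dual_act_def)

lemma clinear_herm: "clinear (\<lambda>s. herm \<Omega> h s t)" and antilinear_herm: "antilinear (herm \<Omega> h s)"
  unfolding herm_def by (simp_all add: lin)

lemmas [lin] = clinear_comp[OF clinear_herm] antilinear_comp[OF clinear_herm]
  antilinear_comp'[OF antilinear_herm]
lemmas herm_linear = clinearD[OF clinear_herm] antilinearD[OF antilinear_herm]

lemma herm_ftensor: "herm \<Omega> h (ftensor \<Omega> F \<omega> f) (ftensor \<Omega> F \<nu> g) = \<omega> * h g f * fstar \<Omega> \<nu>"
proof -
  have inner: "tensor_lift (\<lambda>\<nu> g. \<omega> * h g f * fstar \<Omega> \<nu>) (ftensor \<Omega> F \<nu> g) = \<omega> * h g f * fstar \<Omega> \<nu>"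
    for \<omega> \<nu> f g
    by (rule tensor_lift_ftensor) (simp_all add: lin h_act_left fstar_mult_base mult.assoc)
  have "herm \<Omega> h (ftensor \<Omega> F \<omega> f) (ftensor \<Omega> F \<nu> g)
      = tensor_lift (\<lambda>\<nu> g. \<omega> * h g f * fstar \<Omega> \<nu>) (ftensor \<Omega> F \<nu> g)"
    unfolding herm_def
    by (rule tensor_lift_ftensor) (simp_all add: lin h_act_right mult.assoc)
  then show ?thesis by (simp only: inner)
qed

lemma herm_fwedge_left:
  assumes "s \<in> fspace \<Omega> F UNIV" "t \<in> fspace \<Omega> F UNIV"
  shows "herm \<Omega> h (fwedge \<Omega> F \<omega> s) t = \<omega> * herm \<Omega> h s t"
  using assms(1)
proof (induction s rule: fspace_induct)
  case (ftensor \<eta> f)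
  show ?case
    using assms(2)
    by (induction t rule: fspace_induct)
      (simp_all add: fwedge_ftensor herm_ftensor herm_linear distrib_left mult.assoc)
qed (simp_all add: fwedge_linear herm_linear distrib_left)

lemma herm_ftensor_right:
  assumes "s \<in> fspace \<Omega> F UNIV"
  shows "herm \<Omega> h s (ftensor \<Omega> F \<nu> g) = herm \<Omega> h s (ftensor \<Omega> F 1 g) * fstar \<Omega> \<nu>"
  using assms by (induction s rule: fspace_induct) (simp_all add: herm_ftensor herm_linear distrib_right)

text \<open>
  The involution reverses the product of \<open>\<nu>\<close> with the degree one coefficients of \<open>t\<close>, which
  explains the sign.
\<close>

lemma herm_fwedge_right:
  assumes s: "s \<in> fspace \<Omega> F UNIV" and t: "t \<in> fspace \<Omega> F (form \<Omega> 1)"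
  shows "herm \<Omega> h s (fwedge \<Omega> F \<nu> t) = herm \<Omega> h s t * fstar \<Omega> (grade_inv \<Omega> \<nu>)"
  using t
proof (induction t rule: fspace_induct)
  case (ftensor \<eta> g)
  then show ?case
    by (simp add: fwedge_ftensor herm_ftensor_right[OF s, of "\<nu> * \<eta>"] herm_ftensor_right[OF s, of \<eta>]
        fstar_mult_grade mult.assoc)
qed (simp_all add: herm_linear fwedge_linear distrib_right complex_vector.subspace_scale)

lemma herm_fwedge_base_right:
  assumes s: "s \<in> fspace \<Omega> F UNIV" and t: "t \<in> fspace \<Omega> F UNIV" and m: "m \<in> base \<Omega>"
  shows "herm \<Omega> h s (fwedge \<Omega> F m t) = herm \<Omega> h s t * fstar \<Omega> m"
  using t
proof (induction t rule: fspace_induct)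
  case (ftensor \<eta> g)
  then show ?case
    by (simp add: fwedge_ftensor herm_ftensor_right[OF s, of "m * \<eta>"] herm_ftensor_right[OF s, of \<eta>]
        fstar_mult_base m mult.assoc)
qed (simp_all add: herm_linear fwedge_linear distrib_right complex_vector.subspace_scale)

text \<open>
  There is no sign because one of the two arguments has degree zero.
\<close>

lemma herm_section_fstar:
  assumes "t \<in> fspace \<Omega> F UNIV"
  shows "herm \<Omega> h (ftensor \<Omega> F 1 f) t = fstar \<Omega> (herm \<Omega> h t (ftensor \<Omega> F 1 f))"
  using assms
  by (induction t rule: fspace_induct)
    (simp_all add: herm_ftensor herm_linear fstar_antilinear fstar_mult_base h_fstar)

lemma part_herm_left:
  assumes "s \<in> fspace \<Omega> F UNIV"
  shows "part p (herm \<Omega> h s (ftensor \<Omega> F 1 g))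
    = herm \<Omega> h (tensor_lift (\<lambda>\<omega> f. ftensor \<Omega> F (part p \<omega>) f) s) (ftensor \<Omega> F 1 g)"
  using assms
proof (induction s rule: fspace_induct)
  case (ftensor \<omega> f)
  show ?case by (simp add: tensor_lift_part_ftensor herm_ftensor part_mult_base)
qed (simp_all add: herm_linear part_linear tensor_lift_add tensor_lift_zero lin)

subsection \<open>Nondegeneracy\<close>

text \<open>
  A dual basis whose functionals are written as \<open>h (g i)\<close>. The roles of \<open>e\<close> and \<open>g\<close> may be
  exchanged: both sides of the second equation have the same image under \<open>h\<close>, by the first
  equation and the symmetry of \<open>h\<close>.
\<close>

lemma hermitian_basis:
  obtains n :: nat and e g :: "nat \<Rightarrow> 'f"
  where "\<forall>f. f = (\<Sum>i<n. act F (h (g i) f) (e i))" "\<forall>f. f = (\<Sum>i<n. act F (h (e i) f) (g i))"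
proof -
  obtain n :: nat and e \<phi> where "\<forall>i. \<phi> i \<in> dual \<Omega> F" and basis: "\<forall>f. f = (\<Sum>i<n. act F (\<phi> i f) (e i))"
    by (rule dual_basis)
  then have "\<forall>i. \<exists>f. \<phi> i = h f" using h_surj by blast
  from choice[OF this] obtain g where "\<forall>i. \<phi> i = h (g i)" by blast
  then have e: "f = (\<Sum>i<n. act F (h (g i) f) (e i))" for f using basis by simp
  have "h k = h (\<Sum>i<n. act F (h (e i) k) (g i))" for k
  proof
    fix f
    have "h k f = (\<Sum>i<n. h k (act F (h (g i) f) (e i)))"
      using arg_cong[OF e[of f], of "h k"] by (simp only: complex_vector.linear_sum[OF clinear_h])
    also have "\<dots> = fstar \<Omega> (\<Sum>i<n. h f (act F (h (e i) k) (g i)))"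
      by (simp add: h_act_right antilinear_sum[OF antilinear_fstar] fstar_mult_base h_fstar)
    also have "\<dots> = h (\<Sum>i<n. act F (h (e i) k) (g i)) f"
      by (simp only: h_fstar flip: complex_vector.linear_sum[OF clinear_h])
    finally show "h k f = h (\<Sum>i<n. act F (h (e i) k) (g i)) f" .
  qed
  then have "k = (\<Sum>i<n. act F (h (e i) k) (g i))" for k by (rule h_inj)
  then show ?thesis using that e by blast
qed

lemma fspace_reconstruct:
  assumes basis: "\<forall>f. f = (\<Sum>i<n. act F (h (g i) f) (e i))" and s: "s \<in> fspace \<Omega> F UNIV"
  shows "s = (\<Sum>i<n. ftensor \<Omega> F (herm \<Omega> h s (ftensor \<Omega> F 1 (g i))) (e i))"
  using s
proof (induction s rule: fspace_induct)
  case (ftensor \<omega> f)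
  have "ftensor \<Omega> F \<omega> f = ftensor \<Omega> F \<omega> (\<Sum>i<n. act F (h (g i) f) (e i))"
    using basis by simp
  also have "\<dots> = (\<Sum>i<n. ftensor \<Omega> F \<omega> (act F (h (g i) f) (e i)))"
    by (rule complex_vector.linear_sum[OF clinear_ftensor_right])
  also have "\<dots> = (\<Sum>i<n. ftensor \<Omega> F (herm \<Omega> h (ftensor \<Omega> F \<omega> f) (ftensor \<Omega> F 1 (g i))) (e i))"
    by (simp add: herm_ftensor ftensor_balanced)
  finally show ?case .
qed (simp_all add: herm_linear ftensor_linear sum.distrib)

lemma herm_eqI:
  assumes s: "s \<in> fspace \<Omega> F UNIV" and t: "t \<in> fspace \<Omega> F UNIV"
    and eq: "\<And>g. herm \<Omega> h s (ftensor \<Omega> F 1 g) = herm \<Omega> h t (ftensor \<Omega> F 1 g)"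
  shows "s = t"
proof -
  obtain n :: nat and e g where basis: "\<forall>f. f = (\<Sum>i<n. act F (h (g i) f) (e i))"
    by (rule hermitian_basis)
  show ?thesis using fspace_reconstruct[OF basis s] fspace_reconstruct[OF basis t] eq by simp
qed

text \<open>
  The Riesz representation theorem for the pairing: a functional \<open>R\<close> that is conjugate-linear over
  \<open>M\<close> is determined by its values on the \<open>g i\<close>, and \<open>\<Sum> R (g i) \<otimes> e i\<close> has the required pairing
  with each of them.
\<close>

lemma herm_represent:
  assumes add: "\<And>f g. R (f + g) = R f + R g"
    and act: "\<And>m g. m \<in> base \<Omega> \<Longrightarrow> R (act F m g) = R g * fstar \<Omega> m"
    and V: "\<And>g. R g \<in> V"
  shows "\<exists>s\<in>fspace \<Omega> F V. \<forall>g. herm \<Omega> h s (ftensor \<Omega> F 1 g) = R g"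
proof -
  obtain n :: nat and e g where basis: "\<forall>f. f = (\<Sum>i<n. act F (h (e i) f) (g i))"
    by (rule hermitian_basis)
  let ?s = "\<Sum>i<n. ftensor \<Omega> F (R (g i)) (e i)"
  have zero: "R 0 = 0" using add[of 0 0] by simp
  have sum: "R (\<Sum>i\<in>I. k i) = (\<Sum>i\<in>I. R (k i))" for I and k :: "nat \<Rightarrow> 'f"
    by (induction I rule: infinite_finite_induct) (simp_all add: zero add)
  have "herm \<Omega> h ?s (ftensor \<Omega> F 1 f) = R f" for f
  proof -
    have "herm \<Omega> h ?s (ftensor \<Omega> F 1 f) = (\<Sum>i<n. R (g i) * h f (e i))"
      by (simp add: complex_vector.linear_sum[OF clinear_herm] herm_ftensor)
    also have "\<dots> = R (\<Sum>i<n. act F (h (e i) f) (g i))"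
      by (simp add: sum act h_fstar)
    finally show ?thesis using basis by simp
  qed
  moreover have "?s \<in> fspace \<Omega> F V"
    by (intro complex_vector.subspace_sum fspace_subspace ftensor_in_fspace V)
  ultimately show ?thesis by blast
qed

subsection \<open>The conjugation between a bundle and its dual\<close>

lemma chern_map_ftensor: "chern_map \<Omega> F h (ftensor \<Omega> F \<omega> f) = dtensor \<Omega> F (h f) (fstar \<Omega> \<omega>)"
  unfolding chern_map_def
proof (rule tensor_lift_ftensor)
  fix \<omega> m f assume m: "m \<in> base \<Omega>"
  have "h (act F m f) = dual_act (h f) (fstar \<Omega> m)" using h_act_fstar[OF fstar_form[OF m]] by simp
  then show "dtensor \<Omega> F (h f) (fstar \<Omega> (\<omega> * m)) = dtensor \<Omega> F (h (act F m f)) (fstar \<Omega> \<omega>)"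
    by (simp add: dtensor_balanced m fstar_form fstar_mult_base)
qed (simp add: lin)

lemma antilinear_chern_map: "antilinear (chern_map \<Omega> F h)"
  unfolding chern_map_def by (simp add: lin)

lemmas chern_map_antilinear = antilinearD[OF antilinear_chern_map]

lemma chern_map_in_dspace:
  assumes "t \<in> fspace \<Omega> F V" "\<And>c \<omega>. \<omega> \<in> V \<Longrightarrow> c *\<^sub>C \<omega> \<in> V" "\<And>\<omega>. \<omega> \<in> V \<Longrightarrow> fstar \<Omega> \<omega> \<in> W"
  shows "chern_map \<Omega> F h t \<in> dspace \<Omega> F W"
  using assms(1)
  by (induction t rule: fspace_induct)
    (auto simp: assms(2,3) chern_map_antilinear chern_map_ftensor
      intro: complex_vector.subspace_0 complex_vector.subspace_add dtensor_in_dspace)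

text \<open>
  This is how statements about the dual are turned into statements about the pairing.
\<close>

lemma ev_wedge_chern_map:
  assumes "t \<in> fspace \<Omega> F UNIV"
  shows "ev_wedge (ftensor \<Omega> F 1 f) (chern_map \<Omega> F h t) = herm \<Omega> h (ftensor \<Omega> F 1 f) t"
  using assms
proof (induction t rule: fspace_induct)
  case zero
  show ?case
    by (simp add: chern_map_antilinear herm_linear ev_wedge_ftensor complex_vector.subspace_0
        tensor_lift_zero lin)
next
  case (add s t)
  then show ?case
    by (simp add: chern_map_antilinear herm_linear ev_wedge_add_right chern_map_in_dspace[of _ UNIV])
qed (simp_all add: chern_map_ftensor ev_wedge_ftensor_dtensor herm_ftensor)

text \<open>
  \<open>C\<^sub>h\<close> is injective since \<open>C\<^sub>h t\<close> determines all pairings of \<open>t\<close> with sections.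
\<close>

lemma chern_map_inv_into:
  assumes "s \<in> fspace \<Omega> F UNIV"
  shows "inv_into (fspace \<Omega> F UNIV) (chern_map \<Omega> F h) (chern_map \<Omega> F h s) = s"
proof (rule inv_into_f_f[OF _ assms], rule inj_onI)
  fix s t
  assume s: "s \<in> fspace \<Omega> F UNIV" and t: "t \<in> fspace \<Omega> F UNIV"
    and eq: "chern_map \<Omega> F h s = chern_map \<Omega> F h t"
  have "fstar \<Omega> (herm \<Omega> h s (ftensor \<Omega> F 1 f)) = fstar \<Omega> (herm \<Omega> h t (ftensor \<Omega> F 1 f))" for f
    using ev_wedge_chern_map[OF s, of f] ev_wedge_chern_map[OF t, of f]
    by (simp add: eq herm_section_fstar s t)
  then show "s = t" by (intro herm_eqI s t) (metis fstar_fstar)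
qed

lemma dwedge_chern_map:
  assumes "t \<in> fspace \<Omega> F (form \<Omega> 1)"
  shows "dwedge \<Omega> F (chern_map \<Omega> F h t) (fstar \<Omega> \<omega>) = chern_map \<Omega> F h (fwedge \<Omega> F (grade_inv \<Omega> \<omega>) t)"
  using assms
proof (induction t rule: fspace_induct)
  case (ftensor \<eta> f)
  then show ?case
    by (simp add: chern_map_ftensor fwedge_ftensor dwedge_dtensor fstar_mult_grade grade_inv_grade_inv)
next
  case (add s t)
  then show ?case
    by (simp add: chern_map_antilinear fwedge_linear dwedge_add chern_map_in_dspace[OF fspace_mono'[OF _ subset_UNIV]])
qed (simp_all add: complex_vector.subspace_scale chern_map_antilinear fwedge_linear dwedge_zero)

end

section \<open>The conjugate operator\<close>

locale hermitian_holomorphic_bundle = hermitian_bundle H \<Omega> F h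
  for H :: "('a::complex_algebra) hopf" and \<Omega> :: "('a, 'w::complex_algebra) complex_calculus"
    and F :: "('a, 'w, 'f::complex_vector) vbundle" and h :: "'f \<Rightarrow> 'f \<Rightarrow> 'w" +
  fixes dbar :: "'f \<Rightarrow> 'w \<otimes>\<^sub>C 'f"
  assumes holomorphic: "holomorphic_structure \<Omega> F dbar"
begin

abbreviation sec :: "'f \<Rightarrow> 'w \<otimes>\<^sub>C 'f" where "sec \<equiv> ftensor \<Omega> F 1"

lemma sec_in [simp]: "sec f \<in> fspace \<Omega> F UNIV"
  by (simp add: ftensor_in_fspace)

lemma clinear_dbar: "clinear dbar"
  and dbar_01: "dbar f \<in> fspace \<Omega> F (biform \<Omega> (0, 1))"
  and dbar_coact: "ftensor_coact \<Omega> F (dbar f) = tensor_map id dbar (vcoact F f)"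
  and dbar_act: "m \<in> base \<Omega> \<Longrightarrow> dbar (act F m f) = ftensor \<Omega> F (delbar \<Omega> m) f + fwedge \<Omega> F m (dbar f)"
  using holomorphic by (auto simp: holomorphic_structure_def covariant_operator_def)

lemmas [lin] = clinear_comp[OF clinear_dbar] antilinear_comp[OF clinear_dbar]

lemma dbar_form: "dbar f \<in> fspace \<Omega> F (form \<Omega> 1)"
  using fspace_mono'[OF dbar_01 biform_01_form] .

lemma dbar_in [simp]: "dbar f \<in> fspace \<Omega> F UNIV"
  using fspace_mono'[OF dbar_01] by blast

lemma extension_dbar_ftensor: "extension \<Omega> F (delbar \<Omega>) dbar (ftensor \<Omega> F \<omega> f)
    = ftensor \<Omega> F (delbar \<Omega> \<omega>) f + fwedge \<Omega> F (grade_inv \<Omega> \<omega>) (dbar f)"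
  and clinear_extension_dbar: "clinear (extension \<Omega> F (delbar \<Omega>) dbar)"
  by (rule extension_ftensor clinear_extension; simp add: clinear_delbar delbar_mult clinear_dbar dbar_act)+

lemma dbar_flat: "extension \<Omega> F (delbar \<Omega>) dbar (dbar f) = 0"
proof -
  have "sec f \<in> fspace \<Omega> F (\<Union>k. biform \<Omega> (0, k))"
    using one_base unfolding base_eq by (intro ftensor_in_fspace) blast
  then have "extension \<Omega> F (delbar \<Omega>) dbar (extension \<Omega> F (delbar \<Omega>) dbar (sec f)) = 0"
    using holomorphic unfolding holomorphic_structure_def by blast
  then show ?thesis
    by (simp add: extension_dbar_ftensor delbar_one ftensor_linear grade_inv_base fwedge_one)
qed

lemma herm_sec_biform:
  assumes "t \<in> fspace \<Omega> F (biform \<Omega> (a, b))"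
  shows "herm \<Omega> h (sec f) t \<in> biform \<Omega> (b, a)"
  using assms
proof (induction t rule: fspace_induct)
  case (ftensor \<nu> g)
  then show ?case
    using biform_mult[of "h g f" 0 0 "fstar \<Omega> \<nu>" b a] fstar_biform[of \<nu> a b] h_base[of g f]
    by (simp add: herm_ftensor base_eq)
qed (simp_all add: herm_linear complex_vector.subspace_0 complex_vector.subspace_add complex_vector.subspace_scale)

text \<open>
  Any \<open>(1, 0)\<close>-part of a Hermitian connection with \<open>(0, 1)\<close>-part \<open>dbar\<close> satisfies this equation,
  the component of bidegree \<open>(1, 0)\<close> of the Hermitian condition. By \<open>herm_eqI\<close> at most one
  element satisfies it, so the choice is no choice.
\<close>

definition chern10 :: "'f \<Rightarrow> 'w \<otimes>\<^sub>C 'f" where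
  "chern10 f = (SOME s. s \<in> fspace \<Omega> F (biform \<Omega> (1, 0)) \<and>
     (\<forall>g. herm \<Omega> h s (sec g) = del \<Omega> (h g f) - herm \<Omega> h (sec f) (dbar g)))"

lemma chern10_10: "chern10 f \<in> fspace \<Omega> F (biform \<Omega> (1, 0))"
  and herm_chern10: "herm \<Omega> h (chern10 f) (sec g) = del \<Omega> (h g f) - herm \<Omega> h (sec f) (dbar g)"
proof -
  let ?R = "\<lambda>g. del \<Omega> (h g f) - herm \<Omega> h (sec f) (dbar g)"
  have "\<exists>s\<in>fspace \<Omega> F (biform \<Omega> (1, 0)). \<forall>g. herm \<Omega> h s (sec g) = ?R g"
  proof (rule herm_represent)
    show "?R (g + g') = ?R g + ?R g'" for g g'
      by (rule antilinearD(1)) (simp add: lin)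
    show "?R (act F m g) = ?R g * fstar \<Omega> m" if m: "m \<in> base \<Omega>" for m g
    proof -
      have "del \<Omega> (h (act F m g) f) = del \<Omega> (h g f) * fstar \<Omega> m + h g f * del \<Omega> (fstar \<Omega> m)"
        by (simp only: h_act_left[OF m] del_mult grade_inv_base[OF h_base])
      moreover have "herm \<Omega> h (sec f) (dbar (act F m g))
          = h g f * del \<Omega> (fstar \<Omega> m) + herm \<Omega> h (sec f) (dbar g) * fstar \<Omega> m"
        by (simp add: dbar_act[OF m] herm_linear(6) herm_ftensor herm_fwedge_base_right m fstar_delbar)
      ultimately show ?thesis by (simp add: left_diff_distrib)
    qed
    show "?R g \<in> biform \<Omega> (1, 0)" for g
      using herm_sec_biform[OF dbar_01] del_biform[of "h g f" 0 0] h_base[of g f]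
      by (simp add: base_eq complex_vector.subspace_diff)
  qed
  then have conn: "chern10 f \<in> fspace \<Omega> F (biform \<Omega> (1, 0)) \<and> (\<forall>g. herm \<Omega> h (chern10 f) (sec g) = ?R g)"
    unfolding chern10_def Bex_def by (rule someI_ex)
  from conjunct1[OF conn] show "chern10 f \<in> fspace \<Omega> F (biform \<Omega> (1, 0))" .
  from spec[OF conjunct2[OF conn], of g] show "herm \<Omega> h (chern10 f) (sec g) = ?R g" .
qed

lemma chern10_form: "chern10 f \<in> fspace \<Omega> F (form \<Omega> 1)"
  using fspace_mono'[OF chern10_10 biform_10_form] .

lemma chern10_in [simp]: "chern10 f \<in> fspace \<Omega> F UNIV"
  using fspace_mono'[OF chern10_10] by blast

lemma clinear_chern10: "clinear chern10"
proof (rule clinearI; rule herm_eqI)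
  show "herm \<Omega> h (chern10 (x + y)) (sec g) = herm \<Omega> h (chern10 x + chern10 y) (sec g)" for x y g
    by (simp add: herm_linear herm_chern10 clinearD[OF clinear_h] del_linear ftensor_linear)
  show "herm \<Omega> h (chern10 (c *\<^sub>C x)) (sec g) = herm \<Omega> h (c *\<^sub>C chern10 x) (sec g)" for c x g
    by (simp add: herm_linear herm_chern10 clinearD[OF clinear_h] del_linear ftensor_linear
        complex_vector.scale_right_diff_distrib)
qed (simp_all add: complex_vector.subspace_add complex_vector.subspace_scale)

lemmas [lin] = clinear_comp[OF clinear_chern10] antilinear_comp[OF clinear_chern10]

lemma chern10_act:
  assumes m: "m \<in> base \<Omega>"
  shows "chern10 (act F m f) = ftensor \<Omega> F (del \<Omega> m) f + fwedge \<Omega> F m (chern10 f)"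
proof (rule herm_eqI)
  fix g
  have "herm \<Omega> h (sec (act F m f)) (dbar g) = m * herm \<Omega> h (sec f) (dbar g)"
    using herm_fwedge_left[of "sec f" "dbar g" m] ftensor_balanced[OF m, of 1 f] by (simp add: fwedge_ftensor)
  then show "herm \<Omega> h (chern10 (act F m f)) (sec g)
    = herm \<Omega> h (ftensor \<Omega> F (del \<Omega> m) f + fwedge \<Omega> F m (chern10 f)) (sec g)"
    by (simp add: herm_chern10 herm_linear herm_fwedge_left herm_ftensor h_act_right m del_mult
        grade_inv_base right_diff_distrib)
qed simp_all

abbreviation chern10_ext :: "'w \<otimes>\<^sub>C 'f \<Rightarrow> 'w \<otimes>\<^sub>C 'f" where "chern10_ext \<equiv> extension \<Omega> F (del \<Omega>) chern10"

lemma chern10_ext_ftensor: "chern10_ext (ftensor \<Omega> F \<omega> f) = ftensor \<Omega> F (del \<Omega> \<omega>) f + fwedge \<Omega> F (grade_inv \<Omega> \<omega>) (chern10 f)"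
  and clinear_chern10_ext: "clinear chern10_ext"
  by (rule extension_ftensor clinear_extension; simp add: clinear_del del_mult clinear_chern10 chern10_act)+

lemmas chern10_ext_linear = clinearD[OF clinear_chern10_ext]

lemma chern10_ext_sec: "chern10_ext (sec f) = chern10 f"
  by (simp add: chern10_ext_ftensor del_one ftensor_linear grade_inv_base fwedge_one)

lemma chern10_ext_in [simp]: "t \<in> fspace \<Omega> F UNIV \<Longrightarrow> chern10_ext t \<in> fspace \<Omega> F UNIV"
  by (induction t rule: fspace_induct) (simp_all add: chern10_ext_ftensor chern10_ext_linear)

lemma chern10_ext_degree:
  assumes "t \<in> fspace \<Omega> F (biform \<Omega> (a, 0))"
  shows "chern10_ext t \<in> fspace \<Omega> F (biform \<Omega> (Suc a, 0))"
  using assms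
proof (induction t rule: fspace_induct)
  case (ftensor \<omega> f)
  have "fwedge \<Omega> F \<omega> (chern10 f) \<in> fspace \<Omega> F (biform \<Omega> (Suc a, 0))"
    by (rule fwedge_in_fspace[OF chern10_10])
      (use biform_mult[OF ftensor, of _ 1 0] in \<open>simp_all add: complex_vector.subspace_scale\<close>)
  then show ?case
    using ftensor del_biform[OF ftensor]
    by (simp add: chern10_ext_ftensor ftensor_in_fspace grade_inv_biform fwedge_linear complex_vector.subspace_scale)
qed (simp_all add: chern10_ext_linear complex_vector.subspace_scale)

lemma ev_wedge_dtensor_h:
  assumes "s \<in> fspace \<Omega> F UNIV"
  shows "ev_wedge s (dtensor \<Omega> F (h f) 1) = herm \<Omega> h s (sec f)"
proof -
  note add = ev_wedge_add_left[OF dtensor_in_dspace[OF h_dual UNIV_I]]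
  show ?thesis
    using assms
    by (induction s rule: fspace_induct)
      (use add[of 0 0] in \<open>simp_all add: ev_wedge_ftensor_dtensor herm_ftensor herm_linear add\<close>)
qed

text \<open>
  The involution carries the equation that characterises \<open>chern10 f\<close> into the equation that
  characterises the dual operator at \<open>h f\<close>; evaluations separate the elements of the dual side.
\<close>

lemma dual_delbar_h: "dual_delbar \<Omega> F dbar (h f) = chern_map \<Omega> F h (chern10 f)"
  unfolding dual_delbar_def
proof (rule the_equality, intro conjI allI)
  show in01: "chern_map \<Omega> F h (chern10 f) \<in> dspace \<Omega> F (biform \<Omega> (0, 1))"
    by (rule chern_map_in_dspace[OF chern10_10]) (simp_all add: fstar_biform complex_vector.subspace_scale)
  show ev: "ev_wedge (sec g) (chern_map \<Omega> F h (chern10 f))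
      = delbar \<Omega> (h f g) - ev_wedge (dbar g) (dtensor \<Omega> F (h f) 1)" for g
    by (simp add: ev_wedge_chern_map ev_wedge_dtensor_h herm_section_fstar[of "chern10 f"] herm_chern10
        fstar_antilinear fstar_del h_fstar herm_section_fstar[of "dbar g"])
  fix t assume t: "t \<in> dspace \<Omega> F (biform \<Omega> (0, 1)) \<and> (\<forall>g. ev_wedge (sec g) t
      = delbar \<Omega> (h f g) - ev_wedge (dbar g) (dtensor \<Omega> F (h f) 1))"
  show "t = chern_map \<Omega> F h (chern10 f)"
    by (rule dspace_eqI) (use t in01 dspace_mono[of "biform \<Omega> (0, 1)" UNIV] in \<open>auto simp: ev\<close>)
qed

text \<open>
  The main step towards \<open>\<partial>\<^sub>\<F> = C\<^sub>h\<^sup>-\<^sup>1 \<circ> \<partial>bar \<circ> C\<^sub>h\<close>. The only subtle point is that the dual extension is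
  well defined on the balanced tensor product. Since every element of the dual is of the form
  \<open>h f\<close>, its integrand is \<open>C\<^sub>h\<close> applied to values of \<open>chern10_ext\<close>, and balancedness is inherited
  from there.
\<close>

lemma dual_extension_chern_map:
  assumes "t \<in> fspace \<Omega> F UNIV"
  shows "dual_extension \<Omega> F dbar (chern_map \<Omega> F h t) = chern_map \<Omega> F h (chern10_ext t)"
proof -
  let ?b = "\<lambda>\<phi> \<omega>. dwedge \<Omega> F (dual_delbar \<Omega> F dbar \<phi>) \<omega> + dtensor \<Omega> F \<phi> (delbar \<Omega> \<omega>)"
  have b: "?b (h f) \<eta> = chern_map \<Omega> F h (chern10_ext (ftensor \<Omega> F (fstar \<Omega> \<eta>) f))" for f \<eta>
    using dwedge_chern_map[OF chern10_form, of f "fstar \<Omega> \<eta>"]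
    by (simp add: dual_delbar_h chern10_ext_ftensor chern_map_antilinear chern_map_ftensor fstar_del)
  have bal: "balanced_on (dual \<Omega> F) UNIV ?b"
    unfolding balanced_on_def
  proof (intro conjI ballI allI)
    fix \<phi> \<psi> :: "'f \<Rightarrow> 'w" and \<eta> \<eta>' c
    assume "\<phi> \<in> dual \<Omega> F"
    then obtain f where f: "\<phi> = h f" using h_surj by blast
    show "?b \<phi> (\<eta> + \<eta>') = ?b \<phi> \<eta> + ?b \<phi> \<eta>'"
      unfolding f b by (simp add: fstar_antilinear ftensor_linear chern10_ext_linear chern_map_antilinear)
    have "c *\<^sub>C h f = h (cnj c *\<^sub>C f)" by (simp add: antilinearD[OF antilinear_h])
    then show "?b (c *\<^sub>C \<phi>) \<eta> = ?b \<phi> (c *\<^sub>C \<eta>)"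
      unfolding f by (simp only: b fstar_antilinear ftensor_linear)
    assume "\<psi> \<in> dual \<Omega> F"
    then obtain g where g: "\<psi> = h g" using h_surj by blast
    have "h f + h g = h (f + g)" by (simp add: antilinearD[OF antilinear_h])
    then show "?b (\<phi> + \<psi>) \<eta> = ?b \<phi> \<eta> + ?b \<psi> \<eta>"
      unfolding f g by (simp only: b ftensor_linear chern10_ext_linear chern_map_antilinear)
  qed
  have bal_base: "?b (dual_act \<phi> m) \<eta> = ?b \<phi> (m * \<eta>)" if "\<phi> \<in> dual \<Omega> F" "m \<in> base \<Omega>" for \<phi> m \<eta>
  proof -
    obtain f where f: "\<phi> = h f" using h_surj \<open>\<phi> \<in> dual \<Omega> F\<close> by blast
    show ?thesis
      unfolding f h_act_fstar[OF that(2), symmetric] b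
      by (simp add: fstar_mult_base that(2) ftensor_balanced fstar_form)
  qed
  have chern_dspace: "chern_map \<Omega> F h t \<in> dspace \<Omega> F UNIV" if "t \<in> fspace \<Omega> F UNIV" for t
    using chern_map_in_dspace[OF that] by blast
  have dual_add: "dual_extension \<Omega> F dbar (s + t) = dual_extension \<Omega> F dbar s + dual_extension \<Omega> F dbar t"
    if "s \<in> dspace \<Omega> F UNIV" "t \<in> dspace \<Omega> F UNIV" for s t
    unfolding dual_extension_def
    using that by (intro tensor_lift_on_add bal) (auto intro: dspace_in_tensor_space)
  show ?thesis
    using assms
  proof (induction t rule: fspace_induct)
    case zero
    show ?case
      using dual_add[of 0 0] by (simp add: chern_map_antilinear chern10_ext_linear complex_vector.subspace_0)
  next
    case (ftensor \<omega> f)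
    show ?case
      using dual_lift_dtensor[OF bal bal_base h_dual, of f "fstar \<Omega> \<omega>"] b[of f "fstar \<Omega> \<omega>"]
      by (simp add: chern_map_ftensor dual_extension_def)
  next
    case (add s t)
    then show ?case by (simp add: chern_map_antilinear chern10_ext_linear dual_add chern_dspace)
  qed simp
qed

lemma conj_del_eq: "t \<in> fspace \<Omega> F UNIV \<Longrightarrow> conj_del \<Omega> F dbar h t = chern10_ext t"
  by (simp add: conj_del_def dual_extension_chern_map chern_map_inv_into)

lemma conj_del_sec: "conj_del \<Omega> F dbar h (sec f) = chern10 f"
  by (simp add: conj_del_eq chern10_ext_sec)

subsection \<open>Flatness\<close>

text \<open>
  The next two lemmas say that the extension of \<open>chern10\<close> is, up to sign and a total \<open>\<partial>\<close>, the
  adjoint of the extension of \<open>dbar\<close>; the signs are those of \<^const>\<open>grade_inv\<close>.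
\<close>

lemma herm_chern10_ext_sec:
  assumes "s \<in> fspace \<Omega> F UNIV"
  shows "herm \<Omega> h (chern10_ext s) (sec g) = del \<Omega> (herm \<Omega> h s (sec g)) + grade_inv \<Omega> (herm \<Omega> h s (dbar g))"
  using assms
proof (induction s rule: fspace_induct)
  case (ftensor \<omega> f)
  have "herm \<Omega> h (sec f) (dbar g) \<in> form \<Omega> 1"
    using herm_sec_biform[OF dbar_01, of f] biform_10_form by blast
  moreover have "herm \<Omega> h (ftensor \<Omega> F \<omega> f) (dbar g) = \<omega> * herm \<Omega> h (sec f) (dbar g)"
    using herm_fwedge_left[of "sec f" "dbar g" \<omega>] by (simp add: fwedge_ftensor)
  ultimately show ?case
    by (simp add: chern10_ext_ftensor herm_linear herm_fwedge_left herm_chern10 herm_ftensor del_mult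
        grade_inv_mult grade_inv_form_1 right_diff_distrib)
qed (simp_all add: chern10_ext_linear herm_linear del_linear grade_inv_linear)

lemma herm_chern10_ext:
  assumes s: "s \<in> fspace \<Omega> F UNIV" and t: "t \<in> fspace \<Omega> F (form \<Omega> 1)"
  shows "herm \<Omega> h (chern10_ext s) t = del \<Omega> (herm \<Omega> h s t)
    - grade_inv \<Omega> (herm \<Omega> h s (extension \<Omega> F (delbar \<Omega>) dbar t))"
  using t
proof (induction t rule: fspace_induct)
  case (ftensor \<nu> g)
  let ?g = "grade_inv \<Omega>"
  have "delbar \<Omega> \<nu> \<in> form \<Omega> 2"
    using delbar_form[OF ftensor] by (simp add: numeral_2_eq_2)
  then have d: "?g (fstar \<Omega> (delbar \<Omega> \<nu>)) = fstar \<Omega> (delbar \<Omega> \<nu>)"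
    using grade_inv_form[OF fstar_form] by (simp add: scaleC_one)
  have n: "?g (fstar \<Omega> \<nu>) = - fstar \<Omega> \<nu>" "?g \<nu> = - \<nu>"
    using grade_inv_form_1 fstar_form ftensor by auto
  have "herm \<Omega> h s (extension \<Omega> F (delbar \<Omega>) dbar (ftensor \<Omega> F \<nu> g))
      = herm \<Omega> h s (sec g) * fstar \<Omega> (delbar \<Omega> \<nu>) + herm \<Omega> h s (dbar g) * fstar \<Omega> \<nu>"
    by (simp add: extension_dbar_ftensor herm_linear herm_ftensor_right[OF s, of "delbar \<Omega> \<nu>"]
        herm_fwedge_right[OF s dbar_form] grade_inv_grade_inv)
  then show ?case
    by (simp add: herm_ftensor_right[OF s, of \<nu>] herm_ftensor_right[of "chern10_ext s" \<nu>] s herm_chern10_ext_sec grade_inv_mult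
        grade_inv_linear d[unfolded fstar_delbar] n del_mult fstar_delbar distrib_right)
qed (simp_all add: herm_linear del_linear grade_inv_linear clinearD[OF clinear_extension_dbar]
    complex_vector.subspace_scale)

text \<open>
  Let \<open>D\<close> be the extension of \<open>chern10\<close>. By adjointness \<open>\<langle>D (D s), g\<rangle>\<close> is
  \<open>\<partial>\<langle>D s, g\<rangle> \<plusminus> \<langle>D s, dbar g\<rangle>\<close>. Flatness of \<open>dbar\<close> reduces \<open>\<langle>D s, dbar g\<rangle>\<close> to \<open>\<partial>\<langle>s, dbar g\<rangle>\<close>, which
  cancels against the same term in \<open>\<partial>\<langle>D s, g\<rangle>\<close>; the remaining term is \<open>\<partial>\<^sup>2\<langle>s, g\<rangle>\<close>.
\<close>

lemma chern10_ext_twice: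
  assumes s: "s \<in> fspace \<Omega> F UNIV"
  shows "chern10_ext (chern10_ext s) = 0"
proof (rule herm_eqI)
  fix g
  have "herm \<Omega> h (chern10_ext s) (dbar g) = del \<Omega> (herm \<Omega> h s (dbar g))"
    using herm_chern10_ext[OF s dbar_form] by (simp add: dbar_flat herm_linear grade_inv_linear)
  then show "herm \<Omega> h (chern10_ext (chern10_ext s)) (sec g) = herm \<Omega> h 0 (sec g)"
    using s by (simp add: herm_chern10_ext_sec del_linear del_del del_grade_inv herm_linear)
qed (simp_all add: s)

end

section \<open>Covariance\<close>

context covariant_bundle
begin

text \<open>
  For \<open>\<phi>\<close> in the dual, the map sending \<open>f\<close> to \<open>S (f_(-1)) \<phi>(f_(0))_(-1) \<otimes> \<phi>(f_(0))_(0)\<close> is left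
  \<open>M\<close>-linear, so by the dual basis it is evaluation of an element of \<open>A \<otimes> dual\<close>.
\<close>

definition coact_eval :: "('f \<Rightarrow> 'w) \<Rightarrow> 'f \<Rightarrow> 'a \<otimes>\<^sub>C 'w" where
  "coact_eval \<phi> f =
     tensor_lift (\<lambda>a g. tensor_map ((*) (antipode H a)) id (fcoact \<Omega> (\<phi> g))) (vcoact F f)"

lemma clinear_left_mult_map:
  "clinear k \<Longrightarrow> clinear g \<Longrightarrow>
    clinear (\<lambda>x. tensor_map ((*) (k x :: 'x::complex_algebra)) g (t :: 'x \<otimes>\<^sub>C 'y::complex_vector))"
  unfolding tensor_map_def by (simp add: lin clinear_comp[of g])

text \<open>
  By coassociativity the left-hand side is \<open>S (\<omega>_(-2) a) \<omega>_(-1) \<otimes> \<omega>_(0)\<close>, to which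
  \<open>antipode_absorb\<close> applies.
\<close>

lemma forms_antipode_cancel:
  "tensor_lift (\<lambda>x \<nu>. tensor_map ((*) (antipode H (x * a))) id (fcoact \<Omega> \<nu>)) (fcoact \<Omega> \<omega>)
    = antipode H a \<otimes>\<^sub>C \<omega>"
proof -
  have "tensor_map ((*) (antipode H (x * a))) id t
      = tensor_lift (\<lambda>y \<nu>. (antipode H (x * a) * y) \<otimes>\<^sub>C \<nu>) t" for x and t :: "'a \<otimes>\<^sub>C 'w"
    by (simp add: tensor_map_def)
  then have "tensor_lift (\<lambda>x \<nu>. tensor_map ((*) (antipode H (x * a))) id (fcoact \<Omega> \<nu>)) (fcoact \<Omega> \<omega>)
      = tensor_lift (\<lambda>x \<nu>. tensor_lift (\<lambda>y \<nu>. (antipode H (x * a) * y) \<otimes>\<^sub>C \<nu>) (fcoact \<Omega> \<nu>)) (fcoact \<Omega> \<omega>)"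
    by simp
  also have "\<dots> = tensor_lift (\<lambda>x \<nu>. tensor_lift (\<lambda>x y. (antipode H (x * a) * y) \<otimes>\<^sub>C \<nu>) (comult H x)) (fcoact \<Omega> \<omega>)"
    by (rule comodule_coassoc[OF comodule_forms clinear_comult, symmetric]) (simp add: lin)
  also have "\<dots> = tensor_lift (\<lambda>x \<nu>. tensor_lift (\<lambda>x y. antipode H (x * a) * y) (comult H x) \<otimes>\<^sub>C \<nu>) (fcoact \<Omega> \<omega>)"
    by (subst tensor_lift_comp[where g = "\<lambda>z. z \<otimes>\<^sub>C _"]) (simp_all add: lin tensor_add_left)
  also have "\<dots> = tensor_lift (\<lambda>x \<nu>. antipode H a \<otimes>\<^sub>C (counit H x *\<^sub>C \<nu>)) (fcoact \<Omega> \<omega>)"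
    by (simp add: antipode_absorb tensor_scaleC_left tensor_scaleC_right)
  also have "\<dots> = antipode H a \<otimes>\<^sub>C \<omega>"
    by (rule comodule_counit[OF comodule_forms clinear_counit]) (simp add: tensor_add_right)
  finally show ?thesis .
qed

text \<open>
  Left \<open>M\<close>-linearity: the factor \<open>m_(-1)\<close> under the antipode is cancelled by the one that the
  coaction of \<open>m_(0) \<phi>(f_(0))\<close> produces.
\<close>

lemma coact_eval_act:
  assumes \<phi>: "\<phi> \<in> dual \<Omega> F" and m: "m \<in> base \<Omega>"
  shows "coact_eval \<phi> (act F m f) = tensor_map id ((*) m) (coact_eval \<phi> f)"
proof -
  note [lin] = clinear_comp[OF clinear_dual[OF \<phi>]] clinear_mult_map clinear_left_mult_map
  let ?L = "tensor_lift (\<lambda>a g. tensor_map ((*) (antipode H a)) id (fcoact \<Omega> (\<phi> g)))"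
  have L: "?L (tensor_mult_on (base \<Omega>) (act F) y (b \<otimes>\<^sub>C g))
      = tensor_lift (\<lambda>x \<nu>. tensor_map ((*) (antipode H (x * b))) id (tensor_mult (*) (fcoact \<Omega> \<nu>) (fcoact \<Omega> (\<phi> g)))) y"
    if "y \<in> tensor_space UNIV (base \<Omega>)" for y b g
    using csubspace_UNIV form_subspace that
  proof (induction y rule: tensor_space_induct)
    case (tensor a n)
    have [lin]: "clinear (\<lambda>x. act F n (k x))" if "clinear k" for k :: "'z::complex_vector \<Rightarrow> 'f"
      using clinear_comp[OF clinear_act that] tensor by simp
    show ?case
      using tensor by (simp add: tensor_mult_act_tensor tensor_lift_tensor lin dual_act_left[OF \<phi>] fcoact_mult)
  qed (simp add: tensor_mult_act_add tensor_lift_add lin)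
  have swap: "tensor_map ((*) c) id (tensor_mult (*) s t) = tensor_mult (*) (tensor_map ((*) c) id s) t"
    for c :: 'a and s t :: "'a \<otimes>\<^sub>C 'w"
  proof (induction s rule: tensor_induct)
    case (tensor a \<omega>)
    show ?case
      by (induction t rule: tensor_induct)
        (simp_all add: tensor_mult_tensor tensor_mult_add tensor_map_tensor tensor_map_add lin mult.assoc)
  qed (simp add: tensor_mult_add tensor_map_add lin)
  have pure: "?L (tensor_mult_on (base \<Omega>) (act F) (fcoact \<Omega> m) (b \<otimes>\<^sub>C g))
      = tensor_map id ((*) m) (tensor_map ((*) (antipode H b)) id (fcoact \<Omega> (\<phi> g)))" for b g
  proof -
    have "?L (tensor_mult_on (base \<Omega>) (act F) (fcoact \<Omega> m) (b \<otimes>\<^sub>C g))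
        = tensor_lift (\<lambda>x \<nu>. tensor_mult (*) (tensor_map ((*) (antipode H (x * b))) id (fcoact \<Omega> \<nu>))
            (fcoact \<Omega> (\<phi> g))) (fcoact \<Omega> m)"
      by (simp only: L[OF fcoact_form[OF m]] swap)
    also have "\<dots> = tensor_mult (*) (antipode H b \<otimes>\<^sub>C m) (fcoact \<Omega> (\<phi> g))"
      unfolding forms_antipode_cancel[symmetric]
      by (rule tensor_lift_comp[symmetric]) (simp_all add: lin tensor_mult_add)
    also have "\<dots> = tensor_map id ((*) m) (tensor_map ((*) (antipode H b)) id (fcoact \<Omega> (\<phi> g)))"
    proof -
      have "tensor_mult (*) (c \<otimes>\<^sub>C m) t = tensor_map id ((*) m) (tensor_map ((*) c) id t)"
        for c and t :: "'a \<otimes>\<^sub>C 'w"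
        by (induction t rule: tensor_induct)
          (simp_all add: tensor_mult_tensor tensor_mult_add tensor_map_tensor tensor_map_add lin)
      then show ?thesis .
    qed
    finally show ?thesis .
  qed
  have "?L (tensor_mult_on (base \<Omega>) (act F) (fcoact \<Omega> m) t) = tensor_map id ((*) m) (?L t)" for t
  proof (induction t rule: tensor_induct)
    case (tensor b g)
    have "?L (b \<otimes>\<^sub>C g) = tensor_map ((*) (antipode H b)) id (fcoact \<Omega> (\<phi> g))"
      by (rule tensor_lift_tensor) (simp add: lin)
    then show ?case by (simp only: pure)
  next
    case (add s t)
    have "tensor_mult_on (base \<Omega>) (act F) y (s + t)
        = tensor_mult_on (base \<Omega>) (act F) y s + tensor_mult_on (base \<Omega>) (act F) y t"
      if "y \<in> tensor_space UNIV (base \<Omega>)" for y :: "'a \<otimes>\<^sub>C 'w"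
      using csubspace_UNIV form_subspace that
    proof (induction y rule: tensor_space_induct)
      case (tensor a n)
      have [lin]: "clinear (\<lambda>x. act F n (k x))" if "clinear k" for k :: "'z::complex_vector \<Rightarrow> 'f"
        using clinear_comp[OF clinear_act that] tensor by simp
      show ?case using tensor by (simp add: tensor_mult_act_tensor tensor_lift_add lin)
    qed (simp add: tensor_mult_act_add)
    then show ?case using add by (simp add: fcoact_form[OF m] tensor_lift_add tensor_map_add lin)
  qed
  then show ?thesis by (simp add: coact_eval_def vcoact_act[OF m])
qed

lemma coact_eval_add:
  assumes "\<phi> \<in> dual \<Omega> F"
  shows "coact_eval \<phi> (f + g) = coact_eval \<phi> f + coact_eval \<phi> g"
proof -
  note [lin] = clinear_comp[OF clinear_dual[OF assms]] clinear_mult_map clinear_left_mult_map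
  show ?thesis
    unfolding coact_eval_def by (simp add: clinearD[OF clinear_vcoact] tensor_lift_add lin)
qed

lemma coact_eval_in:
  assumes \<phi>: "\<phi> \<in> dual \<Omega> F"
  shows "coact_eval \<phi> f \<in> tensor_space UNIV (base \<Omega>)"
proof -
  note [lin] = clinear_comp[OF clinear_dual[OF \<phi>]] clinear_mult_map clinear_left_mult_map
  have in_base: "tensor_map ((*) a) id t \<in> tensor_space UNIV (base \<Omega>)"
    if "t \<in> tensor_space UNIV (base \<Omega>)" for a :: 'a and t
    using csubspace_UNIV form_subspace that
    by (induction t rule: tensor_space_induct)
      (simp_all add: tensor_map_tensor tensor_map_add lin tensor_in_tensor_space complex_vector.subspace_add)
  have "tensor_lift (\<lambda>a g. tensor_map ((*) (antipode H a)) id (fcoact \<Omega> (\<phi> g))) t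
      \<in> tensor_space UNIV (base \<Omega>)" for t
  proof (induction t rule: tensor_induct)
    case (tensor b g)
    have "tensor_lift (\<lambda>a g. tensor_map ((*) (antipode H a)) id (fcoact \<Omega> (\<phi> g))) (b \<otimes>\<^sub>C g)
        = tensor_map ((*) (antipode H b)) id (fcoact \<Omega> (\<phi> g))"
      by (rule tensor_lift_tensor) (simp add: lin)
    then show ?case using in_base[OF fcoact_form[OF dual_base[OF \<phi>]]] by (simp only:)
  qed (simp add: tensor_lift_add lin complex_vector.subspace_add)
  then show ?thesis by (simp add: coact_eval_def)
qed

text \<open>
  The coaction on the dual is given by a definite description, which is meaningful because an element of
  \<open>A \<otimes> dual\<close> is recovered from its evaluations at a dual basis (uniqueness), and because
  gluing the values of an \<open>M\<close>-linear map at that basis gives an element with the prescribed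
  evaluations (existence).
\<close>

lemma dual_coact:
  assumes \<phi>: "\<phi> \<in> dual \<Omega> F"
  shows "tensor_map id (\<lambda>\<psi>. \<psi> f) (dual_coact H \<Omega> F \<phi>) = coact_eval \<phi> f"
proof -
  obtain n :: nat and e \<theta> where "\<forall>i. \<theta> i \<in> dual \<Omega> F" and basis: "\<forall>f. f = (\<Sum>i<n. act F (\<theta> i f) (e i))"
    by (rule dual_basis)
  then have \<theta>: "\<And>i. \<theta> i \<in> dual \<Omega> F" by blast
  let ?ev = "\<lambda>f. tensor_map id (\<lambda>\<psi> :: 'f \<Rightarrow> 'w. \<psi> f) :: 'a \<otimes>\<^sub>C ('f \<Rightarrow> 'w) \<Rightarrow> 'a \<otimes>\<^sub>C 'w"
  let ?glue = "\<lambda>T :: 'f \<Rightarrow> 'a \<otimes>\<^sub>C 'w. \<Sum>i<n. tensor_map id (dual_act (\<theta> i)) (T (e i))"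
  have ev_sum: "?ev f (\<Sum>i<n. t i) = (\<Sum>i<n. ?ev f (t i))" for f and t :: "nat \<Rightarrow> 'a \<otimes>\<^sub>C ('f \<Rightarrow> 'w)"
    by (rule complex_vector.linear_sum) (simp add: lin)
  have ev_glue: "?ev f (?glue T) = T f"
    if add: "\<And>f g. T (f + g) = T f + T g"
      and act: "\<And>m f. m \<in> base \<Omega> \<Longrightarrow> T (act F m f) = tensor_map id ((*) m) (T f)" for T f
  proof -
    have "?ev f (tensor_map id (dual_act (\<theta> i)) t) = tensor_map id ((*) (\<theta> i f)) t" for i t
      by (induction t rule: tensor_induct)
        (simp_all add: tensor_map_tensor tensor_map_add lin clinear_mult_map clinear_dual_act, simp add: dual_act_def)
    then have "?ev f (?glue T) = (\<Sum>i<n. T (act F (\<theta> i f) (e i)))"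
      by (simp add: ev_sum act dual_base[OF \<theta>])
    also have "\<dots> = T (\<Sum>i<n. act F (\<theta> i f) (e i))"
    proof -
      have "T 0 = 0" using add[of 0 0] by simp
      then have "(\<Sum>i\<in>I. T (k i)) = T (\<Sum>i\<in>I. k i)" for I and k :: "nat \<Rightarrow> 'f"
        by (induction I rule: infinite_finite_induct) (simp_all add: add)
      then show ?thesis .
    qed
    finally show ?thesis using basis by simp
  qed
  have glue_ev: "?glue (\<lambda>f. ?ev f t) = t" if "t \<in> tensor_space UNIV (dual \<Omega> F)" for t
    using csubspace_UNIV dual_subspace that
  proof (induction t rule: tensor_space_induct)
    case (tensor a \<psi>)
    have "(\<Sum>i<n. dual_act (\<theta> i) (\<psi> (e i))) = \<psi>"
      using dual_expansion[OF basis \<theta> tensor(2)] by (rule sym)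
    moreover have "(\<Sum>i<n. tensor_map id (dual_act (\<theta> i)) (?ev (e i) (a \<otimes>\<^sub>C \<psi>)))
        = a \<otimes>\<^sub>C (\<Sum>i<n. dual_act (\<theta> i) (\<psi> (e i)))"
      using complex_vector.linear_sum[OF clinear_tensor_right[OF clinear_id, of a],
          of "\<lambda>i. dual_act (\<theta> i) (\<psi> (e i))" "{..<n}"]
      by (simp add: tensor_map_tensor lin clinear_dual_act)
    ultimately show ?case by (simp only:)
  next
    case (add s t)
    then show ?case by (simp add: tensor_map_add lin clinear_dual_act sum.distrib)
  qed
  have glue_in: "?glue T \<in> tensor_space UNIV (dual \<Omega> F)" if "\<And>f. T f \<in> tensor_space UNIV (base \<Omega>)" for T
  proof (intro complex_vector.subspace_sum tensor_space_subspace)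
    fix i
    have "tensor_map id (dual_act (\<theta> i)) t \<in> tensor_space UNIV (dual \<Omega> F)"
      if "t \<in> tensor_space UNIV (base \<Omega>)" for t :: "'a \<otimes>\<^sub>C 'w"
      using csubspace_UNIV form_subspace that
      by (induction t rule: tensor_space_induct)
        (simp_all add: tensor_map_tensor tensor_map_add lin clinear_dual_act tensor_in_tensor_space
          dual_act_closed \<theta> complex_vector.subspace_add)
    then show "tensor_map id (dual_act (\<theta> i)) (T (e i)) \<in> tensor_space UNIV (dual \<Omega> F)"
      using that by blast
  qed
  let ?P = "\<lambda>t. t \<in> tensor_space UNIV (dual \<Omega> F) \<and> (\<forall>f. ?ev f t = coact_eval \<phi> f)"
  have "?P (THE t. ?P t)"
  proof (rule theI)
    show "?P (?glue (coact_eval \<phi>))"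
      using glue_in coact_eval_in[OF \<phi>] ev_glue coact_eval_add[OF \<phi>] coact_eval_act[OF \<phi>] by blast
    show "t = ?glue (coact_eval \<phi>)" if "?P t" for t
      using glue_ev[of t] that by simp
  qed
  then show ?thesis unfolding dual_coact_def coact_eval_def by blast
qed

end

subsection \<open>Products of coactions\<close>

context hopf_star
begin

text \<open>
  The product \<open>s t\<^sup>*\<close> with legs \<open>a b\<^sup>*\<close> and \<open>\<beta> v u\<close>; it is used for \<open>\<beta>\<close> linear in the first and
  conjugate-linear in the second argument.
\<close>

definition sesq_mult :: "('v::complex_vector \<Rightarrow> 'u::complex_vector \<Rightarrow> 'z::complex_vector) \<Rightarrow>
    'a \<otimes>\<^sub>C 'v \<Rightarrow> 'a \<otimes>\<^sub>C 'u \<Rightarrow> 'a \<otimes>\<^sub>C 'z" where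
  "sesq_mult \<beta> s t = tensor_lift (\<lambda>a v. tensor_lift (\<lambda>b u. (a * hstar H b) \<otimes>\<^sub>C \<beta> v u) t) s"

lemma hstar_one: "hstar H 1 = 1"
  using hstar_mult[of "hstar H 1" 1] by simp

context
  fixes \<beta> :: "'v::complex_vector \<Rightarrow> 'u::complex_vector \<Rightarrow> 'z::complex_vector"
  assumes \<beta>: "\<And>u. clinear (\<lambda>v. \<beta> v u)" "\<And>v. antilinear (\<beta> v)"
begin

lemmas [lin] = clinear_comp[OF \<beta>(1)] antilinear_comp'[OF \<beta>(2)]

lemma sesq_mult_tensor: "sesq_mult \<beta> (a \<otimes>\<^sub>C v) (b \<otimes>\<^sub>C u) = (a * hstar H b) \<otimes>\<^sub>C \<beta> v u"
  unfolding sesq_mult_def by (simp add: tensor_lift_tensor lin)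

lemma sesq_mult_add_left: "sesq_mult \<beta> (s + s') t = sesq_mult \<beta> s t + sesq_mult \<beta> s' t"
  unfolding sesq_mult_def by (simp add: tensor_lift_add lin)

lemma sesq_mult_add_right: "sesq_mult \<beta> s (t + t') = sesq_mult \<beta> s t + sesq_mult \<beta> s t'"
  by (induction s rule: tensor_induct)
    (simp_all add: sesq_mult_add_left, simp add: sesq_mult_def tensor_lift_tensor tensor_lift_add lin)

lemma sesq_mult_diff_left: "sesq_mult \<beta> (s - s') t = sesq_mult \<beta> s t - sesq_mult \<beta> s' t"
  using sesq_mult_add_left[of "s - s'" s' t] by simp

lemma sesq_mult_swap:
  "sesq_mult \<beta> s t = tensor_lift (\<lambda>b u. tensor_lift (\<lambda>a v. (a * hstar H b) \<otimes>\<^sub>C \<beta> v u) s) t"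
proof (induction t rule: tensor_induct)
  case (tensor b u)
  show ?case
    by (induction s rule: tensor_induct)
      (simp_all add: sesq_mult_add_left sesq_mult_tensor tensor_lift_tensor tensor_lift_add lin)
qed (simp add: sesq_mult_add_right tensor_lift_add lin)

text \<open>
  In Sweedler notation, if \<open>a g_(-1)^* \<otimes> \<beta> v g_(0)\<close> vanishes for all \<open>g\<close>, then so does
  \<open>a g_(-1)^* S(g_(-2))^* \<otimes> \<beta> v g_(0)\<close>, which is \<open>a \<otimes> \<beta> v g\<close> by the antipode axiom.
\<close>

lemma sesq_mult_cancel:
  assumes \<delta>: "left_comodule H \<delta>" and zero: "\<And>g. sesq_mult \<beta> s (\<delta> g) = 0"
  shows "tensor_map id (\<lambda>v. \<beta> v g) s = 0"
proof -
  note [lin] = clinear_comp[OF comodule_clinear[OF \<delta>]]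
  let ?S = "antipode H"
  let ?G = "\<lambda>z u. tensor_lift (\<lambda>a v. (a * hstar H z) \<otimes>\<^sub>C \<beta> v u) s"
  have G_add: "?G (z + z') u = ?G z u + ?G z' u" for z z' u
    by (rule antilinearD(1)) (simp add: lin)
  have "tensor_map (\<lambda>a. a * hstar H (?S c)) id (sesq_mult \<beta> s t) = tensor_lift (\<lambda>b u. ?G (?S c * b) u) t"
    for c t
  proof (induction t rule: tensor_induct)
    case (tensor b u)
    show ?case
      by (induction s rule: tensor_induct)
        (simp_all add: sesq_mult_add_left sesq_mult_tensor tensor_lift_tensor tensor_lift_add
          tensor_map_tensor tensor_map_add lin hstar_mult mult.assoc)
  qed (simp add: sesq_mult_add_right tensor_map_add tensor_lift_add lin)
  from this[of _ "\<delta> _"] have "tensor_lift (\<lambda>b u. ?G (?S c * b) u) (\<delta> g') = 0" for c g'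
    by (simp add: zero tensor_map_def tensor_lift_zero lin)
  then have "0 = tensor_lift (\<lambda>c g'. tensor_lift (\<lambda>b u. ?G (?S c * b) u) (\<delta> g')) (\<delta> g)"
    by (simp add: tensor_lift_fun_zero)
  also have "\<dots> = tensor_lift (\<lambda>c u. tensor_lift (\<lambda>c1 c2. ?G (?S c1 * c2) u) (comult H c)) (\<delta> g)"
    by (rule comodule_coassoc[OF \<delta> clinear_comult, symmetric]) (simp add: lin)
  also have "\<dots> = tensor_lift (\<lambda>c u. ?G (tensor_lift (\<lambda>c1 c2. ?S c1 * c2) (comult H c)) u) (\<delta> g)"
    by (subst tensor_lift_comp[where g = "\<lambda>z. ?G z _"]) (simp_all add: G_add, simp_all add: lin)
  also have "\<dots> = tensor_lift (\<lambda>c u. tensor_lift (\<lambda>a v. a \<otimes>\<^sub>C \<beta> v (counit H c *\<^sub>C u)) s) (\<delta> g)"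
    by (simp add: antipode_left antilinearD[OF antilinear_hstar] hstar_one mult_scaleC_right
        antilinearD[OF \<beta>(2)] tensor_scaleC_left tensor_scaleC_right)
  also have "\<dots> = tensor_lift (\<lambda>a v. a \<otimes>\<^sub>C \<beta> v g) s"
    by (rule comodule_counit[OF \<delta> clinear_counit]; rule antilinearD(1)) (simp add: lin)
  finally show ?thesis by (simp add: tensor_map_def)
qed

lemma sesq_mult_map:
  assumes "clinear p" "clinear q"
  shows "sesq_mult \<beta> (tensor_map id p s) (tensor_map id q t) = sesq_mult (\<lambda>v u. \<beta> (p v) (q u)) s t"
proof -
  note [lin] = assms clinear_comp[OF assms(1)] clinear_comp[OF assms(2)]
  show ?thesis
  proof (induction s rule: tensor_induct)
    case (tensor a v)
    show ?case
      by (induction t rule: tensor_induct)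
        (simp_all add: tensor_map_tensor tensor_map_add lin sesq_mult_tensor sesq_mult_add_right
          hopf_star.sesq_mult_tensor[OF hopf_star_axioms] hopf_star.sesq_mult_add_right[OF hopf_star_axioms])
  qed (simp add: tensor_map_add lin sesq_mult_add_left hopf_star.sesq_mult_add_left[OF hopf_star_axioms])
qed

lemma map_sesq_mult:
  assumes "clinear p"
  shows "tensor_map id p (sesq_mult \<beta> s t) = sesq_mult (\<lambda>v u. p (\<beta> v u)) s t"
proof -
  note [lin] = assms clinear_comp[OF assms(1)] antilinear_comp[OF assms(1)]
  show ?thesis
  proof (induction s rule: tensor_induct)
    case (tensor a v)
    show ?case
      by (induction t rule: tensor_induct)
        (simp_all add: tensor_map_tensor tensor_map_add lin sesq_mult_tensor sesq_mult_add_right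
          hopf_star.sesq_mult_tensor[OF hopf_star_axioms] hopf_star.sesq_mult_add_right[OF hopf_star_axioms])
  qed (simp add: tensor_map_add lin sesq_mult_add_left hopf_star.sesq_mult_add_left[OF hopf_star_axioms])
qed

end

lemma sesq_mult_fun_diff:
  assumes "\<And>u. clinear (\<lambda>v. \<beta> v u)" "\<And>v. antilinear (\<beta> v)" "\<And>u. clinear (\<lambda>v. \<gamma> v u)" "\<And>v. antilinear (\<gamma> v)"
  shows "sesq_mult (\<lambda>v u. \<beta> v u - \<gamma> v u) s t = sesq_mult \<beta> s t - sesq_mult \<gamma> s t"
proof -
  note [lin] = clinear_comp[OF assms(1)] antilinear_comp'[OF assms(2)] clinear_comp[OF assms(3)] antilinear_comp'[OF assms(4)]
  have tensor_diff: "a \<otimes>\<^sub>C (x - y) = a \<otimes>\<^sub>C x - a \<otimes>\<^sub>C y" for a :: 'a and x y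
    by (rule clinearD(4)) (simp add: lin)
  show ?thesis
  proof (induction s rule: tensor_induct)
    case (tensor a v)
    show ?case
      by (induction t rule: tensor_induct)
        (simp_all add: sesq_mult_tensor sesq_mult_add_right lin tensor_diff)
  qed (simp add: sesq_mult_add_left lin)
qed

end

context hermitian_bundle
begin

lemma coact_eval_h: "coact_eval (h g) f = tensor_lift (\<lambda>b k. hstar H b \<otimes>\<^sub>C h k f) (vcoact F g)"
proof -
  have eval: "tensor_map id (\<lambda>\<psi>. \<psi> f) (b \<otimes>\<^sub>C \<phi>) = b \<otimes>\<^sub>C \<phi> f" for b :: 'a and \<phi> :: "'f \<Rightarrow> 'w"
    by (simp add: tensor_map_tensor lin)
  have "coact_eval (h g) f
      = tensor_map id (\<lambda>\<psi>. \<psi> f) (tensor_lift (\<lambda>b k. hstar H b \<otimes>\<^sub>C h k) (vcoact F g))"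
    using dual_coact[OF h_dual] by (simp only: dual_coact_h[symmetric])
  also have "\<dots> = tensor_lift (\<lambda>b k. tensor_map id (\<lambda>\<psi>. \<psi> f) (hstar H b \<otimes>\<^sub>C h k)) (vcoact F g)"
    by (rule tensor_lift_comp) (simp_all add: lin tensor_map_add)
  finally show ?thesis by (simp only: eval)
qed

text \<open>
  Covariance of \<open>h\<close> says \<open>S (f_(-1)) h(g, f_(0))_(-1) \<otimes> h(g, f_(0))_(0) = g_(-1)^* \<otimes> h(g_(0), f)\<close>.
  Applying this to \<open>f_(0)\<close> and multiplying by \<open>f_(-1)\<close> removes the antipode.
\<close>

lemma fcoact_h: "fcoact \<Omega> (h g f) = sesq_mult (\<lambda>f g. h g f) (vcoact F f) (vcoact F g)"
proof -
  let ?S = "antipode H"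
  let ?m = "\<lambda>a t. tensor_map ((*) a) id t :: 'a \<otimes>\<^sub>C 'w"
  note [lin] = clinear_mult_map clinear_left_mult_map
  have m_m: "?m a (?m b t) = ?m (a * b) t" for a b t
    by (induction t rule: tensor_induct) (simp_all add: tensor_map_tensor tensor_map_add lin mult.assoc)
  have m_add: "?m (a + b) t = ?m a t + ?m b t" for a b t
    by (rule clinearD(1)) (simp add: lin)
  have m_add': "?m a (s + t) = ?m a s + ?m a t" for a s t
    by (rule tensor_map_add) (simp add: lin)
  have m_one: "?m (c *\<^sub>C 1) t = c *\<^sub>C t" for c t
    by (induction t rule: tensor_induct)
      (simp_all add: tensor_map_tensor tensor_map_add lin mult_scaleC_left tensor_scaleC_left scaleC_add_right)
  have "sesq_mult (\<lambda>f g. h g f) (vcoact F f) (vcoact F g)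
      = tensor_lift (\<lambda>a k. ?m a (coact_eval (h g) k)) (vcoact F f)"
  proof -
    have "?m a (hstar H b \<otimes>\<^sub>C \<omega>) = (a * hstar H b) \<otimes>\<^sub>C \<omega>" for a b and \<omega> :: 'w
      by (simp add: tensor_map_tensor lin)
    moreover have "?m a (coact_eval (h g) k) = tensor_lift (\<lambda>b l. ?m a (hstar H b \<otimes>\<^sub>C h l k)) (vcoact F g)" for a k
      unfolding coact_eval_h by (rule tensor_lift_comp) (simp_all only: m_add', simp add: lin)
    ultimately show ?thesis by (simp only: sesq_mult_def)
  qed
  also have "\<dots> = tensor_lift (\<lambda>a k. tensor_lift (\<lambda>b l. ?m (a * ?S b) (fcoact \<Omega> (h g l))) (vcoact F k)) (vcoact F f)"
  proof -
    have "?m a (coact_eval (h g) k) = tensor_lift (\<lambda>b l. ?m a (?m (?S b) (fcoact \<Omega> (h g l)))) (vcoact F k)" for a k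
      unfolding coact_eval_def by (rule tensor_lift_comp) (simp_all only: m_add', simp add: lin)
    then show ?thesis by (simp only: m_m)
  qed
  also have "\<dots> = tensor_lift (\<lambda>a l. tensor_lift (\<lambda>a b. ?m (a * ?S b) (fcoact \<Omega> (h g l))) (comult H a)) (vcoact F f)"
    by (rule comodule_coassoc[OF comodule_bundle clinear_comult, symmetric]) (simp add: lin)
  also have "\<dots> = tensor_lift (\<lambda>a l. ?m (tensor_lift (\<lambda>a b. a * ?S b) (comult H a)) (fcoact \<Omega> (h g l))) (vcoact F f)"
    by (subst tensor_lift_comp[where g = "\<lambda>z. ?m z _"]) (simp_all only: m_add, simp_all add: lin)
  also have "\<dots> = tensor_lift (\<lambda>a l. fcoact \<Omega> (h g (counit H a *\<^sub>C l))) (vcoact F f)"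
    by (simp only: antipode_right m_one clinearD[OF clinear_h] fcoact_linear)
  also have "\<dots> = fcoact \<Omega> (h g f)"
    by (rule comodule_counit[OF comodule_bundle clinear_counit]) (simp only: clinearD[OF clinear_h] fcoact_linear)
  finally show ?thesis ..
qed

text \<open>
  Multiplicativity of the coaction on forms reduces this to the previous lemma: what remains is an
  identity that is additive in each of the coactions of \<open>\<omega>\<close>, \<open>f\<close>, \<open>\<nu>\<close> and \<open>g\<close>, and it holds for
  pure tensors because \<open>(c e)\<^sup>* = e\<^sup>* c\<^sup>*\<close>.
\<close>

lemma fcoact_herm:
  assumes s: "s \<in> fspace \<Omega> F UNIV" and t: "t \<in> fspace \<Omega> F UNIV"
  shows "fcoact \<Omega> (herm \<Omega> h s t) = sesq_mult (herm \<Omega> h) (ftensor_coact \<Omega> F s) (ftensor_coact \<Omega> F t)"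
proof -
  note herm_lin = clinear_herm antilinear_herm
  have h_lin: "clinear (\<lambda>f. h g f)" "antilinear (\<lambda>g. h g f)" for f g
    by (simp_all add: clinear_h antilinear_h_left)
  note sm = sesq_mult_tensor[of "\<lambda>f g. h g f", OF h_lin] sesq_mult_add_left[of "\<lambda>f g. h g f", OF h_lin]
    sesq_mult_add_right[of "\<lambda>f g. h g f", OF h_lin] sesq_mult_tensor[OF herm_lin]
    sesq_mult_add_left[OF herm_lin] sesq_mult_add_right[OF herm_lin]
    tensor_mult_tensor tensor_mult_add tensor_map_tensor tensor_map_add
  have key: "tensor_mult (*) (tensor_mult (*) x (sesq_mult (\<lambda>f g. h g f) y w)) (tensor_map (hstar H) (fstar \<Omega>) z)
      = sesq_mult (herm \<Omega> h) (tensor_mult (ftensor \<Omega> F) x y) (tensor_mult (ftensor \<Omega> F) z w)" for x y z w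
  proof (induction x rule: tensor_induct)
    case (tensor a \<omega>)
    show ?case
    proof (induction y rule: tensor_induct)
      case (tensor b f)
      show ?case
      proof (induction z rule: tensor_induct)
        case (tensor c \<nu>)
        show ?case
        proof (induction w rule: tensor_induct)
          case (tensor e g)
          show ?case by (simp add: sm lin hstar_mult herm_ftensor mult.assoc)
        qed (simp add: sm lin)
      qed (simp add: sm lin)
    qed (simp add: sm lin)
  qed (simp add: sm lin)
  show ?thesis
    using s
  proof (induction s rule: fspace_induct)
    case zero
    show ?case by (simp add: herm_linear fcoact_linear ftensor_coact_linear sesq_mult_def tensor_lift_zero lin)
  next
    case (ftensor \<omega> f)
    show ?case
      using t
    proof (induction t rule: fspace_induct)
      case zero
      show ?case
        by (simp add: herm_linear fcoact_linear ftensor_coact_linear sesq_mult_swap[OF herm_lin] tensor_lift_zero lin)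
    next
      case (ftensor \<nu> g)
      show ?case
        by (simp only: herm_ftensor fcoact_mult fcoact_h fcoact_fstar key ftensor_coact_ftensor)
    qed (simp_all add: herm_linear fcoact_linear ftensor_coact_linear sm)
  next
    case (add s s')
    then show ?case by (simp add: herm_linear fcoact_linear ftensor_coact_linear sm)
  qed simp
qed

text \<open>
  Nondegeneracy survives tensoring with \<open>A\<close>, since the reconstruction from the pairings with a
  basis can be applied to the second leg.
\<close>

lemma tensor_fspace_eq_0I:
  assumes s: "s \<in> tensor_space UNIV (fspace \<Omega> F UNIV)"
    and zero: "\<And>g. tensor_map id (\<lambda>t. herm \<Omega> h t (ftensor \<Omega> F 1 g)) s = 0"
  shows "(s :: 'a \<otimes>\<^sub>C 'w \<otimes>\<^sub>C 'f) = 0"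
proof -
  obtain n :: nat and e g where basis: "\<forall>f. f = (\<Sum>i<n. act F (h (g i) f) (e i))"
    by (rule hermitian_basis)
  let ?T = "\<lambda>i s. tensor_map id (\<lambda>\<omega>. ftensor \<Omega> F \<omega> (e i))
    (tensor_map id (\<lambda>t. herm \<Omega> h t (ftensor \<Omega> F 1 (g i))) s)"
  have "(\<Sum>i<n. ?T i s) = s"
    using csubspace_UNIV fspace_subspace s
  proof (induction s rule: tensor_space_induct)
    case (tensor a t)
    have "(\<Sum>i<n. ?T i (a \<otimes>\<^sub>C t))
        = a \<otimes>\<^sub>C (\<Sum>i<n. ftensor \<Omega> F (herm \<Omega> h t (ftensor \<Omega> F 1 (g i))) (e i))"
      using complex_vector.linear_sum[OF clinear_tensor_right[OF clinear_id, of a],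
          of "\<lambda>i. ftensor \<Omega> F (herm \<Omega> h t (ftensor \<Omega> F 1 (g i))) (e i)" "{..<n}"]
      by (simp add: tensor_map_tensor lin)
    then show ?case by (simp only: fspace_reconstruct[OF basis tensor(2), symmetric])
  next
    case (add s t)
    then show ?case by (simp add: tensor_map_add lin sum.distrib)
  qed
  moreover have "?T i s = 0" for i
    unfolding zero by (simp add: tensor_map_def tensor_lift_zero lin)
  ultimately show ?thesis by (simp only: sum.neutral_const)
qed

end

context hermitian_holomorphic_bundle
begin

text \<open>
  In the equation \<open>\<langle>chern10 f, g\<rangle> = \<partial>\<langle>f, g\<rangle> - \<langle>f, dbar g\<rangle>\<close> the coaction can be computed on the
  left through \<open>chern10 f\<close> and on the right through \<open>f\<close>. Comparison shows that the difference
  of the two sides of the claim has zero product with the coaction of every \<open>g\<close>.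
\<close>

lemma chern10_coact: "ftensor_coact \<Omega> F (chern10 f) = tensor_map id chern10 (vcoact F f)"
proof -
  let ?s = "ftensor_coact \<Omega> F (chern10 f) - tensor_map id chern10 (vcoact F f)"
  let ?\<beta> = "\<lambda>t g. herm \<Omega> h t (sec g)"
  note herm_lin = clinear_herm antilinear_herm
  have \<beta>: "clinear (\<lambda>t. ?\<beta> t g)" "antilinear (?\<beta> t)" for t g by (simp_all add: lin)
  have id_id: "tensor_map id (\<lambda>x. x) t = t" for t :: "'a \<otimes>\<^sub>C 'v::complex_vector"
    by (induction t rule: tensor_induct) (simp_all add: tensor_map_tensor tensor_map_add lin)
  have s0: "sesq_mult ?\<beta> ?s (vcoact F g) = 0" for g
  proof -
    have \<beta>_map: "sesq_mult ?\<beta> x (vcoact F g) = sesq_mult (herm \<Omega> h) x (ftensor_coact \<Omega> F (sec g))" for x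
      using sesq_mult_map[OF herm_lin clinear_id clinear_ftensor_right, of x 1 "vcoact F g"]
      by (simp only: id_id ftensor_coact_section)
    have h_lin: "clinear (\<lambda>f. h g f)" "antilinear (\<lambda>g. h g f)" for f g
      by (simp_all add: clinear_h antilinear_h_left)
    have "sesq_mult ?\<beta> (ftensor_coact \<Omega> F (chern10 f)) (vcoact F g) = fcoact \<Omega> (herm \<Omega> h (chern10 f) (sec g))"
      by (simp only: \<beta>_map fcoact_herm[OF chern10_in sec_in])
    also have "\<dots> = tensor_map id (del \<Omega>) (sesq_mult (\<lambda>f g. h g f) (vcoact F f) (vcoact F g))
        - sesq_mult (herm \<Omega> h) (tensor_map id sec (vcoact F f)) (tensor_map id dbar (vcoact F g))"
      by (simp only: herm_chern10 fcoact_linear fcoact_del fcoact_h fcoact_herm[OF sec_in dbar_in]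
          ftensor_coact_section dbar_coact)
    also have "\<dots> = sesq_mult (\<lambda>f g. del \<Omega> (h g f)) (vcoact F f) (vcoact F g)
        - sesq_mult (\<lambda>f g. herm \<Omega> h (sec f) (dbar g)) (vcoact F f) (vcoact F g)"
      by (simp only: map_sesq_mult[of "\<lambda>f g. h g f", OF h_lin clinear_del]
          sesq_mult_map[OF herm_lin clinear_ftensor_right clinear_dbar])
    also have "\<dots> = sesq_mult (\<lambda>f g. herm \<Omega> h (chern10 f) (sec g)) (vcoact F f) (vcoact F g)"
      unfolding herm_chern10 by (rule sesq_mult_fun_diff[symmetric]) (simp_all add: lin)
    also have "\<dots> = sesq_mult ?\<beta> (tensor_map id chern10 (vcoact F f)) (vcoact F g)"
      using sesq_mult_map[of ?\<beta>, OF \<beta> clinear_chern10 clinear_id, of "vcoact F f" "vcoact F g"]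
      by (simp only: id_id)
    finally show ?thesis by (simp add: sesq_mult_diff_left[of ?\<beta>, OF \<beta>])
  qed
  have "tensor_map id chern10 t \<in> tensor_space UNIV (fspace \<Omega> F UNIV)" for t :: "'a \<otimes>\<^sub>C 'f"
    by (induction t rule: tensor_induct)
      (simp_all add: tensor_map_tensor tensor_map_add lin clinear_chern10 tensor_in_tensor_space
        complex_vector.subspace_add)
  then have "?s \<in> tensor_space UNIV (fspace \<Omega> F UNIV)"
    by (intro complex_vector.subspace_diff tensor_space_subspace ftensor_coact_in chern10_in)
  from tensor_fspace_eq_0I[OF this] sesq_mult_cancel[of ?\<beta>, OF \<beta> comodule_bundle s0]
  have "?s = 0" by blast
  then show ?thesis by simp
qed

lemma antiholomorphic_chern10: "antiholomorphic_structure \<Omega> F chern10"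
  unfolding antiholomorphic_structure_def covariant_operator_def
  using fspace_mono'[OF _ subset_UNIV] chern10_ext_twice
  by (auto simp: clinear_chern10 chern10_10 chern10_coact chern10_act simp del: One_nat_def)

section \<open>The Chern connection\<close>

text \<open>
  The conjugate of the equation for \<open>chern10\<close>; the two equations together are the Hermitian
  condition.
\<close>

lemma delbar_h: "delbar \<Omega> (h g f) = herm \<Omega> h (dbar f) (sec g) + herm \<Omega> h (sec f) (chern10 g)"
  by (simp add: herm_section_fstar[of "chern10 g"] herm_chern10 fstar_antilinear fstar_del h_fstar
      herm_section_fstar[of "dbar f"])

lemma part01_nabla: "part01 \<Omega> F (\<lambda>f. dbar f + chern10 f) = dbar"
  by (rule ext) (simp add: part01_def tensor_lift_add lin tensor_lift_part[OF dbar_01] tensor_lift_part[OF chern10_10])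

text \<open>
  The \<open>(0, 1)\<close>-part of \<open>\<langle>nabla f, g\<rangle>\<close> is \<open>\<langle>dbar f, g\<rangle>\<close>. The Hermitian condition expresses its
  \<open>(1, 0)\<close>-part by the \<open>(1, 0)\<close>-part of \<open>\<langle>f, nabla g\<rangle>\<close>, which is the conjugate of the
  \<open>(0, 1)\<close>-part of \<open>\<langle>nabla g, f\<rangle>\<close> and hence also determined by \<open>dbar\<close>.
\<close>

lemma chern_unique:
  assumes nabla: "hermitian_connection \<Omega> F h nabla" and p01: "part01 \<Omega> F nabla = dbar"
  shows "nabla f = dbar f + chern10 f"
proof (rule herm_eqI)
  have form: "nabla f \<in> fspace \<Omega> F (form \<Omega> 1)" for f
    using nabla by (simp add: hermitian_connection_def covariant_connection_def covariant_operator_def)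
  show in_UNIV: "nabla f \<in> fspace \<Omega> F UNIV" for f using fspace_mono'[OF form] by blast
  fix g
  let ?x = "\<lambda>f g. herm \<Omega> h (nabla f) (sec g)"
  have h01: "part (0, 1) (?x f g) = herm \<Omega> h (dbar f) (sec g)" for f g
    using p01 in_UNIV by (auto simp: part_herm_left part01_def fun_eq_iff)
  have "herm \<Omega> h t (sec g) \<in> form \<Omega> 1" if "t \<in> fspace \<Omega> F (form \<Omega> 1)" for t
    using that
  proof (induction t rule: fspace_induct)
    case (ftensor \<omega> f)
    then show ?case using form_mult[OF ftensor h_base] by (simp add: herm_ftensor)
  qed (simp_all add: herm_linear complex_vector.subspace_0 complex_vector.subspace_add complex_vector.subspace_scale)
  from this[OF form] have "?x f g \<in> form \<Omega> 1" .
  then have split: "?x f g = part (1, 0) (?x f g) + part (0, 1) (?x f g)"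
    by (rule form_1_parts)
  have "?x f g = ext_d \<Omega> (h g f) - fstar \<Omega> (?x g f)"
    using nabla by (simp add: hermitian_connection_def herm_ftensor herm_section_fstar in_UNIV algebra_simps)
  moreover have "part (1, 0) (ext_d \<Omega> (h g f)) = del \<Omega> (h g f)"
    using del_eq_part[of "h g f" 0 0] h_base[of g f] by (simp add: base_eq)
  ultimately have "part (1, 0) (?x f g) = del \<Omega> (h g f) - fstar \<Omega> (part (0, 1) (?x g f))"
    by (simp add: part_linear part_fstar)
  also have "\<dots> = herm \<Omega> h (chern10 f) (sec g)"
    by (simp only: h01 herm_chern10 herm_section_fstar[OF dbar_in])
  finally show "?x f g = herm \<Omega> h (dbar f + chern10 f) (sec g)"
    using split h01 by (simp add: herm_linear)
qed simp

lemma covariant_connection_sum: "covariant_connection \<Omega> F (\<lambda>f. dbar f + chern10 f)"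
  unfolding covariant_connection_def covariant_operator_def
proof (intro conjI allI ballI)
  show "clinear (\<lambda>f. dbar f + chern10 f)" by (simp add: lin clinear_dbar clinear_chern10)
  show "dbar f + chern10 f \<in> fspace \<Omega> F (form \<Omega> 1)" for f
    by (intro add_in dbar_form chern10_form)
  have "tensor_map id (\<lambda>f. dbar f + chern10 f) t = tensor_map id dbar t + tensor_map id chern10 t"
    for t :: "'a \<otimes>\<^sub>C 'f"
    by (induction t rule: tensor_induct)
      (simp_all add: tensor_map_tensor tensor_map_add lin clinear_dbar clinear_chern10 tensor_add_right)
  then show "ftensor_coact \<Omega> F (dbar f + chern10 f) = tensor_map id (\<lambda>f. dbar f + chern10 f) (vcoact F f)" for f
    by (simp add: ftensor_coact_linear dbar_coact chern10_coact)
  show "dbar (act F m f) + chern10 (act F m f)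
      = ftensor \<Omega> F (ext_d \<Omega> m) f + fwedge \<Omega> F m (dbar f + chern10 f)" if "m \<in> base \<Omega>" for m f
    by (simp add: that dbar_act chern10_act ext_d_eq ftensor_linear fwedge_linear)
qed

lemma chern_connection_sum: "is_chern_connection \<Omega> F dbar h (\<lambda>f. dbar f + chern10 f)"
  unfolding is_chern_connection_def
proof (intro conjI allI impI)
  show "hermitian_connection \<Omega> F h (\<lambda>f. dbar f + chern10 f)"
    unfolding hermitian_connection_def
    by (simp add: covariant_connection_sum herm_ftensor ext_d_eq delbar_h herm_linear herm_chern10)
  show "part01 \<Omega> F (\<lambda>f. dbar f + chern10 f) = dbar" by (rule part01_nabla)
  show "nabla' = (\<lambda>f. dbar f + chern10 f)"
    if "hermitian_connection \<Omega> F h nabla' \<and> part01 \<Omega> F nabla' = dbar" for nabla'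
    using chern_unique that by blast
qed

end

theorem proposition7p3:
  fixes H :: "('a::complex_algebra) hopf"
    and \<Omega> :: "('a, 'w::complex_algebra) complex_calculus"
    and F :: "('a, 'w, 'f::complex_vector) vbundle"
    and dbar :: "'f \<Rightarrow> 'w \<otimes>\<^sub>C 'f"
    and h :: "'f \<Rightarrow> 'f \<Rightarrow> 'w"
  assumes "hopf_star_algebra H"
    and "star_calculus H \<Omega>"
    and "complex_structure \<Omega>"
    and "vector_bundle H \<Omega> F"
    and "holomorphic_structure \<Omega> F dbar"
    and "hermitian_structure H \<Omega> F h"
  defines "del_F \<equiv> conj_del \<Omega> F dbar h"
  shows "(\<forall>a. \<forall>t\<in>fspace \<Omega> F (biform \<Omega> (a, 0)). del_F t \<in> fspace \<Omega> F (biform \<Omega> (Suc a, 0)))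
    \<and> antiholomorphic_structure \<Omega> F (\<lambda>f. del_F (ftensor \<Omega> F 1 f))
    \<and> (\<forall>t\<in>fspace \<Omega> F (\<Union>a. biform \<Omega> (a, 0)).
         del_F t = extension \<Omega> F (del \<Omega>) (\<lambda>f. del_F (ftensor \<Omega> F 1 f)) t)
    \<and> is_chern_connection \<Omega> F dbar h (\<lambda>f. dbar f + del_F (ftensor \<Omega> F 1 f))"
proof -
  interpret hermitian_holomorphic_bundle H \<Omega> F h dbar
    by unfold_locales (fact assms)+
  have del_F: "del_F t = chern10_ext t" if "t \<in> fspace \<Omega> F V" for t V
    unfolding del_F_def using conj_del_eq[OF fspace_mono'[OF that subset_UNIV]] .
  have "(\<lambda>f. del_F (sec f)) = chern10"
    by (rule ext) (simp add: del_F_def conj_del_sec)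
  then show ?thesis
    using del_F chern10_ext_degree antiholomorphic_chern10 chern_connection_sum
    by (simp add: fun_eq_iff)
qed

end
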